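(* Let $(R,\mathfrak m)$ be a commutative Noetherian local ring with $\operatorname{depth} R=t$, and let $M,N$ be finitely generated $R$-modules with $M\in\operatorname{Deep}(R)$ and $N\in\Omega\operatorname{Deep}(R)$. Assume that $\operatorname{Hom}_R(M,N)$ is free and that $\operatorname{Ext}^i_R(M,N)=0$ for all $1\le i\le t-1$. Then $N$ is free.
   Context: All modules are finitely generated. For a Noetherian local ring $R$ with $\operatorname{depth} R=t$: - $\operatorname{Deep}(R)$ is the class of $R$-modules $X$ with $\operatorname{depth} X\ge t$. - $\Omega\operatorname{Deep}(R)$ is the class of $R$-modules $M$ for which there is an exact sequence $0\to M\to R^n\to X\to 0$ with $n\in\mathbb N$ and $X\in\operatorname{Deep}(R)$.
   Formalization: The formal theorem additionally assumes that Hom_R(M,N) is nonzero whenever N is nonzero; without it the claim fails, e.g. R=k[[x,y]]/(x^2,xy), t=0, M=k, N=yR, where Hom_R(M,N)=0 is free of rank 0 but N is not free. *)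

theory Defs
  imports "HOL-Algebra.Algebra" "HOL-Library.Extended_Nat"
begin

locale noetherian_local_ring = cring R + noetherian_ring R for R (structure) +
  assumes local: "\<exists>!I. maximalideal I R"

definition max_ideal :: "('a, 'r) ring_scheme \<Rightarrow> 'a set" where
  "max_ideal R = (THE I. maximalideal I R)"

text \<open>
  The locale \<^locale>\<open>module\<close> only constrains the additive group and the scalar multiplication
  of its second argument, so the ring multiplication and unit carried by the record
  \<^type>\<open>module\<close> are left \<^const>\<open>undefined\<close> below.
\<close>

subsection \<open>Submodules, quotients, homomorphisms, free modules\<close>

definition span_mod :: "('a, 'r) ring_scheme \<Rightarrow> ('a, 'b, 'c) module_scheme \<Rightarrow> 'b set \<Rightarrow> 'b set" where
  "span_mod R M S = (\<lambda>K. submodule K R M) hull S"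

definition fin_gen :: "('a, 'r) ring_scheme \<Rightarrow> ('a, 'b, 'c) module_scheme \<Rightarrow> bool" where
  "fin_gen R M \<longleftrightarrow> module R M \<and>
     (\<exists>S. finite S \<and> S \<subseteq> carrier M \<and> span_mod R M S = carrier M)"

definition zero_module :: "('a, 'b, 'c) module_scheme \<Rightarrow> bool" where
  "zero_module M \<longleftrightarrow> carrier M = {\<zero>\<^bsub>M\<^esub>}"

definition quot_mod :: "('a, 'b, 'c) module_scheme \<Rightarrow> 'b set \<Rightarrow> ('a, 'b set) module" where
  "quot_mod M K =
     \<lparr>carrier = a_rcosets\<^bsub>M\<^esub> K, monoid.mult = undefined, one = undefined,
      ring.zero = K, add = set_add M,
      smult = (\<lambda>a C. \<Union>x\<in>C. K +>\<^bsub>M\<^esub> (a \<odot>\<^bsub>M\<^esub> x))\<rparr>"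

text \<open>Homomorphisms are extensional, so that equal homomorphisms are equal as functions.\<close>

definition mod_hom ::
  "('a, 'r) ring_scheme \<Rightarrow> ('a, 'b, 'c) module_scheme \<Rightarrow> ('a, 'd, 'e) module_scheme \<Rightarrow> ('b \<Rightarrow> 'd) set"
where
  "mod_hom R M N = {f \<in> carrier M \<rightarrow>\<^sub>E carrier N.
     (\<forall>x\<in>carrier M. \<forall>y\<in>carrier M. f (x \<oplus>\<^bsub>M\<^esub> y) = f x \<oplus>\<^bsub>N\<^esub> f y) \<and>
     (\<forall>a\<in>carrier R. \<forall>x\<in>carrier M. f (a \<odot>\<^bsub>M\<^esub> x) = a \<odot>\<^bsub>N\<^esub> f x)}"

definition Hom_mod ::
  "('a, 'r) ring_scheme \<Rightarrow> ('a, 'b, 'c) module_scheme \<Rightarrow> ('a, 'd, 'e) module_scheme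
    \<Rightarrow> ('a, 'b \<Rightarrow> 'd) module"
where
  "Hom_mod R M N =
     \<lparr>carrier = mod_hom R M N, monoid.mult = undefined, one = undefined,
      ring.zero = (\<lambda>x\<in>carrier M. \<zero>\<^bsub>N\<^esub>),
      add = (\<lambda>f g. \<lambda>x\<in>carrier M. f x \<oplus>\<^bsub>N\<^esub> g x),
      smult = (\<lambda>a f. \<lambda>x\<in>carrier M. a \<odot>\<^bsub>N\<^esub> f x)\<rparr>"

text \<open>The module \<open>R\<^sup>n\<close>, with vectors as extensional functions on \<open>{..<n}\<close>.\<close>

definition free_mod :: "('a, 'r) ring_scheme \<Rightarrow> nat \<Rightarrow> ('a, nat \<Rightarrow> 'a) module" where
  "free_mod R n =
     \<lparr>carrier = {..<n} \<rightarrow>\<^sub>E carrier R, monoid.mult = undefined, one = undefined,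
      ring.zero = (\<lambda>i\<in>{..<n}. \<zero>\<^bsub>R\<^esub>),
      add = (\<lambda>u v. \<lambda>i\<in>{..<n}. u i \<oplus>\<^bsub>R\<^esub> v i),
      smult = (\<lambda>a u. \<lambda>i\<in>{..<n}. a \<otimes>\<^bsub>R\<^esub> u i)\<rparr>"

text \<open>Free of finite rank; rank \<open>0\<close>, i.e. the zero module, is allowed.\<close>

definition is_free :: "('a, 'r) ring_scheme \<Rightarrow> ('a, 'b, 'c) module_scheme \<Rightarrow> bool" where
  "is_free R M \<longleftrightarrow> module R M \<and>
     (\<exists>n. \<exists>f \<in> mod_hom R M (free_mod R n). bij_betw f (carrier M) (carrier (free_mod R n)))"

definition regular_module :: "('a, 'r) ring_scheme \<Rightarrow> ('a, 'a) module" where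
  "regular_module R =
     \<lparr>carrier = carrier R, monoid.mult = monoid.mult R, one = one R,
      ring.zero = ring.zero R, add = add R, smult = monoid.mult R\<rparr>"

subsection \<open>Depth\<close>

text \<open>The submodule \<open>(x\<^sub>1, \<dots>, x\<^sub>k)M\<close>.\<close>

definition seq_submod :: "('a, 'r) ring_scheme \<Rightarrow> ('a, 'b, 'c) module_scheme \<Rightarrow> 'a list \<Rightarrow> 'b set" where
  "seq_submod R M xs = span_mod R M {x \<odot>\<^bsub>M\<^esub> m | x m. x \<in> set xs \<and> m \<in> carrier M}"

definition nonzerodivisor_on :: "('a, 'b, 'c) module_scheme \<Rightarrow> 'a \<Rightarrow> bool" where
  "nonzerodivisor_on M x \<longleftrightarrow> (\<forall>m\<in>carrier M. x \<odot>\<^bsub>M\<^esub> m = \<zero>\<^bsub>M\<^esub> \<longrightarrow> m = \<zero>\<^bsub>M\<^esub>)"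

definition regular_seq :: "('a, 'r) ring_scheme \<Rightarrow> ('a, 'b, 'c) module_scheme \<Rightarrow> 'a list \<Rightarrow> bool" where
  "regular_seq R M xs \<longleftrightarrow> set xs \<subseteq> carrier R \<and>
     (\<forall>i<length xs. nonzerodivisor_on (quot_mod M (seq_submod R M (take i xs))) (xs ! i)) \<and>
     \<not> zero_module (quot_mod M (seq_submod R M xs))"

text \<open>
  The depth of a finitely generated module over a local ring: the supremum of the lengths of
  regular sequences in the maximal ideal, with the usual convention that the zero module has
  infinite depth.
\<close>

definition depth :: "('a, 'r) ring_scheme \<Rightarrow> ('a, 'b, 'c) module_scheme \<Rightarrow> enat" where
  "depth R M = (if zero_module M then \<infinity>
     else Sup {enat (length xs) | xs. set xs \<subseteq> max_ideal R \<and> regular_seq R M xs})"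

definition ring_depth :: "('a, 'r) ring_scheme \<Rightarrow> enat" where
  "ring_depth R = depth R (regular_module R)"

subsection \<open>Ext\<close>

text \<open>
  A resolution \<open>\<dots> \<rightarrow> R\<^bsup>b 2\<^esup> \<rightarrow> R\<^bsup>b 1\<^esup> \<rightarrow> R\<^bsup>b 0\<^esup> \<rightarrow> M \<rightarrow> 0\<close> by free modules of finite rank, with
  \<open>d i : R\<^bsup>b (i + 1)\<^esup> \<rightarrow> R\<^bsup>b i\<^esup>\<close> and augmentation \<open>e\<close>. Over a Noetherian ring every finitely
  generated module has one.
\<close>

definition free_resolution ::
  "('a, 'r) ring_scheme \<Rightarrow> ('a, 'b, 'c) module_scheme \<Rightarrow> (nat \<Rightarrow> nat)
    \<Rightarrow> (nat \<Rightarrow> (nat \<Rightarrow> 'a) \<Rightarrow> (nat \<Rightarrow> 'a)) \<Rightarrow> ((nat \<Rightarrow> 'a) \<Rightarrow> 'b) \<Rightarrow> bool"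
where
  "free_resolution R M b d e \<longleftrightarrow>
     e \<in> mod_hom R (free_mod R (b 0)) M \<and>
     (\<forall>i. d i \<in> mod_hom R (free_mod R (b (Suc i))) (free_mod R (b i))) \<and>
     e ` carrier (free_mod R (b 0)) = carrier M \<and>
     d 0 ` carrier (free_mod R (b 1)) = a_kernel (free_mod R (b 0)) M e \<and>
     (\<forall>i. d (Suc i) ` carrier (free_mod R (b (Suc (Suc i)))) =
            a_kernel (free_mod R (b (Suc i))) (free_mod R (b i)) (d i))"

definition hom_cocycles ::
  "('a, 'r) ring_scheme \<Rightarrow> (nat \<Rightarrow> nat) \<Rightarrow> (nat \<Rightarrow> (nat \<Rightarrow> 'a) \<Rightarrow> (nat \<Rightarrow> 'a))
    \<Rightarrow> ('a, 'd, 'e) module_scheme \<Rightarrow> nat \<Rightarrow> ((nat \<Rightarrow> 'a) \<Rightarrow> 'd) set"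
where
  "hom_cocycles R b d N i = {f \<in> mod_hom R (free_mod R (b i)) N.
     \<forall>u\<in>carrier (free_mod R (b (Suc i))). f (d i u) = \<zero>\<^bsub>N\<^esub>}"

fun hom_coboundaries ::
  "('a, 'r) ring_scheme \<Rightarrow> (nat \<Rightarrow> nat) \<Rightarrow> (nat \<Rightarrow> (nat \<Rightarrow> 'a) \<Rightarrow> (nat \<Rightarrow> 'a))
    \<Rightarrow> ('a, 'd, 'e) module_scheme \<Rightarrow> nat \<Rightarrow> ((nat \<Rightarrow> 'a) \<Rightarrow> 'd) set"
where
  "hom_coboundaries R b d N 0 = {\<lambda>u\<in>carrier (free_mod R (b 0)). \<zero>\<^bsub>N\<^esub>}"
| "hom_coboundaries R b d N (Suc i) =
     (\<lambda>f. \<lambda>u\<in>carrier (free_mod R (b (Suc i))). f (d i u)) ` mod_hom R (free_mod R (b i)) N"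

text \<open>The cohomology in degree \<open>i\<close> of the complex \<open>Hom\<^sub>R(R\<^bsup>b \<bullet>\<^esup>, N)\<close>.\<close>

definition hom_cohomology ::
  "('a, 'r) ring_scheme \<Rightarrow> (nat \<Rightarrow> nat) \<Rightarrow> (nat \<Rightarrow> (nat \<Rightarrow> 'a) \<Rightarrow> (nat \<Rightarrow> 'a))
    \<Rightarrow> ('a, 'd, 'e) module_scheme \<Rightarrow> nat \<Rightarrow> ('a, ((nat \<Rightarrow> 'a) \<Rightarrow> 'd) set) module"
where
  "hom_cohomology R b d N i =
     quot_mod (Hom_mod R (free_mod R (b i)) N \<lparr>carrier := hom_cocycles R b d N i\<rparr>)
       (hom_coboundaries R b d N i)"

text \<open>
  \<open>Ext\<^sup>i\<^sub>R(M, N)\<close>, computed from one fixed free resolution of \<open>M\<close>, the same for all \<open>i\<close>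
  and \<open>N\<close>; up to isomorphism the choice is irrelevant. For \<open>M\<close> without a resolution by free
  modules of finite rank the value is meaningless.
\<close>

definition Ext ::
  "('a, 'r) ring_scheme \<Rightarrow> nat \<Rightarrow> ('a, 'b, 'c) module_scheme \<Rightarrow> ('a, 'd, 'e) module_scheme
    \<Rightarrow> ('a, ((nat \<Rightarrow> 'a) \<Rightarrow> 'd) set) module"
where
  "Ext R i M N =
     (let (b, d) = (SOME (b, d). \<exists>e. free_resolution R M b d e) in hom_cohomology R b d N i)"

subsection \<open>The classes Deep and \<open>\<Omega>\<close>Deep\<close>

definition Deep :: "('a, 'r) ring_scheme \<Rightarrow> ('a, 'b, 'c) module_scheme set" where
  "Deep R = {Y. fin_gen R Y \<and> ring_depth R \<le> depth R Y}"

text \<open>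
  In the exact sequence \<open>0 \<rightarrow> M \<rightarrow> R\<^sup>n \<rightarrow> Y \<rightarrow> 0\<close> the module \<open>Y\<close> ranges over modules whose elements
  are sets of vectors. This is no restriction: \<open>Y\<close> is isomorphic to the quotient of \<open>R\<^sup>n\<close> by
  the image of \<open>M\<close>, whose elements are cosets, i.e. such sets.
\<close>

definition Omega_Deep :: "('a, 'r) ring_scheme \<Rightarrow> ('a, 'b, 'c) module_scheme set" where
  "Omega_Deep R = {M. fin_gen R M \<and>
     (\<exists>n. \<exists>Y :: ('a, (nat \<Rightarrow> 'a) set) module.
        Y \<in> Deep R \<and>
        (\<exists>f \<in> mod_hom R M (free_mod R n). \<exists>g \<in> mod_hom R (free_mod R n) Y.
           inj_on f (carrier M) \<and>
           f ` carrier M = a_kernel (free_mod R n) Y g \<and>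
           g ` carrier (free_mod R n) = carrier Y))}"

end

theory Submission
  imports Defs
begin

text \<open>
  Choose one sequence \<open>z\<^sub>1, \<dots>, z\<^sub>t\<close> in the maximal ideal that is regular both on \<open>R\<close> and on \<open>Y\<close>,
  where \<open>0 \<rightarrow> N \<rightarrow> R\<^sup>k \<rightarrow> Y \<rightarrow> 0\<close> is exact; then it is regular on \<open>N\<close> and \<open>N/zN \<rightarrow> (R/z)\<^sup>k\<close> is
  injective. As \<open>depth R = t\<close>, some \<open>s \<notin> (z)\<close> satisfies \<open>\<mm> s \<subseteq> (z)\<close>. The vanishing of Ext makes
  \<open>Hom(M, N)/z Hom(M, N) \<rightarrow> Hom(M, N/zN)\<close> injective. If all composites \<open>M \<rightarrow> N \<rightarrow> R\<^sup>k \<rightarrow> R\<close> had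
  image in \<open>\<mm>\<close>, then \<open>s Hom(M, N) \<subseteq> z Hom(M, N)\<close>, which is impossible for a nonzero free module.
  So \<open>M\<close> maps onto \<open>R\<close>, \<open>N\<close> is a direct summand of the free module \<open>Hom(M, N)\<close>, and direct
  summands of free modules over a local ring are free.
\<close>

section \<open>Submodules and linear maps\<close>

text \<open>Regularity of z on \<open>Y\<close> makes N/zN -> (R/z)^k injective, and regularity on
  \<open>R\<close> produces s; hence one sequence has to serve both. If all composites have image in
  the maximal ideal, then s h(M) lies in z R^k, hence in zN, so s h vanishes in Hom(M, N/zN) for
  every h. The conflict with freeness is read off in one coordinate: for a basis element h, s h in z
  Hom(M, N) would put s into (z).

  The vanishing range 1, ..., t - 1 is what the reduction consumes. Dividing by the last element of
  z yields a homomorphism to N/(z_1, ..., z_{t-1})N that has to lift to N. Lifting through z_{i+1}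
  requires Ext^1(M, N/(z_1, ..., z_i)N) = 0, which follows from the vanishing of Ext^1(M, N), ...,
  Ext^{i+1}(M, N), and here i + 1 is at most t - 1. These degree shifts are carried out on cochains
  of the chosen resolution.

  The splitting is explicit: with psi : M -> R linear and psi(m') = 1, send y to the map x -> psi(x)
  y, and return by evaluation at m'.\<close>

lemma (in module) submodule_closed:
  assumes "submodule K R M"
  shows "x \<in> K \<Longrightarrow> x \<in> carrier M"
    and "\<zero>\<^bsub>M\<^esub> \<in> K"
    and "x \<in> K \<Longrightarrow> y \<in> K \<Longrightarrow> x \<oplus>\<^bsub>M\<^esub> y \<in> K"
    and "x \<in> K \<Longrightarrow> y \<in> K \<Longrightarrow> x \<ominus>\<^bsub>M\<^esub> y \<in> K"
    and "a \<in> carrier R \<Longrightarrow> x \<in> K \<Longrightarrow> a \<odot>\<^bsub>M\<^esub> x \<in> K"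
    and "x \<in> K \<Longrightarrow> \<ominus>\<^bsub>M\<^esub> x \<in> K"
  using submoduleE[OF assms] submodule.axioms(1)[OF assms] subgroup.one_closed
  by (force simp: a_minus_def)+

text \<open>Negatives come from scalar multiplication by \<open>\<ominus> \<one>\<close>.\<close>

lemma (in module) submoduleI':
  assumes "H \<subseteq> carrier M" "\<zero>\<^bsub>M\<^esub> \<in> H"
    and "\<And>x y. x \<in> H \<Longrightarrow> y \<in> H \<Longrightarrow> x \<oplus>\<^bsub>M\<^esub> y \<in> H"
    and "\<And>a x. a \<in> carrier R \<Longrightarrow> x \<in> H \<Longrightarrow> a \<odot>\<^bsub>M\<^esub> x \<in> H"
  shows "submodule H R M"
proof (rule submoduleI[OF assms(1,2) _ assms(3,4)])
  fix x assume "x \<in> H"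
  then have "\<ominus>\<^bsub>M\<^esub> x = (\<ominus> \<one>) \<odot>\<^bsub>M\<^esub> x"
    using assms(1) by (auto simp: smult_l_minus)
  then show "\<ominus>\<^bsub>M\<^esub> x \<in> H"
    using assms(4)[of "\<ominus> \<one>" x] \<open>x \<in> H\<close> by simp
qed

lemma (in module) submodule_zero: "submodule {\<zero>\<^bsub>M\<^esub>} R M"
  by (rule submoduleI') auto

lemma (in module) submodule_Inter:
  assumes "T \<noteq> {}" "\<And>K. K \<in> T \<Longrightarrow> submodule K R M"
  shows "submodule (\<Inter>T) R M"
proof (rule submoduleI')
  show "\<Inter>T \<subseteq> carrier M"
    using assms submodule_closed(1) by blast
  show "\<zero>\<^bsub>M\<^esub> \<in> \<Inter>T"
    using assms(2) submodule_closed(2) by blast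
  show "x \<oplus>\<^bsub>M\<^esub> y \<in> \<Inter>T" if "x \<in> \<Inter>T" "y \<in> \<Inter>T" for x y
    using that assms(2) submodule_closed(3) by blast
  show "a \<odot>\<^bsub>M\<^esub> x \<in> \<Inter>T" if "a \<in> carrier R" "x \<in> \<Inter>T" for a x
    using that assms(2) submodule_closed(5) by blast
qed

lemma (in module) submodule_span:
  assumes "S \<subseteq> carrier M"
  shows "submodule (span_mod R M S) R M"
  unfolding span_mod_def hull_def
  using assms carrier_is_submodule by (intro submodule_Inter) auto

lemma span_superset: "S \<subseteq> span_mod R M S"
  unfolding span_mod_def by (rule hull_subset)

lemma span_minimal: "S \<subseteq> K \<Longrightarrow> submodule K R M \<Longrightarrow> span_mod R M S \<subseteq> K"
  unfolding span_mod_def by (rule hull_minimal)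

lemma span_mono: "S \<subseteq> T \<Longrightarrow> span_mod R M S \<subseteq> span_mod R M T"
  unfolding span_mod_def by (rule hull_mono)

text \<open>
  Regularity of a sequence on \<open>M/K\<close> is phrased inside \<open>M\<close>, so that no iterated quotients are formed
  and their element types do not grow.
\<close>

definition adjoin :: "('a, 'b, 'c) module_scheme \<Rightarrow> 'b set \<Rightarrow> 'a \<Rightarrow> 'b set" where
  "adjoin M K x = {k \<oplus>\<^bsub>M\<^esub> x \<odot>\<^bsub>M\<^esub> w | k w. k \<in> K \<and> w \<in> carrier M}"

definition nzd :: "('a, 'b, 'c) module_scheme \<Rightarrow> 'b set \<Rightarrow> 'a \<Rightarrow> bool" where
  "nzd M K x \<longleftrightarrow> (\<forall>w\<in>carrier M. x \<odot>\<^bsub>M\<^esub> w \<in> K \<longrightarrow> w \<in> K)"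

text \<open>In contrast to \<open>regular_seq\<close>, the final quotient may be zero. This treats
  zero modules, which have infinite depth and may occur as \<open>Y\<close>, uniformly with all
  others. Over \<open>R\<close> with entries in the maximal ideal the quotient is nonzero
  anyway.\<close>

fun weakly_regular :: "('a, 'b, 'c) module_scheme \<Rightarrow> 'b set \<Rightarrow> 'a list \<Rightarrow> bool" where
  "weakly_regular M K [] \<longleftrightarrow> True"
| "weakly_regular M K (x # xs) \<longleftrightarrow> nzd M K x \<and> weakly_regular M (adjoin M K x) xs"

abbreviation adjoin_seq :: "('a, 'b, 'c) module_scheme \<Rightarrow> 'b set \<Rightarrow> 'a list \<Rightarrow> 'b set" where
  "adjoin_seq M \<equiv> foldl (adjoin M)"

text \<open>The recursion strips the first element, whereas most later inductions remove the last
  one; this is the bridge.\<close>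

lemma weakly_regular_append:
  "weakly_regular M K (xs @ ys) \<longleftrightarrow>
    weakly_regular M K xs \<and> weakly_regular M (adjoin_seq M K xs) ys"
  by (induction xs arbitrary: K) auto

lemma weakly_regular_iff_nth:
  "weakly_regular M K xs \<longleftrightarrow> (\<forall>i<length xs. nzd M (adjoin_seq M K (take i xs)) (xs ! i))"
proof (induction xs rule: rev_induct)
  case (snoc x xs)
  then show ?case
    by (auto simp: weakly_regular_append nth_append less_Suc_eq)
qed simp

context module
begin

lemma adjoinI: "k \<in> K \<Longrightarrow> w \<in> carrier M \<Longrightarrow> k \<oplus>\<^bsub>M\<^esub> x \<odot>\<^bsub>M\<^esub> w \<in> adjoin M K x"
  unfolding adjoin_def by blast

lemma adjoinE:
  assumes "v \<in> adjoin M K x"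
  obtains k w where "k \<in> K" "w \<in> carrier M" "v = k \<oplus>\<^bsub>M\<^esub> x \<odot>\<^bsub>M\<^esub> w"
  using assms unfolding adjoin_def by blast

lemma submodule_adjoin:
  assumes "submodule K R M" "x \<in> carrier R"
  shows "submodule (adjoin M K x) R M"
proof (rule submoduleI')
  note K = submodule_closed[OF assms(1)]
  show "adjoin M K x \<subseteq> carrier M"
    using K(1) assms(2) by (auto elim!: adjoinE)
  have "\<zero>\<^bsub>M\<^esub> = \<zero>\<^bsub>M\<^esub> \<oplus>\<^bsub>M\<^esub> x \<odot>\<^bsub>M\<^esub> \<zero>\<^bsub>M\<^esub>"
    using assms(2) by simp
  then show "\<zero>\<^bsub>M\<^esub> \<in> adjoin M K x"
    using adjoinI[OF K(2) M.zero_closed, of x] by simp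
next
  note K = submodule_closed[OF assms(1)]
  fix u v assume "u \<in> adjoin M K x" "v \<in> adjoin M K x"
  then obtain k w k' w' where *: "k \<in> K" "w \<in> carrier M" "u = k \<oplus>\<^bsub>M\<^esub> x \<odot>\<^bsub>M\<^esub> w"
    "k' \<in> K" "w' \<in> carrier M" "v = k' \<oplus>\<^bsub>M\<^esub> x \<odot>\<^bsub>M\<^esub> w'"
    by (metis adjoinE)
  have "u \<oplus>\<^bsub>M\<^esub> v = (k \<oplus>\<^bsub>M\<^esub> k') \<oplus>\<^bsub>M\<^esub> x \<odot>\<^bsub>M\<^esub> (w \<oplus>\<^bsub>M\<^esub> w')"
    using * K(1) assms(2) by (simp add: smult_r_distr M.a_ac)
  then show "u \<oplus>\<^bsub>M\<^esub> v \<in> adjoin M K x"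
    using * K(3) by (simp add: adjoinI)
next
  note K = submodule_closed[OF assms(1)]
  fix a u assume a: "a \<in> carrier R" and "u \<in> adjoin M K x"
  then obtain k w where *: "k \<in> K" "w \<in> carrier M" "u = k \<oplus>\<^bsub>M\<^esub> x \<odot>\<^bsub>M\<^esub> w"
    by (metis adjoinE)
  have "a \<odot>\<^bsub>M\<^esub> u = a \<odot>\<^bsub>M\<^esub> k \<oplus>\<^bsub>M\<^esub> x \<odot>\<^bsub>M\<^esub> (a \<odot>\<^bsub>M\<^esub> w)"
    using * K(1) assms(2) a by (simp add: smult_r_distr smult_assoc1[symmetric] R.m_comm)
  then show "a \<odot>\<^bsub>M\<^esub> u \<in> adjoin M K x"
    using * K(5) a by (simp add: adjoinI)
qed

lemma subset_adjoin:
  assumes "submodule K R M" "x \<in> carrier R"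
  shows "K \<subseteq> adjoin M K x"
proof
  fix k assume "k \<in> K"
  then show "k \<in> adjoin M K x"
    using adjoinI[of k K "\<zero>\<^bsub>M\<^esub>" x] submodule_closed(1)[OF assms(1)] assms(2) by simp
qed

lemma smult_in_adjoin:
  assumes "submodule K R M" "x \<in> carrier R" "w \<in> carrier M"
  shows "x \<odot>\<^bsub>M\<^esub> w \<in> adjoin M K x"
  using adjoinI[of "\<zero>\<^bsub>M\<^esub>" K w x] submodule_closed(2)[OF assms(1)] assms(2,3) by simp

text \<open>Both sides are K + xM + yM. The exchange argument permutes neighbouring elements of a
  sequence and needs the quotients behind them to agree.\<close>

lemma adjoin_commute:
  assumes "submodule K R M" "x \<in> carrier R" "y \<in> carrier R"
  shows "adjoin M (adjoin M K x) y = adjoin M (adjoin M K y) x"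
proof -
  have "adjoin M (adjoin M K x) y \<subseteq> adjoin M (adjoin M K y) x"
    if "x \<in> carrier R" "y \<in> carrier R" for x y
  proof
    fix v assume "v \<in> adjoin M (adjoin M K x) y"
    then obtain k w w' where *: "k \<in> K" "w \<in> carrier M" "w' \<in> carrier M"
      "v = (k \<oplus>\<^bsub>M\<^esub> x \<odot>\<^bsub>M\<^esub> w) \<oplus>\<^bsub>M\<^esub> y \<odot>\<^bsub>M\<^esub> w'"
      by (metis adjoinE)
    then have "v = (k \<oplus>\<^bsub>M\<^esub> y \<odot>\<^bsub>M\<^esub> w') \<oplus>\<^bsub>M\<^esub> x \<odot>\<^bsub>M\<^esub> w"
      using that submodule_closed(1)[OF assms(1)] by (simp add: M.a_ac)
    then show "v \<in> adjoin M (adjoin M K y) x"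
      using * by (simp add: adjoinI)
  qed
  then show ?thesis
    using assms(2,3) by blast
qed

lemma submodule_adjoin_seq:
  "submodule K R M \<Longrightarrow> set xs \<subseteq> carrier R \<Longrightarrow> submodule (adjoin_seq M K xs) R M"
  by (induction xs arbitrary: K) (auto simp: submodule_adjoin)

lemma smult_minus_right:
  "a \<in> carrier R \<Longrightarrow> x \<in> carrier M \<Longrightarrow> y \<in> carrier M \<Longrightarrow>
    a \<odot>\<^bsub>M\<^esub> (x \<ominus>\<^bsub>M\<^esub> y) = a \<odot>\<^bsub>M\<^esub> x \<ominus>\<^bsub>M\<^esub> a \<odot>\<^bsub>M\<^esub> y"
  by (simp add: a_minus_def smult_r_distr smult_r_minus)

lemma minus_eq_iff_eq_plus:
  "x \<in> carrier M \<Longrightarrow> y \<in> carrier M \<Longrightarrow> z \<in> carrier M \<Longrightarrow> x \<ominus>\<^bsub>M\<^esub> y = z \<longleftrightarrow> x = z \<oplus>\<^bsub>M\<^esub> y"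
  by (metis M.add.inv_closed M.add.inv_solve_right a_minus_def)

lemma submodule_mem_plus_iff:
  assumes "submodule K R M" "k \<in> K" "y \<in> carrier M"
  shows "k \<oplus>\<^bsub>M\<^esub> y \<in> K \<longleftrightarrow> y \<in> K"
proof -
  note K = submodule_closed[OF assms(1)]
  have "(k \<oplus>\<^bsub>M\<^esub> y) \<ominus>\<^bsub>M\<^esub> k = y"
    using assms K(1) by (simp add: minus_eq_iff_eq_plus M.a_comm)
  then show ?thesis
    using K(3,4) assms(2) by metis
qed

text \<open>Reads membership as the congruence v = x w modulo K, the form in which elements are
  divided by x later on.\<close>

lemma mem_adjoin_iff:
  assumes "submodule K R M" "x \<in> carrier R" "v \<in> carrier M"
  shows "v \<in> adjoin M K x \<longleftrightarrow> (\<exists>w\<in>carrier M. v \<ominus>\<^bsub>M\<^esub> x \<odot>\<^bsub>M\<^esub> w \<in> K)"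
proof -
  have "v \<ominus>\<^bsub>M\<^esub> x \<odot>\<^bsub>M\<^esub> w \<in> K \<longleftrightarrow> (\<exists>k\<in>K. v = k \<oplus>\<^bsub>M\<^esub> x \<odot>\<^bsub>M\<^esub> w)" if "w \<in> carrier M" for w
    using minus_eq_iff_eq_plus submodule_closed(1)[OF assms(1)] that assms(2,3) by (metis smult_closed)
  then show ?thesis
    unfolding adjoin_def by blast
qed

end

text \<open>This is \<open>mod_hom\<close> without extensionality, so that composites and pointwise
  combinations qualify without being restricted to the carrier.\<close>

definition linear_map ::
  "('a, 'r) ring_scheme \<Rightarrow> ('a, 'b, 'c) module_scheme \<Rightarrow> ('a, 'd, 'e) module_scheme \<Rightarrow> ('b \<Rightarrow> 'd) \<Rightarrow> bool"
where
  "linear_map R M N f \<longleftrightarrow> f \<in> carrier M \<rightarrow> carrier N \<and>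
     (\<forall>x\<in>carrier M. \<forall>y\<in>carrier M. f (x \<oplus>\<^bsub>M\<^esub> y) = f x \<oplus>\<^bsub>N\<^esub> f y) \<and>
     (\<forall>a\<in>carrier R. \<forall>x\<in>carrier M. f (a \<odot>\<^bsub>M\<^esub> x) = a \<odot>\<^bsub>N\<^esub> f x)"

lemma linear_mapD:
  assumes "linear_map R M N f"
  shows "x \<in> carrier M \<Longrightarrow> f x \<in> carrier N"
    and "x \<in> carrier M \<Longrightarrow> y \<in> carrier M \<Longrightarrow> f (x \<oplus>\<^bsub>M\<^esub> y) = f x \<oplus>\<^bsub>N\<^esub> f y"
    and "a \<in> carrier R \<Longrightarrow> x \<in> carrier M \<Longrightarrow> f (a \<odot>\<^bsub>M\<^esub> x) = a \<odot>\<^bsub>N\<^esub> f x"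
  using assms by (auto simp: linear_map_def)

lemma mod_hom_iff_linear_map:
  "f \<in> mod_hom R M N \<longleftrightarrow> linear_map R M N f \<and> f \<in> extensional (carrier M)"
  unfolding mod_hom_def linear_map_def by (auto simp: PiE_iff)

lemma linear_map_if_mod_hom: "f \<in> mod_hom R M N \<Longrightarrow> linear_map R M N f"
  by (simp add: mod_hom_iff_linear_map)

lemma restrict_in_mod_hom:
  assumes "module R M" "linear_map R M N f"
  shows "restrict f (carrier M) \<in> mod_hom R M N"
proof -
  interpret module R M by fact
  show ?thesis
    using assms(2) by (auto simp: mod_hom_iff_linear_map linear_map_def)
qed

lemma linear_map_comp:
  assumes "linear_map R M N f" "linear_map R N P g"
  shows "linear_map R M P (\<lambda>x. g (f x))"
  using assms by (auto simp: linear_map_def Pi_iff)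

locale module_hom = M: module R M + N: module R N
  for R (structure) and M :: "('a, 'b, 'c) module_scheme" and N :: "('a, 'd, 'e) module_scheme" +
  fixes f
  assumes lin: "linear_map R M N f"
begin

lemmas f_simps = linear_mapD[OF lin]

lemma f_zero: "f \<zero>\<^bsub>M\<^esub> = \<zero>\<^bsub>N\<^esub>"
  using f_simps(1)[of "\<zero>\<^bsub>M\<^esub>"] f_simps(3)[of "\<zero>" "\<zero>\<^bsub>M\<^esub>"] by simp

lemma f_uminus: "x \<in> carrier M \<Longrightarrow> f (\<ominus>\<^bsub>M\<^esub> x) = \<ominus>\<^bsub>N\<^esub> f x"
  using f_simps(3)[of "\<ominus> \<one>" x] f_simps(1)[of x]
  by (simp add: M.smult_l_minus N.smult_l_minus)

lemma f_minus: "x \<in> carrier M \<Longrightarrow> y \<in> carrier M \<Longrightarrow> f (x \<ominus>\<^bsub>M\<^esub> y) = f x \<ominus>\<^bsub>N\<^esub> f y"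
  by (simp add: a_minus_def f_simps f_uminus)

lemma f_minus_eq_zero: "x \<in> carrier M \<Longrightarrow> y \<in> carrier M \<Longrightarrow> f x = f y \<Longrightarrow> f (x \<ominus>\<^bsub>M\<^esub> y) = \<zero>\<^bsub>N\<^esub>"
  using f_simps(1)[of y] by (simp only: f_minus) (simp add: a_minus_def N.M.r_neg)

lemma submodule_vimage:
  assumes "submodule K R N"
  shows "submodule {x \<in> carrier M. f x \<in> K} R M"
  using N.submodule_closed[OF assms] by (intro M.submoduleI') (auto simp: f_simps f_zero)

lemma submodule_image:
  assumes "submodule K R M"
  shows "submodule (f ` K) R N"
proof (rule N.submoduleI')
  note K = M.submodule_closed[OF assms]
  show "f ` K \<subseteq> carrier N"
    using K(1) f_simps(1) by blast
  show "\<zero>\<^bsub>N\<^esub> \<in> f ` K"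
    using K(2) f_zero by force
  show "x \<oplus>\<^bsub>N\<^esub> y \<in> f ` K" if "x \<in> f ` K" "y \<in> f ` K" for x y
    using that K(1,3) f_simps(2) by (smt (verit) imageE imageI)
  show "a \<odot>\<^bsub>N\<^esub> x \<in> f ` K" if "a \<in> carrier R" "x \<in> f ` K" for a x
    using that K(1,5) f_simps(3) by (smt (verit) imageE imageI)
qed

lemma inj_on_iff_kernel: "inj_on f (carrier M) \<longleftrightarrow> (\<forall>x\<in>carrier M. f x = \<zero>\<^bsub>N\<^esub> \<longrightarrow> x = \<zero>\<^bsub>M\<^esub>)"
proof
  assume "inj_on f (carrier M)"
  then show "\<forall>x\<in>carrier M. f x = \<zero>\<^bsub>N\<^esub> \<longrightarrow> x = \<zero>\<^bsub>M\<^esub>"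
    using f_zero by (metis M.M.zero_closed inj_onD)
next
  assume *: "\<forall>x\<in>carrier M. f x = \<zero>\<^bsub>N\<^esub> \<longrightarrow> x = \<zero>\<^bsub>M\<^esub>"
  show "inj_on f (carrier M)"
  proof (rule inj_onI)
    fix x y assume xy: "x \<in> carrier M" "y \<in> carrier M" "f x = f y"
    then have "f (x \<ominus>\<^bsub>M\<^esub> y) = \<zero>\<^bsub>N\<^esub>"
      by (rule f_minus_eq_zero)
    then have "x \<ominus>\<^bsub>M\<^esub> y = \<zero>\<^bsub>M\<^esub>"
      using * xy by simp
    then show "x = y"
      using xy M.minus_eq_iff_eq_plus by simp
  qed
qed

lemma image_adjoin_seq:
  assumes "\<And>x. x \<in> K \<Longrightarrow> x \<in> carrier M \<and> f x \<in> L" "set xs \<subseteq> carrier R" "v \<in> adjoin_seq M K xs"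
  shows "v \<in> carrier M \<and> f v \<in> adjoin_seq N L xs"
  using assms
proof (induction xs arbitrary: v rule: rev_induct)
  case (snoc z xs)
  then obtain k w where *: "k \<in> adjoin_seq M K xs" "w \<in> carrier M" "v = k \<oplus>\<^bsub>M\<^esub> z \<odot>\<^bsub>M\<^esub> w"
    by (auto elim: M.adjoinE)
  then have "f k \<in> adjoin_seq N L xs" "k \<in> carrier M"
    using snoc by auto
  then show ?case
    using * snoc.prems(2) by (auto simp: f_simps N.adjoinI)
qed auto

text \<open>Surjectivity is what lets the multiplier in N be lifted to M.\<close>

lemma vimage_adjoin:
  assumes "f ` carrier M = carrier N" "submodule L R N" "x \<in> carrier R"
  shows "adjoin M {v \<in> carrier M. f v \<in> L} x = {v \<in> carrier M. f v \<in> adjoin N L x}"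
proof -
  have "v \<in> adjoin M {v \<in> carrier M. f v \<in> L} x \<longleftrightarrow> f v \<in> adjoin N L x" if v: "v \<in> carrier M" for v
  proof -
    have "f v \<in> adjoin N L x \<longleftrightarrow> (\<exists>w\<in>carrier M. f v \<ominus>\<^bsub>N\<^esub> x \<odot>\<^bsub>N\<^esub> f w \<in> L)"
      using N.mem_adjoin_iff[OF assms(2,3), of "f v"] v f_simps(1) assms(1) by (metis image_iff)
    then show ?thesis
      using M.mem_adjoin_iff[OF submodule_vimage[OF assms(2)] assms(3) v] v assms(3)
      by (auto simp: f_minus f_simps)
  qed
  moreover have "adjoin M {v \<in> carrier M. f v \<in> L} x \<subseteq> carrier M"
    using M.submodule_adjoin[OF submodule_vimage[OF assms(2)] assms(3)] M.submodule_closed(1) by blast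
  ultimately show ?thesis
    by blast
qed

text \<open>The map induces an isomorphism from M modulo the preimage of L to N/L. Applied to R^k ->
  Y, it turns regularity on \<open>Y\<close> into regularity on R^k modulo the image of
  \<open>N\<close>.\<close>

lemma weakly_regular_vimage_iff:
  assumes "f ` carrier M = carrier N" "submodule L R N" "set xs \<subseteq> carrier R"
  shows "weakly_regular M {v \<in> carrier M. f v \<in> L} xs \<longleftrightarrow> weakly_regular N L xs"
  using assms(2,3)
proof (induction xs arbitrary: L)
  case (Cons x xs)
  have "nzd N L x \<longleftrightarrow> (\<forall>w\<in>f ` carrier M. x \<odot>\<^bsub>N\<^esub> w \<in> L \<longrightarrow> w \<in> L)"
    unfolding nzd_def assms(1) ..
  also have "\<dots> \<longleftrightarrow> nzd M {v \<in> carrier M. f v \<in> L} x"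
    using Cons.prems(2) by (auto simp: nzd_def f_simps)
  finally show ?case
    using Cons.prems Cons.IH[of "adjoin N L x"] N.submodule_adjoin[of L x]
    by (simp add: vimage_adjoin[OF assms(1) Cons.prems(1)])
qed simp

end

section \<open>Free modules and Noetherian modules\<close>

lemma regular_module_simps [simp]:
  "carrier (regular_module R) = carrier R" "\<zero>\<^bsub>regular_module R\<^esub> = \<zero>\<^bsub>R\<^esub>"
  "add (regular_module R) = add R" "smult (regular_module R) = monoid.mult R"
  by (simp_all add: regular_module_def)

lemma free_mod_simps [simp]:
  "carrier (free_mod R n) = {..<n} \<rightarrow>\<^sub>E carrier R" "\<zero>\<^bsub>free_mod R n\<^esub> = (\<lambda>i\<in>{..<n}. \<zero>\<^bsub>R\<^esub>)"
  "u \<oplus>\<^bsub>free_mod R n\<^esub> v = (\<lambda>i\<in>{..<n}. u i \<oplus>\<^bsub>R\<^esub> v i)"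
  "a \<odot>\<^bsub>free_mod R n\<^esub> u = (\<lambda>i\<in>{..<n}. a \<otimes>\<^bsub>R\<^esub> u i)"
  by (simp_all add: free_mod_def)

definition basis_vec :: "('a, 'r) ring_scheme \<Rightarrow> nat \<Rightarrow> nat \<Rightarrow> (nat \<Rightarrow> 'a)" where
  "basis_vec R n i = (\<lambda>j\<in>{..<n}. if j = i then \<one>\<^bsub>R\<^esub> else \<zero>\<^bsub>R\<^esub>)"

definition noetherian_module :: "('a, 'r) ring_scheme \<Rightarrow> ('a, 'b, 'c) module_scheme \<Rightarrow> bool" where
  "noetherian_module R M \<longleftrightarrow> module R M \<and>
     (\<forall>K. submodule K R M \<longrightarrow> (\<exists>S. finite S \<and> S \<subseteq> K \<and> span_mod R M S = K))"

context cring
begin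

lemma module_regular: "module R (regular_module R)"
proof (rule moduleI)
  show "abelian_group (regular_module R)"
    by (rule abelian_groupI) (auto simp: a_ac intro: add.l_inv_ex)
qed (auto simp: cring_axioms l_distr r_distr m_assoc)

lemma module_free_mod: "module R (free_mod R n)"
proof (rule moduleI)
  show "abelian_group (free_mod R n)"
  proof (rule abelian_groupI)
    fix u assume u: "u \<in> carrier (free_mod R n)"
    then have "(\<lambda>i\<in>{..<n}. \<ominus> u i) \<oplus>\<^bsub>free_mod R n\<^esub> u = \<zero>\<^bsub>free_mod R n\<^esub>"
      by (auto simp: PiE_iff l_neg intro!: restrict_ext)
    moreover have "(\<lambda>i\<in>{..<n}. \<ominus> u i) \<in> carrier (free_mod R n)"
      using u by auto
    ultimately show "\<exists>v\<in>carrier (free_mod R n). v \<oplus>\<^bsub>free_mod R n\<^esub> u = \<zero>\<^bsub>free_mod R n\<^esub>"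
      by blast
  next
    fix u assume "u \<in> carrier (free_mod R n)"
    then show "\<zero>\<^bsub>free_mod R n\<^esub> \<oplus>\<^bsub>free_mod R n\<^esub> u = u"
      by (intro ext) (auto simp: PiE_iff extensional_def)
  qed (auto simp: PiE_iff a_ac intro!: restrict_ext)
  fix u assume "u \<in> carrier (free_mod R n)"
  then show "\<one> \<odot>\<^bsub>free_mod R n\<^esub> u = u"
    by (intro ext) (auto simp: PiE_iff extensional_def)
qed (auto simp: PiE_iff cring_axioms l_distr r_distr m_assoc intro!: restrict_ext)

lemma linear_map_coord: "i < n \<Longrightarrow> linear_map R (free_mod R n) (regular_module R) (\<lambda>u. u i)"
  by (auto simp: linear_map_def)

lemma basis_vec_closed: "basis_vec R n i \<in> carrier (free_mod R n)"
  by (auto simp: basis_vec_def)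

lemma free_mod_subset_if_basis:
  assumes K: "submodule K R (free_mod R n)" and e: "\<And>i. i < n \<Longrightarrow> basis_vec R n i \<in> K"
  shows "carrier (free_mod R n) \<subseteq> K"
proof -
  interpret F: module R "free_mod R n" by (rule module_free_mod)
  \<comment> \<open>Here j bounds the support of u: all coordinates from j on vanish. The induction
    removes the last coordinate that may be nonzero.\<close>
  have "u \<in> K" if "u \<in> carrier (free_mod R n)" "\<And>i. i < n \<Longrightarrow> j \<le> i \<Longrightarrow> u i = \<zero>" "j \<le> n" for u j
    using that
  proof (induction j arbitrary: u)
    case 0
    then have "u = \<zero>\<^bsub>free_mod R n\<^esub>"
      by (intro ext) (auto simp: PiE_iff extensional_def)
    then show ?case
      using F.submodule_closed(2)[OF K] by (simp only:)
  next
    case (Suc j)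
    have "u(j := \<zero>) \<in> K"
      using Suc.prems by (intro Suc.IH) (auto simp: PiE_iff extensional_def)
    moreover have "u j \<odot>\<^bsub>free_mod R n\<^esub> basis_vec R n j \<in> K"
      using Suc.prems e[of j] by (intro F.submodule_closed(5)[OF K]) auto
    moreover have "u(j := \<zero>) \<oplus>\<^bsub>free_mod R n\<^esub> u j \<odot>\<^bsub>free_mod R n\<^esub> basis_vec R n j = u"
      using Suc.prems(1,3) by (intro ext) (auto simp: PiE_iff extensional_def basis_vec_def)
    ultimately show ?case
      using F.submodule_closed(3)[OF K] by metis
  qed
  from this[of _ n] show ?thesis
    by auto
qed

text \<open>The preimage of K is a submodule containing the basis.\<close>

lemma linear_map_free_mod_in:
  assumes "module R M" "linear_map R (free_mod R n) M f" "submodule K R M"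
    and "\<And>i. i < n \<Longrightarrow> f (basis_vec R n i) \<in> K" "u \<in> carrier (free_mod R n)"
  shows "f u \<in> K"
proof -
  interpret module_hom R "free_mod R n" M f
    using assms(1,2) module_free_mod by (auto simp: module_hom_def module_hom_axioms_def)
  show ?thesis
    using free_mod_subset_if_basis[OF submodule_vimage[OF assms(3)]] assms(4,5) basis_vec_closed
    by blast
qed

lemma ex_linear_map_free_mod:
  assumes "module R M" "\<And>i. i < n \<Longrightarrow> w i \<in> carrier M"
  obtains g where "g \<in> mod_hom R (free_mod R n) M" "\<And>i. i < n \<Longrightarrow> g (basis_vec R n i) = w i"
proof -
  interpret M: module R M by fact
  define g where "g = (\<lambda>u. \<Oplus>\<^bsub>M\<^esub>i\<in>{..<n}. u i \<odot>\<^bsub>M\<^esub> w i)"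
  have cl: "(\<lambda>i. u i \<odot>\<^bsub>M\<^esub> w i) \<in> {..<n} \<rightarrow> carrier M" if "u \<in> {..<n} \<rightarrow>\<^sub>E carrier R" for u
    using that assms(2) by (auto simp: PiE_iff)
  have "linear_map R (free_mod R n) M g"
    unfolding linear_map_def
  proof (intro conjI ballI)
    show "g \<in> carrier (free_mod R n) \<rightarrow> carrier M"
      using cl by (auto simp: g_def intro!: M.finsum_closed)
  next
    fix u v assume "u \<in> carrier (free_mod R n)" "v \<in> carrier (free_mod R n)"
    then have uv: "u \<in> {..<n} \<rightarrow>\<^sub>E carrier R" "v \<in> {..<n} \<rightarrow>\<^sub>E carrier R"
      by auto
    have "g (u \<oplus>\<^bsub>free_mod R n\<^esub> v) = (\<Oplus>\<^bsub>M\<^esub>i\<in>{..<n}. u i \<odot>\<^bsub>M\<^esub> w i \<oplus>\<^bsub>M\<^esub> v i \<odot>\<^bsub>M\<^esub> w i)"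
      unfolding g_def using uv assms(2)
      by (intro M.finsum_cong') (auto simp: PiE_iff M.smult_l_distr)
    then show "g (u \<oplus>\<^bsub>free_mod R n\<^esub> v) = g u \<oplus>\<^bsub>M\<^esub> g v"
      using M.finsum_addf[OF cl[OF uv(1)] cl[OF uv(2)]] by (simp add: g_def)
  next
    fix a u assume a: "a \<in> carrier R" and "u \<in> carrier (free_mod R n)"
    then have u: "u \<in> {..<n} \<rightarrow>\<^sub>E carrier R"
      by auto
    have "g (a \<odot>\<^bsub>free_mod R n\<^esub> u) = (\<Oplus>\<^bsub>M\<^esub>i\<in>{..<n}. a \<odot>\<^bsub>M\<^esub> (u i \<odot>\<^bsub>M\<^esub> w i))"
      unfolding g_def using a u assms(2)
      by (intro M.finsum_cong') (auto simp: PiE_iff M.smult_assoc1)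
    then show "g (a \<odot>\<^bsub>free_mod R n\<^esub> u) = a \<odot>\<^bsub>M\<^esub> g u"
      using M.finsum_smult_ldistr[OF _ a cl[OF u]] by (simp add: g_def)
  qed
  moreover have "g (basis_vec R n i) = w i" if "i < n" for i
  proof -
    have "g (basis_vec R n i) = (\<Oplus>\<^bsub>M\<^esub>j\<in>{..<n}. if i = j then w j else \<zero>\<^bsub>M\<^esub>)"
      unfolding g_def using assms(2)
      by (intro M.finsum_cong') (auto simp: basis_vec_def)
    also have "\<dots> = w i"
      using that assms(2) by (intro M.finsum_singleton) auto
    finally show ?thesis .
  qed
  ultimately show thesis
    using basis_vec_closed
    by (intro that[OF restrict_in_mod_hom[OF module_free_mod]]) (simp_all del: free_mod_simps)
qed

lemma submodule_regular_iff_ideal: "submodule I R (regular_module R) \<longleftrightarrow> ideal I R"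
proof
  interpret RM: module R "regular_module R" by (rule module_regular)
  assume I: "submodule I R (regular_module R)"
  show "ideal I R"
  proof (rule idealI)
    have "\<ominus> x \<in> I" if "x \<in> I" for x
      using RM.submodule_closed(1)[OF I that] RM.submodule_closed(5)[OF I _ that, of "\<ominus> \<one>"]
      by (simp add: l_minus)
    then show "subgroup I (add_monoid R)"
      using RM.submodule_closed(1-3)[OF I] by (intro subgroup.intro) (auto simp: a_inv_def)
    fix a x assume *: "a \<in> I" "x \<in> carrier R"
    then show "x \<otimes> a \<in> I"
      using RM.submodule_closed(5)[OF I] by simp
    then show "a \<otimes> x \<in> I"
      using * RM.submodule_closed(1)[OF I, of a] by (simp add: m_comm)
  qed (rule ring_axioms)
next
  interpret RM: module R "regular_module R" by (rule module_regular)
  assume "ideal I R"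
  then interpret I: ideal I R .
  show "submodule I R (regular_module R)"
    using I.Icarr I.zero_closed I.a_closed I.I_l_closed by (intro RM.submoduleI') auto
qed

end

lemma (in module_hom) submodule_Int_kernel:
  assumes "submodule K R M"
  shows "submodule {x \<in> K. f x = \<zero>\<^bsub>N\<^esub>} R M"
proof (rule M.submoduleI')
  note K = M.submodule_closed[OF assms]
  show "{x \<in> K. f x = \<zero>\<^bsub>N\<^esub>} \<subseteq> carrier M" "\<zero>\<^bsub>M\<^esub> \<in> {x \<in> K. f x = \<zero>\<^bsub>N\<^esub>}"
    using K(1,2) f_zero by auto
  show "x \<oplus>\<^bsub>M\<^esub> y \<in> {x \<in> K. f x = \<zero>\<^bsub>N\<^esub>}"
    if "x \<in> {x \<in> K. f x = \<zero>\<^bsub>N\<^esub>}" "y \<in> {x \<in> K. f x = \<zero>\<^bsub>N\<^esub>}" for x y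
    using that K(1)[of x] K(1)[of y] K(3)[of x y] by (simp add: f_simps)
  show "a \<odot>\<^bsub>M\<^esub> x \<in> {x \<in> K. f x = \<zero>\<^bsub>N\<^esub>}"
    if "a \<in> carrier R" "x \<in> {x \<in> K. f x = \<zero>\<^bsub>N\<^esub>}" for a x
    using that K(1)[of x] K(5)[of a x] by (simp add: f_simps)
qed

text \<open>Preimages of the generators of the image, together with generators of the kernel part,
  generate K: any x in K differs from a combination y of the former by an element of the kernel.
  This is the inductive step for submodules of R^n.\<close>

lemma (in module_hom) finite_span_if_image_kernel:
  assumes K: "submodule K R M"
    and S: "finite S" "S \<subseteq> f ` K" "span_mod R N S = f ` K"
    and S': "finite S'" "S' \<subseteq> {x \<in> K. f x = \<zero>\<^bsub>N\<^esub>}" "span_mod R M S' = {x \<in> K. f x = \<zero>\<^bsub>N\<^esub>}"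
  shows "\<exists>T. finite T \<and> T \<subseteq> K \<and> span_mod R M T = K"
proof -
  note KD = M.submodule_closed[OF K]
  obtain T where T: "finite T" "T \<subseteq> K" "f ` T = S"
    using finite_subset_image[OF S(1,2)] by blast
  define L where "L = span_mod R M (T \<union> S')"
  have sub: "T \<union> S' \<subseteq> K"
    using T S' by auto
  have L: "submodule L R M"
    using sub KD(1) unfolding L_def by (intro M.submodule_span) auto
  note LD = M.submodule_closed[OF L]
  have "x \<in> L" if x: "x \<in> K" for x
  proof -
    have "f ` L \<supseteq> S"
      using span_superset[of "T \<union> S'" R M] T(3) by (auto simp: L_def)
    then have "f ` K \<subseteq> f ` L"
      using span_minimal[OF _ submodule_image[OF L]] S(3) by blast
    then obtain y where y: "y \<in> L" "f x = f y"
      using x by blast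
    have "y \<in> K"
      using y(1) span_minimal[OF sub K] by (auto simp: L_def)
    then have "x \<ominus>\<^bsub>M\<^esub> y \<in> span_mod R M S'"
      using x y(2) KD(1,4) by (simp add: S'(3) f_minus_eq_zero)
    then have "x \<ominus>\<^bsub>M\<^esub> y \<in> L"
      using span_mono[of S' "T \<union> S'" R M] by (auto simp: L_def)
    then have "(x \<ominus>\<^bsub>M\<^esub> y) \<oplus>\<^bsub>M\<^esub> y \<in> L"
      using y(1) LD(3) by blast
    moreover have "(x \<ominus>\<^bsub>M\<^esub> y) \<oplus>\<^bsub>M\<^esub> y = x"
      using x y(1) KD(1) LD(1) by (metis M.M.minus_closed M.minus_eq_iff_eq_plus)
    ultimately show ?thesis
      by simp
  qed
  then show ?thesis
    using T(1) S'(1) sub span_minimal[OF sub K] by (intro exI[of _ "T \<union> S'"]) (auto simp: L_def)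
qed

locale noetherian_cring = cring R + noetherian_ring R for R (structure)
begin

lemma noetherian_module_regular: "noetherian_module R (regular_module R)"
  unfolding noetherian_module_def
proof (intro conjI module_regular allI impI)
  fix K assume "submodule K R (regular_module R)"
  then have "ideal K R"
    by (simp add: submodule_regular_iff_ideal)
  then obtain A where A: "A \<subseteq> carrier R" "finite A" "K = Idl A"
    using finetely_gen by blast
  have "span_mod R (regular_module R) A = Idl A"
    unfolding span_mod_def hull_def genideal_def submodule_regular_iff_ideal ..
  then show "\<exists>S. finite S \<and> S \<subseteq> K \<and> span_mod R (regular_module R) S = K"
    using A genideal_self by blast
qed

text \<open>Induction on the number of leading coordinates in which elements of K may be nonzero.
  The last of these coordinates maps K onto an ideal, and its kernel in K is an instance with one
  coordinate fewer.\<close>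

lemma noetherian_module_free_mod: "noetherian_module R (free_mod R n)"
proof -
  interpret F: module R "free_mod R n" by (rule module_free_mod)
  have "\<exists>S. finite S \<and> S \<subseteq> K \<and> span_mod R (free_mod R n) S = K"
    if "submodule K R (free_mod R n)" "\<And>u i. u \<in> K \<Longrightarrow> i < n \<Longrightarrow> j \<le> i \<Longrightarrow> u i = \<zero>" "j \<le> n" for K j
    using that
  proof (induction j arbitrary: K)
    case 0
    have "u = \<zero>\<^bsub>free_mod R n\<^esub>" if "u \<in> K" for u
      using that F.submodule_closed(1)[OF 0(1) that] 0(2)[OF that]
      by (intro ext) (auto simp: PiE_iff extensional_def)
    then have "K \<subseteq> span_mod R (free_mod R n) {}"
      using F.submodule_closed(2)[OF F.submodule_span[of "{}"]] by auto
    then show ?case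
      using span_minimal[OF _ 0(1), of "{}"] by (intro exI[of _ "{}"]) auto
  next
    case (Suc j)
    interpret c: module_hom R "free_mod R n" "regular_module R" "\<lambda>u. u j"
      using linear_map_coord[of j n] Suc.prems(3) module_free_mod module_regular
      by (simp add: module_hom_def module_hom_axioms_def)
    have "submodule ((\<lambda>u. u j) ` K) R (regular_module R)"
      by (rule c.submodule_image) fact
    then obtain S where S: "finite S" "S \<subseteq> (\<lambda>u. u j) ` K"
      "span_mod R (regular_module R) S = (\<lambda>u. u j) ` K"
      using noetherian_module_regular unfolding noetherian_module_def by blast
    let ?K = "{u \<in> K. u j = \<zero>\<^bsub>regular_module R\<^esub>}"
    note KD = F.submodule_closed[OF Suc.prems(1)]
    have "submodule ?K R (free_mod R n)"
      by (rule c.submodule_Int_kernel) fact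
    moreover have "u i = \<zero>" if "u \<in> ?K" "i < n" "j \<le> i" for u i
      using that Suc.prems(2)[of u i] by (cases "i = j") (simp_all only: mem_Collect_eq regular_module_simps)
    ultimately have "\<exists>S'. finite S' \<and> S' \<subseteq> ?K \<and> span_mod R (free_mod R n) S' = ?K"
      using Suc_leD[OF Suc.prems(3)] by (rule Suc.IH)
    then obtain S' where "finite S'" "S' \<subseteq> ?K" "span_mod R (free_mod R n) S' = ?K"
      by blast
    then show ?case
      using c.finite_span_if_image_kernel[OF Suc.prems(1) S] by blast
  qed
  from this[of _ n] show ?thesis
    unfolding noetherian_module_def using module_free_mod by auto
qed

end

section \<open>Zero divisors and the exchange of regular sequences\<close>

text \<open>The annihilator of the class of u in M/K.\<close>

definition colon :: "('a, 'r) ring_scheme \<Rightarrow> ('a, 'b, 'c) module_scheme \<Rightarrow> 'b set \<Rightarrow> 'b \<Rightarrow> 'a set" where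
  "colon R M K u = {a \<in> carrier R. a \<odot>\<^bsub>M\<^esub> u \<in> K}"

text \<open>For an ideal J this is Hom(R/J, M/K) = 0. Over Noetherian modules it amounts to J
  containing a nonzerodivisor on M/K: one direction is immediate, the other combines the finite set
  of primes below with prime avoidance.\<close>

definition socle_free :: "'a set \<Rightarrow> ('a, 'b, 'c) module_scheme \<Rightarrow> 'b set \<Rightarrow> bool" where
  "socle_free J M K \<longleftrightarrow> (\<forall>u\<in>carrier M. (\<forall>a\<in>J. a \<odot>\<^bsub>M\<^esub> u \<in> K) \<longrightarrow> u \<in> K)"

lemma socle_free_if_nzd: "nzd M K x \<Longrightarrow> x \<in> J \<Longrightarrow> socle_free J M K"
  unfolding socle_free_def nzd_def by blast

lemma (in module) ideal_colon:
  assumes K: "submodule K R M" and u: "u \<in> carrier M"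
  shows "ideal (colon R M K u) R"
proof -
  interpret RM: module R "regular_module R" by (rule R.module_regular)
  note KD = submodule_closed[OF K]
  have "submodule (colon R M K u) R (regular_module R)"
    using u KD(2,3,5) by (intro RM.submoduleI') (auto simp: colon_def smult_l_distr smult_assoc1)
  then show ?thesis
    by (simp add: R.submodule_regular_iff_ideal)
qed

lemma (in module) submodule_colon_elem:
  assumes K: "submodule K R M" and a: "a \<in> carrier R"
  shows "submodule {w \<in> carrier M. a \<odot>\<^bsub>M\<^esub> w \<in> K} R M"
proof (rule submoduleI')
  note KD = submodule_closed[OF K]
  show "\<zero>\<^bsub>M\<^esub> \<in> {w \<in> carrier M. a \<odot>\<^bsub>M\<^esub> w \<in> K}"
    using a KD(2) by simp
  show "x \<oplus>\<^bsub>M\<^esub> y \<in> {w \<in> carrier M. a \<odot>\<^bsub>M\<^esub> w \<in> K}"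
    if "x \<in> {w \<in> carrier M. a \<odot>\<^bsub>M\<^esub> w \<in> K}" "y \<in> {w \<in> carrier M. a \<odot>\<^bsub>M\<^esub> w \<in> K}" for x y
    using that a KD(3) by (simp add: smult_r_distr)
  show "b \<odot>\<^bsub>M\<^esub> x \<in> {w \<in> carrier M. a \<odot>\<^bsub>M\<^esub> w \<in> K}"
    if "b \<in> carrier R" "x \<in> {w \<in> carrier M. a \<odot>\<^bsub>M\<^esub> w \<in> K}" for b x
  proof -
    have "a \<odot>\<^bsub>M\<^esub> (b \<odot>\<^bsub>M\<^esub> x) = b \<odot>\<^bsub>M\<^esub> (a \<odot>\<^bsub>M\<^esub> x)"
      using that a by (simp add: smult_assoc1[symmetric] R.m_comm)
    then show ?thesis
      using that a KD(5) by simp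
  qed
qed auto

text \<open>Noetherianity supplies finitely many generators of the span of U, but not inside U. Each
  of them involves only finitely many elements of U, because the union D of the spans of finite
  subsets is directed and hence a submodule.\<close>

lemma (in module) finite_subset_spanning:
  assumes "noetherian_module R M" and U: "U \<subseteq> carrier M"
  obtains U' where "finite U'" "U' \<subseteq> U" "U \<subseteq> span_mod R M U'"
proof -
  define D where "D = (\<Union>V\<in>{V. finite V \<and> V \<subseteq> U}. span_mod R M V)"
  have span: "submodule (span_mod R M V) R M" if "V \<subseteq> U" for V
    using that U by (intro submodule_span) auto
  have mono: "span_mod R M V \<subseteq> D" if "finite V" "V \<subseteq> U" for V
    using that by (auto simp: D_def)
  have "submodule D R M"
  proof (rule submoduleI')
    show "D \<subseteq> carrier M"
      using span submodule_closed(1) by (auto simp: D_def)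
    show "\<zero>\<^bsub>M\<^esub> \<in> D"
      using mono[of "{}"] submodule_closed(2)[OF span[of "{}"]] by auto
    show "x \<oplus>\<^bsub>M\<^esub> y \<in> D" if xy: "x \<in> D" "y \<in> D" for x y
    proof -
      obtain V W where "finite V" "V \<subseteq> U" "x \<in> span_mod R M V" "finite W" "W \<subseteq> U" "y \<in> span_mod R M W"
        using xy by (auto simp: D_def)
      then have "x \<in> span_mod R M (V \<union> W)" "y \<in> span_mod R M (V \<union> W)" "finite (V \<union> W)" "V \<union> W \<subseteq> U"
        using span_mono[of V "V \<union> W" R M] span_mono[of W "V \<union> W" R M] by auto
      then show ?thesis
        using submodule_closed(3)[OF span] mono by blast
    qed
    show "a \<odot>\<^bsub>M\<^esub> x \<in> D" if "a \<in> carrier R" "x \<in> D" for a x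
      using that submodule_closed(5)[OF span] by (auto simp: D_def)
  qed
  moreover have "U \<subseteq> D"
  proof
    fix u assume "u \<in> U"
    then show "u \<in> D"
      using mono[of "{u}"] span_superset[of "{u}" R M] by auto
  qed
  ultimately have UD: "span_mod R M U \<subseteq> D"
    by (intro span_minimal)
  obtain S where S: "finite S" "S \<subseteq> span_mod R M U" "span_mod R M S = span_mod R M U"
    using assms(1) span[of U] unfolding noetherian_module_def by blast
  have "\<forall>s\<in>S. \<exists>V. finite V \<and> V \<subseteq> U \<and> s \<in> span_mod R M V"
    using S(2) UD by (auto simp: D_def)
  then obtain V where V: "\<And>s. s \<in> S \<Longrightarrow> finite (V s) \<and> V s \<subseteq> U \<and> s \<in> span_mod R M (V s)"
    by metis
  define U' where "U' = (\<Union>s\<in>S. V s)"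
  have U': "finite U'" "U' \<subseteq> U"
    using S(1) V by (auto simp: U'_def)
  have "S \<subseteq> span_mod R M U'"
    using V span_mono[of "V s" U' R M for s] by (auto simp: U'_def)
  then have "span_mod R M S \<subseteq> span_mod R M U'"
    using span[OF U'(2)] by (intro span_minimal)
  then have "U \<subseteq> span_mod R M U'"
    using S(3) span_superset[of U R M] by blast
  with U' show thesis
    by (rule that)
qed

section \<open>Prime avoidance\<close>

lemma (in ideal) add_mem_iff:
  assumes "x \<in> I" "y \<in> carrier R"
  shows "x \<oplus> y \<in> I \<longleftrightarrow> y \<in> I"
proof
  assume "x \<oplus> y \<in> I"
  then have "\<ominus> x \<oplus> (x \<oplus> y) \<in> I"
    using additive_subgroup.a_closed additive_subgroup.a_inv_closed additive_subgroup_axioms assms(1)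
    by metis
  moreover have "\<ominus> x \<oplus> (x \<oplus> y) = y"
    using assms Icarr[of x] by (simp add: a_assoc[symmetric] l_neg)
  ultimately show "y \<in> I"
    by simp
qed (use assms in simp)

context cring
begin

text \<open>Multiply elements chosen from each \<open>q\<close> outside \<open>p\<close>; primality
  keeps the product outside \<open>p\<close>.\<close>

lemma ex_common_elem_not_in_prime:
  assumes p: "primeideal p R" and "finite Q" "\<And>q. q \<in> Q \<Longrightarrow> ideal q R \<and> \<not> q \<subseteq> p"
  shows "\<exists>a\<in>carrier R. a \<notin> p \<and> (\<forall>q\<in>Q. a \<in> q)"
proof -
  interpret primeideal p R by fact
  show ?thesis
    using assms(2,3)
  proof (induction Q rule: finite_induct)
    case empty
    then show ?case
      using one_imp_carrier I_notcarr by blast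
  next
    case (insert q Q)
    then have "\<exists>a\<in>carrier R. a \<notin> p \<and> (\<forall>q\<in>Q. a \<in> q)"
      by (intro insert.IH) blast
    then obtain a where a: "a \<in> carrier R" "a \<notin> p" "\<forall>q\<in>Q. a \<in> q"
      by blast
    obtain b where b: "b \<in> q" "b \<notin> p" "b \<in> carrier R"
      using insert.prems[of q] ideal.Icarr[of q R] by blast
    have "a \<otimes> b \<notin> p"
      using I_prime a b by blast
    moreover have "\<forall>q'\<in>insert q Q. a \<otimes> b \<in> q'"
    proof
      fix q' assume "q' \<in> insert q Q"
      then have "ideal q' R" "a \<in> q' \<or> b \<in> q'"
        using a b insert.prems by blast+
      then show "a \<otimes> b \<in> q'"
        using a(1) b(3) by (meson ideal.I_l_closed ideal.I_r_closed)
    qed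
    ultimately show ?case
      using a b by blast
  qed
qed

lemma prime_avoidance:
  assumes J: "ideal J R" and "finite P" "\<And>p. p \<in> P \<Longrightarrow> primeideal p R \<and> \<not> J \<subseteq> p"
  shows "\<exists>z\<in>J. \<forall>p\<in>P. z \<notin> p"
  using assms(2,3)
proof (induction P rule: finite_psubset_induct)
  case (psubset P)
  interpret J: ideal J R by fact
  consider "P = {}" | p q where "p \<in> P" "q \<in> P" "p \<noteq> q" "q \<subseteq> p"
    | p where "p \<in> P" "\<And>q. q \<in> P - {p} \<Longrightarrow> \<not> q \<subseteq> p"
    by blast
  then show ?case
  proof cases
    case 1
    then show ?thesis
      using J.zero_closed by blast
  next
    case 2
    then obtain z where "z \<in> J" "\<forall>p\<in>P - {q}. z \<notin> p"
      using psubset.IH[of "P - {q}"] psubset.prems by blast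
    then show ?thesis
      using 2 by blast
  next
    case 3
    obtain z where z: "z \<in> J" "\<forall>q\<in>P - {p}. z \<notin> q"
      using psubset.IH[of "P - {p}"] psubset.prems 3(1) by blast
    obtain a where a: "a \<in> carrier R" "a \<notin> p" "\<forall>q\<in>insert J (P - {p}). a \<in> q"
      using ex_common_elem_not_in_prime[of p "insert J (P - {p})"] psubset.hyps psubset.prems 3 J
      by (auto simp: primeideal_def)
    show ?thesis
    proof (cases "z \<in> p")
      case True
      then have "z \<oplus> a \<notin> p"
        using ideal.add_mem_iff[of p R z a] a psubset.prems 3(1) by (auto simp: primeideal_def)
      moreover have "z \<oplus> a \<notin> q" if "q \<in> P - {p}" for q
        using ideal.add_mem_iff[of q R a z] a z that psubset.prems[of q] J.Icarr[of z]
        by (auto simp: primeideal_def a_comm)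
      moreover have "z \<oplus> a \<in> J"
        using z a by auto
      ultimately show ?thesis
        by blast
    next
      case False
      then show ?thesis
        using z by blast
    qed
  qed
qed

end

context noetherian_cring
begin

text \<open>In a Noetherian ring a nonempty chain of ideals contains its union, so Zorn's lemma
  applies to any family of ideals. It is used for the ideals (K : u) and for the proper
  ideals.\<close>

lemma ex_maximal_ideal_in_family:
  assumes "I \<in> A" "\<And>I. I \<in> A \<Longrightarrow> ideal I R"
  shows "\<exists>m\<in>A. I \<subseteq> m \<and> (\<forall>q\<in>A. m \<subseteq> q \<longrightarrow> q = m)"
proof -
  have "\<exists>m\<in>{q \<in> A. I \<subseteq> q}. \<forall>q\<in>{q \<in> A. I \<subseteq> q}. m \<subseteq> q \<longrightarrow> q = m"
  proof (rule subset_Zorn_nonempty)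
    show "{q \<in> A. I \<subseteq> q} \<noteq> {}"
      using assms(1) by auto
    fix C assume C: "C \<noteq> {}" "subset.chain {q \<in> A. I \<subseteq> q} C"
    then have "subset.chain {I. ideal I R} C"
      using assms(2) by (auto simp: subset_chain_def)
    then have "\<Union>C \<in> C"
      using ideal_chain_is_trivial C(1) by blast
    then show "\<Union>C \<in> {q \<in> A. I \<subseteq> q}"
      using C(2) by (auto simp: subset_chain_def)
  qed
  then obtain m where m: "m \<in> A" "I \<subseteq> m" "\<forall>q\<in>{q \<in> A. I \<subseteq> q}. m \<subseteq> q \<longrightarrow> q = m"
    by blast
  then have "\<forall>q\<in>A. m \<subseteq> q \<longrightarrow> q = m"
    by blast
  with m show ?thesis
    by blast
qed

text \<open>The primes are the maximal ones among the ideals \<open>(K : u)\<close> with \<open>u \<notin> K\<close>.\<close>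

lemma finite_primes_covering_zero_divisors:
  assumes noeth: "noetherian_module R M" and K: "submodule K R M"
    and J: "socle_free J M K" "J \<subseteq> carrier R"
  obtains P where "finite P" "\<And>p. p \<in> P \<Longrightarrow> primeideal p R \<and> \<not> J \<subseteq> p"
    "\<And>z. z \<in> carrier R \<Longrightarrow> \<forall>p\<in>P. z \<notin> p \<Longrightarrow> nzd M K z"
proof -
  interpret module R M using noeth by (simp add: noetherian_module_def)
  note KD = submodule_closed[OF K]
  define A where "A = colon R M K ` (carrier M - K)"
  define Amax where "Amax = {p \<in> A. \<forall>q\<in>A. p \<subseteq> q \<longrightarrow> q = p}"
  have ideal: "ideal I R" if "I \<in> A" for I
    using that ideal_colon[OF K] by (auto simp: A_def)
  have prime: "primeideal p R" if p: "p \<in> Amax" for p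
  proof (rule primeidealI)
    obtain u where u: "p = colon R M K u" "u \<in> carrier M - K"
      using p by (auto simp: Amax_def A_def)
    show "ideal p R" "cring R"
      using p ideal by (auto simp: Amax_def cring_axioms)
    have "\<one> \<notin> p"
      using u by (simp add: colon_def)
    then show "carrier R \<noteq> p"
      by auto
    fix a b assume ab: "a \<in> carrier R" "b \<in> carrier R" "a \<otimes> b \<in> p"
    \<comment> \<open>For b outside p, the ideal (K : b u) is again a member of the family and
      contains p, so the two coincide by maximality; and a kills b u modulo K.\<close>
    have "a \<in> p" if b: "b \<notin> p"
    proof -
      have "b \<odot>\<^bsub>M\<^esub> u \<in> carrier M - K"
        using b ab u by (auto simp: colon_def)
      then have "colon R M K (b \<odot>\<^bsub>M\<^esub> u) \<in> A"
        by (auto simp: A_def)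
      moreover have "p \<subseteq> colon R M K (b \<odot>\<^bsub>M\<^esub> u)"
      proof
        fix c assume c: "c \<in> p"
        have "c \<odot>\<^bsub>M\<^esub> (b \<odot>\<^bsub>M\<^esub> u) = b \<odot>\<^bsub>M\<^esub> (c \<odot>\<^bsub>M\<^esub> u)"
          using c ab u by (simp add: colon_def smult_assoc1[symmetric] m_comm)
        then show "c \<in> colon R M K (b \<odot>\<^bsub>M\<^esub> u)"
          using c ab u KD(5) by (simp add: colon_def)
      qed
      ultimately have "colon R M K (b \<odot>\<^bsub>M\<^esub> u) = p"
        using p by (auto simp: Amax_def)
      moreover have "a \<in> colon R M K (b \<odot>\<^bsub>M\<^esub> u)"
        using ab u by (simp add: colon_def smult_assoc1)
      ultimately show ?thesis
        by simp
    qed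
    then show "a \<in> p \<or> b \<in> p"
      by blast
  qed
  \<comment> \<open>Finiteness of the set of maximal members: finitely many u' in U span all of U.
    If p = (K : u) contained none of the ideals (K : u'), some a outside p would lie in all of them.
    It would send every u', hence also u, into K, so a would be in p after all.\<close>
  define U where "U = {u \<in> carrier M - K. colon R M K u \<in> Amax}"
  obtain U' where U': "finite U'" "U' \<subseteq> U" "U \<subseteq> span_mod R M U'"
    using finite_subset_spanning[OF noeth, of U] by (auto simp: U_def)
  define P where "P = colon R M K ` U'"
  have "Amax \<subseteq> P"
  proof
    fix p assume p: "p \<in> Amax"
    then obtain u where u: "p = colon R M K u" "u \<in> U"
      by (auto simp: Amax_def A_def U_def)
    have "\<exists>q\<in>P. q \<subseteq> p"
    proof (rule ccontr)
      assume *: "\<not> (\<exists>q\<in>P. q \<subseteq> p)"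
      have "\<exists>a\<in>carrier R. a \<notin> p \<and> (\<forall>q\<in>P. a \<in> q)"
        using * U'(1,2) ideal
        by (intro ex_common_elem_not_in_prime prime p) (auto simp: P_def U_def Amax_def)
      then obtain a where a: "a \<in> carrier R" "a \<notin> p" "\<forall>q\<in>P. a \<in> q"
        by blast
      have "U' \<subseteq> {w \<in> carrier M. a \<odot>\<^bsub>M\<^esub> w \<in> K}"
        using a(3) U'(2) by (auto simp: P_def U_def colon_def)
      then have "span_mod R M U' \<subseteq> {w \<in> carrier M. a \<odot>\<^bsub>M\<^esub> w \<in> K}"
        by (intro span_minimal submodule_colon_elem K a(1))
      then have "a \<in> p"
        using u U'(3) a(1) by (auto simp: colon_def)
      then show False
        using a(2) by blast
    qed
    then obtain q where q: "q \<in> P" "q \<subseteq> p"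
      by blast
    then have "q \<in> Amax"
      using U'(2) by (auto simp: P_def U_def)
    then have "p = q"
      using q p by (auto simp: Amax_def)
    then show "p \<in> P"
      using q by simp
  qed
  have PX: "P \<subseteq> Amax"
    using U'(2) by (auto simp: P_def U_def)
  show thesis
  proof
    show "finite P"
      using U'(1) by (simp add: P_def)
    show "primeideal p R \<and> \<not> J \<subseteq> p" if p: "p \<in> P" for p
    proof
      show "primeideal p R"
        using p PX prime by blast
      obtain u where "p = colon R M K u" "u \<in> carrier M - K"
        using subsetD[OF PX p] by (auto simp: Amax_def A_def)
      then show "\<not> J \<subseteq> p"
        using J by (auto simp: colon_def socle_free_def)
    qed
    show "nzd M K z" if z: "z \<in> carrier R" "\<forall>p\<in>P. z \<notin> p" for z
      unfolding nzd_def
    proof (intro ballI impI, rule ccontr)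
      fix w assume w: "w \<in> carrier M" "z \<odot>\<^bsub>M\<^esub> w \<in> K" "w \<notin> K"
      \<comment> \<open>A zero divisor z on M/K lies in some (K : w) with w outside K, hence in a
        maximal member of the family.\<close>
      then obtain m where "m \<in> Amax" "colon R M K w \<subseteq> m"
        using ex_maximal_ideal_in_family[of "colon R M K w" A] ideal by (auto simp: Amax_def A_def)
      then have "z \<in> m" "m \<in> P"
        using w z \<open>Amax \<subseteq> P\<close> by (auto simp: colon_def)
      then show False
        using z by blast
    qed
  qed
qed

end

text \<open>Substitute v = x v' into x u = z v, both modulo K. In the two arguments that follow,
  cancelling x then shows that u is z v' modulo K.\<close>

lemma (in module) smult_minus_mem_if_syzygy:
  assumes K: "submodule K R M" and x: "x \<in> carrier R" and z: "z \<in> carrier R"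
    and u: "u \<in> carrier M" and v: "v \<in> carrier M" "x \<odot>\<^bsub>M\<^esub> u \<ominus>\<^bsub>M\<^esub> z \<odot>\<^bsub>M\<^esub> v \<in> K"
    and v': "v' \<in> carrier M" "v \<ominus>\<^bsub>M\<^esub> x \<odot>\<^bsub>M\<^esub> v' \<in> K"
  shows "x \<odot>\<^bsub>M\<^esub> (u \<ominus>\<^bsub>M\<^esub> z \<odot>\<^bsub>M\<^esub> v') \<in> K"
proof -
  have "(x \<odot>\<^bsub>M\<^esub> u \<ominus>\<^bsub>M\<^esub> z \<odot>\<^bsub>M\<^esub> v) \<oplus>\<^bsub>M\<^esub> z \<odot>\<^bsub>M\<^esub> (v \<ominus>\<^bsub>M\<^esub> x \<odot>\<^bsub>M\<^esub> v') \<in> K"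
    using submodule_closed[OF K] v v' z by simp
  also have "(x \<odot>\<^bsub>M\<^esub> u \<ominus>\<^bsub>M\<^esub> z \<odot>\<^bsub>M\<^esub> v) \<oplus>\<^bsub>M\<^esub> z \<odot>\<^bsub>M\<^esub> (v \<ominus>\<^bsub>M\<^esub> x \<odot>\<^bsub>M\<^esub> v') = x \<odot>\<^bsub>M\<^esub> (u \<ominus>\<^bsub>M\<^esub> z \<odot>\<^bsub>M\<^esub> v')"
  proof -
    have "z \<odot>\<^bsub>M\<^esub> (x \<odot>\<^bsub>M\<^esub> v') = x \<odot>\<^bsub>M\<^esub> (z \<odot>\<^bsub>M\<^esub> v')"
      using x z v'(1) by (simp add: smult_assoc1[symmetric] R.m_comm)
    then show ?thesis
      using x z u v(1) v'(1)
      by (simp add: smult_r_distr smult_r_minus a_minus_def M.a_assoc M.r_neg1)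
  qed
  finally show ?thesis .
qed

text \<open>For z in J as well, both conditions express the vanishing of Ext^1(R/J, M/K), whichever
  nonzerodivisor is divided out. Concretely, if J u lies in K + zM, then x u = z v modulo K. This v
  is killed by J modulo K + xM, hence zero there, and cancelling x brings u into K + zM.\<close>

lemma (in module) socle_free_adjoin_if_nzd:
  assumes K: "submodule K R M" and J: "J \<subseteq> carrier R"
    and x: "x \<in> J" "nzd M K x" and z: "z \<in> carrier R" "nzd M K z"
    and soc: "socle_free J M (adjoin M K x)"
  shows "socle_free J M (adjoin M K z)"
  unfolding socle_free_def
proof (intro ballI impI)
  note KD = submodule_closed[OF K]
  have xR: "x \<in> carrier R"
    using J x(1) by blast
  note mem = mem_adjoin_iff[OF K]
  fix u assume u: "u \<in> carrier M" "\<forall>a\<in>J. a \<odot>\<^bsub>M\<^esub> u \<in> adjoin M K z"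
  then obtain v where v: "v \<in> carrier M" "x \<odot>\<^bsub>M\<^esub> u \<ominus>\<^bsub>M\<^esub> z \<odot>\<^bsub>M\<^esub> v \<in> K"
    using mem[OF z(1), of "x \<odot>\<^bsub>M\<^esub> u"] x xR by auto
  have "a \<odot>\<^bsub>M\<^esub> v \<in> adjoin M K x" if a: "a \<in> J" for a
  proof -
    have aR: "a \<in> carrier R"
      using a J by blast
    obtain w where w: "w \<in> carrier M" "a \<odot>\<^bsub>M\<^esub> u \<ominus>\<^bsub>M\<^esub> z \<odot>\<^bsub>M\<^esub> w \<in> K"
      using mem[OF z(1), of "a \<odot>\<^bsub>M\<^esub> u"] u a aR by auto
    \<comment> \<open>In this combination the two terms a x u cancel, and what remains is divisible
      by z.\<close>
    have "x \<odot>\<^bsub>M\<^esub> (a \<odot>\<^bsub>M\<^esub> u \<ominus>\<^bsub>M\<^esub> z \<odot>\<^bsub>M\<^esub> w) \<ominus>\<^bsub>M\<^esub> a \<odot>\<^bsub>M\<^esub> (x \<odot>\<^bsub>M\<^esub> u \<ominus>\<^bsub>M\<^esub> z \<odot>\<^bsub>M\<^esub> v) \<in> K"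
      using KD v w xR aR by simp
    also have "x \<odot>\<^bsub>M\<^esub> (a \<odot>\<^bsub>M\<^esub> u \<ominus>\<^bsub>M\<^esub> z \<odot>\<^bsub>M\<^esub> w) \<ominus>\<^bsub>M\<^esub> a \<odot>\<^bsub>M\<^esub> (x \<odot>\<^bsub>M\<^esub> u \<ominus>\<^bsub>M\<^esub> z \<odot>\<^bsub>M\<^esub> v) =
      z \<odot>\<^bsub>M\<^esub> (a \<odot>\<^bsub>M\<^esub> v \<ominus>\<^bsub>M\<^esub> x \<odot>\<^bsub>M\<^esub> w)"
    proof -
      have "x \<odot>\<^bsub>M\<^esub> (a \<odot>\<^bsub>M\<^esub> u) = a \<odot>\<^bsub>M\<^esub> (x \<odot>\<^bsub>M\<^esub> u)" "x \<odot>\<^bsub>M\<^esub> (z \<odot>\<^bsub>M\<^esub> w) = z \<odot>\<^bsub>M\<^esub> (x \<odot>\<^bsub>M\<^esub> w)"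
        "a \<odot>\<^bsub>M\<^esub> (z \<odot>\<^bsub>M\<^esub> v) = z \<odot>\<^bsub>M\<^esub> (a \<odot>\<^bsub>M\<^esub> v)"
        using xR aR z(1) u(1) v(1) w(1) by (simp_all add: smult_assoc1[symmetric] R.m_comm)
      then show ?thesis
        using xR aR z(1) u(1) v(1) w(1)
        by (simp add: smult_r_distr smult_r_minus a_minus_def M.minus_add M.a_ac M.r_neg M.r_neg1 M.r_neg2)
    qed
    finally have "a \<odot>\<^bsub>M\<^esub> v \<ominus>\<^bsub>M\<^esub> x \<odot>\<^bsub>M\<^esub> w \<in> K"
      using z(2) v(1) w(1) aR xR by (simp add: nzd_def)
    then show ?thesis
      using mem[OF xR] v(1) w(1) aR by auto
  qed
  then have "v \<in> adjoin M K x"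
    using soc v(1) by (simp add: socle_free_def)
  then obtain v' where v': "v' \<in> carrier M" "v \<ominus>\<^bsub>M\<^esub> x \<odot>\<^bsub>M\<^esub> v' \<in> K"
    using mem[OF xR v(1)] by blast
  have "x \<odot>\<^bsub>M\<^esub> (u \<ominus>\<^bsub>M\<^esub> z \<odot>\<^bsub>M\<^esub> v') \<in> K"
    by (rule smult_minus_mem_if_syzygy[OF K xR z(1) u(1) v v'])
  then have "u \<ominus>\<^bsub>M\<^esub> z \<odot>\<^bsub>M\<^esub> v' \<in> K"
    using x(2) u(1) v'(1) z(1) by (simp add: nzd_def)
  then show "u \<in> adjoin M K z"
    using mem[OF z(1) u(1)] v'(1) by blast
qed

text \<open>The half of permuting the sequence x, w that holds for every module; that w is then also
  a nonzerodivisor modulo \<open>K\<close> can fail in general.\<close>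

lemma (in module) nzd_adjoin_swap:
  assumes K: "submodule K R M" and x: "x \<in> carrier R" "nzd M K x"
    and w: "w \<in> carrier R" "nzd M (adjoin M K x) w"
  shows "nzd M (adjoin M K w) x"
  unfolding nzd_def
proof (intro ballI impI)
  note KD = submodule_closed[OF K]
  note mem = mem_adjoin_iff[OF K]
  fix u assume u: "u \<in> carrier M" "x \<odot>\<^bsub>M\<^esub> u \<in> adjoin M K w"
  then obtain v where v: "v \<in> carrier M" "x \<odot>\<^bsub>M\<^esub> u \<ominus>\<^bsub>M\<^esub> w \<odot>\<^bsub>M\<^esub> v \<in> K"
    using mem[OF w(1), of "x \<odot>\<^bsub>M\<^esub> u"] x by auto
  have "w \<odot>\<^bsub>M\<^esub> v \<ominus>\<^bsub>M\<^esub> x \<odot>\<^bsub>M\<^esub> u = \<ominus>\<^bsub>M\<^esub> (x \<odot>\<^bsub>M\<^esub> u \<ominus>\<^bsub>M\<^esub> w \<odot>\<^bsub>M\<^esub> v)"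
    using u(1) v(1) x w(1) by (simp add: a_minus_def M.minus_add M.a_comm)
  then have "w \<odot>\<^bsub>M\<^esub> v \<ominus>\<^bsub>M\<^esub> x \<odot>\<^bsub>M\<^esub> u \<in> K"
    using KD(6)[OF v(2)] by simp
  then have "w \<odot>\<^bsub>M\<^esub> v \<in> adjoin M K x"
    using mem[OF x(1), of "w \<odot>\<^bsub>M\<^esub> v"] u(1) v(1) w(1) by auto
  then have "v \<in> adjoin M K x"
    using w(2) v(1) by (simp add: nzd_def)
  then obtain v' where v': "v' \<in> carrier M" "v \<ominus>\<^bsub>M\<^esub> x \<odot>\<^bsub>M\<^esub> v' \<in> K"
    using mem[OF x(1) v(1)] by blast
  have "x \<odot>\<^bsub>M\<^esub> (u \<ominus>\<^bsub>M\<^esub> w \<odot>\<^bsub>M\<^esub> v') \<in> K"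
    by (rule smult_minus_mem_if_syzygy[OF K x(1) w(1) u(1) v v'])
  then have "u \<ominus>\<^bsub>M\<^esub> w \<odot>\<^bsub>M\<^esub> v' \<in> K"
    using x(2) u(1) v'(1) w(1) by (simp add: nzd_def)
  then show "u \<in> adjoin M K w"
    using mem[OF w(1) u(1)] v'(1) by blast
qed

context noetherian_cring
begin

text \<open>The exchange step behind the equality of the lengths of maximal regular sequences.\<close>

lemma weakly_regular_exchange:
  assumes "noetherian_module R M" "submodule K R M" and J: "ideal J R"
    and "weakly_regular M K xs" "set xs \<subseteq> J" "length xs = Suc n" "z \<in> J" "nzd M K z"
  shows "\<exists>ys. length ys = n \<and> set ys \<subseteq> J \<and> weakly_regular M (adjoin M K z) ys"
  using assms(2,4-)
proof (induction n arbitrary: K xs z)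
  case 0
  show ?case
    by (intro exI[of _ "[]"]) simp
next
  case (Suc n)
  interpret module R M using assms(1) by (simp add: noetherian_module_def)
  interpret J: ideal J R by fact
  have JR: "J \<subseteq> carrier R"
    using J.Icarr by blast
  obtain x x' xs' where xs: "xs = x # x' # xs'"
    using Suc.prems(4) by (metis length_Suc_conv)
  note K = Suc.prems(1)
  have x: "x \<in> J" "x \<in> carrier R" "nzd M K x" and x': "x' \<in> J" "nzd M (adjoin M K x) x'"
    and z: "z \<in> J" "z \<in> carrier R" "nzd M K z"
    using Suc.prems xs JR by auto
  have Kx: "submodule (adjoin M K x) R M" and Kz: "submodule (adjoin M K z) R M"
    using submodule_adjoin K x z by auto
  have soc_x: "socle_free J M (adjoin M K x)" and soc: "socle_free J M K"
    using socle_free_if_nzd[OF x'(2,1)] socle_free_if_nzd[OF x(3,1)] .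
  \<comment> \<open>The second element x' shows that M/(K + xM) has no J-socle. Carried over to z,
    this provides nonzerodivisors in J modulo K + zM.\<close>
  have soc_z: "socle_free J M (adjoin M K z)"
    using socle_free_adjoin_if_nzd[OF K JR x(1,3) z(2,3) soc_x] .
  obtain P1 where P1: "finite P1" "\<And>p. p \<in> P1 \<Longrightarrow> primeideal p R \<and> \<not> J \<subseteq> p"
    "\<And>w. w \<in> carrier R \<Longrightarrow> \<forall>p\<in>P1. w \<notin> p \<Longrightarrow> nzd M (adjoin M K x) w"
    using finite_primes_covering_zero_divisors[OF assms(1) Kx soc_x JR] by blast
  obtain P2 where P2: "finite P2" "\<And>p. p \<in> P2 \<Longrightarrow> primeideal p R \<and> \<not> J \<subseteq> p"
    "\<And>w. w \<in> carrier R \<Longrightarrow> \<forall>p\<in>P2. w \<notin> p \<Longrightarrow> nzd M (adjoin M K z) w"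
    using finite_primes_covering_zero_divisors[OF assms(1) Kz soc_z JR] by blast
  obtain P3 where P3: "finite P3" "\<And>p. p \<in> P3 \<Longrightarrow> primeideal p R \<and> \<not> J \<subseteq> p"
    "\<And>w. w \<in> carrier R \<Longrightarrow> \<forall>p\<in>P3. w \<notin> p \<Longrightarrow> nzd M K w"
    using finite_primes_covering_zero_divisors[OF assms(1) K soc JR] by blast
  \<comment> \<open>The element w mediates between x and z. The sequence x, x', xs' becomes in turn
    x, w, ys; then w, x, ys; then w, z, ys'; and finally z, w, ys'. The first and third changes are
    the induction hypothesis modulo K + xM and K + wM; the other two swap neighbours.\<close>
  have "\<exists>w\<in>J. \<forall>p\<in>P1 \<union> P2 \<union> P3. w \<notin> p"
    using P1(1,2) P2(1,2) P3(1,2) by (intro prime_avoidance J) auto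
  then obtain w where "w \<in> J" "\<forall>p\<in>P1 \<union> P2 \<union> P3. w \<notin> p"
    by blast
  then have w: "w \<in> J" "w \<in> carrier R" "nzd M (adjoin M K x) w" "nzd M (adjoin M K z) w" "nzd M K w"
    using P1(3) P2(3) P3(3) JR by auto
  obtain ys where ys: "length ys = n" "set ys \<subseteq> J" "weakly_regular M (adjoin M (adjoin M K x) w) ys"
    using Suc.IH[OF Kx, of "x' # xs'" w] Suc.prems w xs by auto
  have "weakly_regular M (adjoin M K w) (x # ys)"
    using ys(3) nzd_adjoin_swap[OF K x(2,3) w(2,3)] adjoin_commute[OF K x(2) w(2)] by simp
  then obtain ys' where ys': "length ys' = n" "set ys' \<subseteq> J"
    "weakly_regular M (adjoin M (adjoin M K w) z) ys'"
    using Suc.IH[OF submodule_adjoin[OF K w(2)], of "x # ys" z] ys x(1) z(1)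
      nzd_adjoin_swap[OF K z(2,3) w(2,4)] by auto
  have "weakly_regular M (adjoin M K z) (w # ys')"
    using ys'(3) w(4) adjoin_commute[OF K z(2) w(2)] by simp
  then show ?case
    using ys' w(1) by (intro exI[of _ "w # ys'"]) simp
qed

text \<open>Avoiding the primes of M/K and of N/L together gives a first element z good for both.
  The exchange lemma then leaves sequences of length n behind z on either side, and the induction
  continues in the two quotients.\<close>

lemma ex_common_weakly_regular:
  assumes M: "noetherian_module R M" "submodule K R M" and N: "noetherian_module R N" "submodule L R N"
    and J: "ideal J R"
    and "weakly_regular M K xs" "set xs \<subseteq> J" "length xs = n"
    and "weakly_regular N L ys" "set ys \<subseteq> J" "length ys = n"
  shows "\<exists>zs. length zs = n \<and> set zs \<subseteq> J \<and> weakly_regular M K zs \<and> weakly_regular N L zs"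
  using assms(2,4,6-)
proof (induction n arbitrary: K L xs ys)
  case 0
  show ?case
    by (intro exI[of _ "[]"]) simp
next
  case (Suc n)
  interpret M: module R M using M(1) by (simp add: noetherian_module_def)
  interpret N: module R N using N(1) by (simp add: noetherian_module_def)
  interpret J: ideal J R by fact
  have JR: "J \<subseteq> carrier R"
    using J.Icarr by blast
  obtain x xs' y ys' where xs: "xs = x # xs'" "ys = y # ys'"
    using Suc.prems(5,8) by (metis length_Suc_conv)
  have soc: "socle_free J M K" "socle_free J N L"
    using socle_free_if_nzd[of M K x] socle_free_if_nzd[of N L y] Suc.prems xs by auto
  obtain P1 where P1: "finite P1" "\<And>p. p \<in> P1 \<Longrightarrow> primeideal p R \<and> \<not> J \<subseteq> p"
    "\<And>w. w \<in> carrier R \<Longrightarrow> \<forall>p\<in>P1. w \<notin> p \<Longrightarrow> nzd M K w"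
    using finite_primes_covering_zero_divisors[OF M(1) Suc.prems(1) soc(1) JR] by blast
  obtain P2 where P2: "finite P2" "\<And>p. p \<in> P2 \<Longrightarrow> primeideal p R \<and> \<not> J \<subseteq> p"
    "\<And>w. w \<in> carrier R \<Longrightarrow> \<forall>p\<in>P2. w \<notin> p \<Longrightarrow> nzd N L w"
    using finite_primes_covering_zero_divisors[OF N(1) Suc.prems(2) soc(2) JR] by blast
  have "\<exists>z\<in>J. \<forall>p\<in>P1 \<union> P2. z \<notin> p"
    using P1(1,2) P2(1,2) by (intro prime_avoidance J) auto
  then obtain z where "z \<in> J" "\<forall>p\<in>P1 \<union> P2. z \<notin> p"
    by blast
  then have z: "z \<in> J" "z \<in> carrier R" "nzd M K z" "nzd N L z"
    using P1(3) P2(3) JR by auto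
  obtain us where us: "length us = n" "set us \<subseteq> J" "weakly_regular M (adjoin M K z) us"
    using weakly_regular_exchange[OF M(1) Suc.prems(1) J Suc.prems(3-5) z(1,3)] by blast
  obtain vs where vs: "length vs = n" "set vs \<subseteq> J" "weakly_regular N (adjoin N L z) vs"
    using weakly_regular_exchange[OF N(1) Suc.prems(2) J Suc.prems(6-8) z(1,4)] by blast
  obtain zs where "length zs = n" "set zs \<subseteq> J" "weakly_regular M (adjoin M K z) zs"
    "weakly_regular N (adjoin N L z) zs"
    using Suc.IH[OF M.submodule_adjoin[OF Suc.prems(1) z(2)] N.submodule_adjoin[OF Suc.prems(2) z(2)]
        us(3,2,1) vs(3,2,1)] by blast
  then show ?case
    using z by (intro exI[of _ "z # zs"]) simp
qed

end

section \<open>Depth\<close>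

context module
begin

text \<open>Connects adjoining elements one at a time with the span in the definition of regular
  sequences.\<close>

lemma adjoin_seq_zero_eq_seq_submod:
  assumes "set xs \<subseteq> carrier R"
  shows "adjoin_seq M {\<zero>\<^bsub>M\<^esub>} xs = seq_submod R M xs"
proof
  have *: "submodule (adjoin_seq M {\<zero>\<^bsub>M\<^esub>} ys) R M" if "set ys \<subseteq> carrier R" for ys
    by (rule submodule_adjoin_seq[OF submodule_zero that])
  have "x \<odot>\<^bsub>M\<^esub> m \<in> adjoin_seq M {\<zero>\<^bsub>M\<^esub>} xs" if "x \<in> set xs" "m \<in> carrier M" for x m
    using assms that(1)
  proof (induction xs rule: rev_induct)
    case (snoc y ys)
    show ?case
    proof (cases "x = y")
      case True
      then show ?thesis
        using smult_in_adjoin[OF *, of ys y m] snoc.prems that(2) by simp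
    next
      case False
      then show ?thesis
        using subset_adjoin[OF *, of ys y] snoc by auto
    qed
  qed simp
  then show "seq_submod R M xs \<subseteq> adjoin_seq M {\<zero>\<^bsub>M\<^esub>} xs"
    unfolding seq_submod_def using *[OF assms] by (intro span_minimal) auto
  let ?S = "{x \<odot>\<^bsub>M\<^esub> m |x m. x \<in> set xs \<and> m \<in> carrier M}"
  have L: "submodule (span_mod R M ?S) R M"
    using assms by (intro submodule_span) auto
  have "adjoin_seq M {\<zero>\<^bsub>M\<^esub>} ys \<subseteq> span_mod R M ?S" if "set ys \<subseteq> set xs" for ys
    using that
  proof (induction ys rule: rev_induct)
    case Nil
    then show ?case
      using submodule_closed(2)[OF L] by simp
  next
    case (snoc y ys)
    have "k \<oplus>\<^bsub>M\<^esub> y \<odot>\<^bsub>M\<^esub> w \<in> span_mod R M ?S"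
      if "k \<in> adjoin_seq M {\<zero>\<^bsub>M\<^esub>} ys" "w \<in> carrier M" for k w
      using that snoc span_superset[of ?S R M] by (intro submodule_closed(3)[OF L]) auto
    then show ?case
      by (auto elim: adjoinE)
  qed
  then show "adjoin_seq M {\<zero>\<^bsub>M\<^esub>} xs \<subseteq> seq_submod R M xs"
    unfolding seq_submod_def by blast
qed

lemma a_r_coset_subset_iff:
  assumes K: "submodule K R M" and w: "w \<in> carrier M"
  shows "K +>\<^bsub>M\<^esub> w \<subseteq> K \<longleftrightarrow> w \<in> K"
proof -
  have "(\<forall>k\<in>K. k \<oplus>\<^bsub>M\<^esub> w \<in> K) \<longleftrightarrow> w \<in> K"
    using submodule_mem_plus_iff[OF K _ w] submodule_closed(2)[OF K] by blast
  then show ?thesis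
    by (auto simp: a_r_coset_def')
qed

lemma a_r_coset_eq_iff:
  assumes K: "submodule K R M" and w: "w \<in> carrier M"
  shows "K +>\<^bsub>M\<^esub> w = K \<longleftrightarrow> w \<in> K"
proof -
  note KD = submodule_closed[OF K]
  have "v \<in> K +>\<^bsub>M\<^esub> w" if "v \<in> K" "w \<in> K" for v
  proof -
    have "v \<ominus>\<^bsub>M\<^esub> w \<in> K" "v = (v \<ominus>\<^bsub>M\<^esub> w) \<oplus>\<^bsub>M\<^esub> w"
      using that KD(1,4) minus_eq_iff_eq_plus[of v w "v \<ominus>\<^bsub>M\<^esub> w"] by auto
    then show ?thesis
      unfolding a_r_coset_def' by blast
  qed
  then show ?thesis
    using a_r_coset_subset_iff[OF assms] by blast
qed

text \<open>Scalar multiplication in \<open>quot_mod\<close> is a union over all representatives of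
  a coset. It equals the zero K of the quotient exactly when x times one representative,
  equivalently every one, lies in K.\<close>

lemma nonzerodivisor_on_quot_mod_iff:
  assumes K: "submodule K R M" and x: "x \<in> carrier R"
  shows "nonzerodivisor_on (quot_mod M K) x \<longleftrightarrow> nzd M K x"
proof -
  note KD = submodule_closed[OF K]
  have "(\<Union>y\<in>K +>\<^bsub>M\<^esub> w. K +>\<^bsub>M\<^esub> (x \<odot>\<^bsub>M\<^esub> y)) = K \<longleftrightarrow> x \<odot>\<^bsub>M\<^esub> w \<in> K" if w: "w \<in> carrier M" for w
  proof
    assume *: "(\<Union>y\<in>K +>\<^bsub>M\<^esub> w. K +>\<^bsub>M\<^esub> (x \<odot>\<^bsub>M\<^esub> y)) = K"
    have "\<zero>\<^bsub>M\<^esub> \<oplus>\<^bsub>M\<^esub> w \<in> K +>\<^bsub>M\<^esub> w"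
      unfolding a_r_coset_def' using KD(2) by blast
    then have "K +>\<^bsub>M\<^esub> (x \<odot>\<^bsub>M\<^esub> w) \<subseteq> K"
      using * w by auto
    then show "x \<odot>\<^bsub>M\<^esub> w \<in> K"
      using a_r_coset_subset_iff[OF K] x w by simp
  next
    assume *: "x \<odot>\<^bsub>M\<^esub> w \<in> K"
    have "K +>\<^bsub>M\<^esub> (x \<odot>\<^bsub>M\<^esub> y) = K" if y: "y \<in> K +>\<^bsub>M\<^esub> w" for y
    proof -
      obtain k where "k \<in> K" "y = k \<oplus>\<^bsub>M\<^esub> w"
        using y by (auto simp: a_r_coset_def')
      then have "x \<odot>\<^bsub>M\<^esub> y \<in> K" "y \<in> carrier M"
        using * KD(1,3,5) x w by (auto simp: smult_r_distr)
      then show ?thesis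
        using a_r_coset_eq_iff[OF K] KD(1) by blast
    qed
    moreover have "K +>\<^bsub>M\<^esub> w \<noteq> {}"
      using KD(2) by (auto simp: a_r_coset_def')
    ultimately show "(\<Union>y\<in>K +>\<^bsub>M\<^esub> w. K +>\<^bsub>M\<^esub> (x \<odot>\<^bsub>M\<^esub> y)) = K"
      by simp
  qed
  then show ?thesis
    using a_r_coset_eq_iff[OF K]
    by (auto simp: nonzerodivisor_on_def nzd_def quot_mod_def A_RCOSETS_def')
qed

lemma zero_module_quot_mod_iff:
  assumes K: "submodule K R M"
  shows "zero_module (quot_mod M K) \<longleftrightarrow> K = carrier M"
proof -
  have "zero_module (quot_mod M K) \<longleftrightarrow> (\<forall>w\<in>carrier M. K +>\<^bsub>M\<^esub> w = K)"
    using M.zero_closed by (auto simp: zero_module_def quot_mod_def A_RCOSETS_def')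
  then show ?thesis
    using a_r_coset_eq_iff[OF K] submodule_closed(1)[OF K] by blast
qed

lemma regular_seq_iff_weakly_regular:
  "regular_seq R M xs \<longleftrightarrow> set xs \<subseteq> carrier R \<and> weakly_regular M {\<zero>\<^bsub>M\<^esub>} xs \<and>
    adjoin_seq M {\<zero>\<^bsub>M\<^esub>} xs \<noteq> carrier M"
proof (cases "set xs \<subseteq> carrier R")
  case True
  note sub = submodule_adjoin_seq[OF submodule_zero]
  have "nonzerodivisor_on (quot_mod M (seq_submod R M (take i xs))) (xs ! i) \<longleftrightarrow>
      nzd M (adjoin_seq M {\<zero>\<^bsub>M\<^esub>} (take i xs)) (xs ! i)" if "i < length xs" for i
  proof -
    have "set (take i xs) \<subseteq> carrier R" "xs ! i \<in> carrier R"
      using True that by (auto dest: in_set_takeD)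
    then show ?thesis
      using nonzerodivisor_on_quot_mod_iff sub adjoin_seq_zero_eq_seq_submod by simp
  qed
  then show ?thesis
    using True zero_module_quot_mod_iff[OF sub[OF True]] adjoin_seq_zero_eq_seq_submod[OF True]
    by (simp add: regular_seq_def weakly_regular_iff_nth)
qed (simp add: regular_seq_def)

text \<open>This is the zero quotient, on which every element is a nonzerodivisor.\<close>

lemma weakly_regular_carrier:
  "set xs \<subseteq> carrier R \<Longrightarrow> weakly_regular M (carrier M) xs"
proof (induction xs)
  case (Cons x xs)
  then have x: "x \<in> carrier R"
    by simp
  have "adjoin M (carrier M) x = carrier M"
    using subset_adjoin[OF carrier_is_submodule x]
      submodule_closed(1)[OF submodule_adjoin[OF carrier_is_submodule x]] by blast
  then show ?case
    using Cons by (simp add: nzd_def)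
qed simp

end

text \<open>A supremum of lengths that is at least a finite t > 0 is reached by some sequence of
  length at least t, which is then truncated. A zero module has infinite depth by convention; there
  the list of t zeros does the job.\<close>

lemma (in module) ex_weakly_regular_if_le_depth:
  assumes "enat t \<le> depth R M" "\<zero> \<in> max_ideal R"
  obtains xs where "length xs = t" "set xs \<subseteq> max_ideal R" "weakly_regular M {\<zero>\<^bsub>M\<^esub>} xs"
proof (cases "zero_module M \<or> t = 0")
  case True
  have "weakly_regular M {\<zero>\<^bsub>M\<^esub>} (replicate t \<zero>)"
  proof (cases "t = 0")
    case False
    then have "carrier M = {\<zero>\<^bsub>M\<^esub>}"
      using True by (simp add: zero_module_def)
    then show ?thesis
      using weakly_regular_carrier[of "replicate t \<zero>"] by (auto simp: set_replicate_conv_if)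
  qed simp
  then show thesis
    using assms(2) by (intro that[of "replicate t \<zero>"]) auto
next
  case False
  let ?S = "{enat (length xs) |xs. set xs \<subseteq> max_ideal R \<and> regular_seq R M xs}"
  have "\<exists>e\<in>?S. enat t \<le> e"
  proof (rule ccontr)
    assume *: "\<not> (\<exists>e\<in>?S. enat t \<le> e)"
    have "length xs < t" if "set xs \<subseteq> max_ideal R" "regular_seq R M xs" for xs
    proof -
      have "enat (length xs) \<in> ?S"
        using that by blast
      then have "\<not> enat t \<le> enat (length xs)"
        using * by blast
      then show ?thesis
        by simp
    qed
    then have "Sup ?S \<le> enat (t - 1)"
      by (intro Sup_least) fastforce
    moreover have "enat t \<le> Sup ?S"
      using assms(1) False by (simp add: depth_def)
    ultimately have "enat t \<le> enat (t - 1)"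
      by (rule order_trans[rotated])
    then show False
      using False by (cases t) simp_all
  qed
  then obtain xs where xs: "set xs \<subseteq> max_ideal R" "regular_seq R M xs" "t \<le> length xs"
    by auto
  then have "weakly_regular M {\<zero>\<^bsub>M\<^esub>} (take t xs @ drop t xs)"
    by (simp add: regular_seq_iff_weakly_regular)
  then show thesis
    unfolding weakly_regular_append using xs
    by (intro that[of "take t xs"]) (auto dest: in_set_takeD)
qed

sublocale noetherian_local_ring \<subseteq> noetherian_cring ..

context noetherian_local_ring
begin

lemma maximalideal_max_ideal: "maximalideal (max_ideal R) R"
  unfolding max_ideal_def using local by (rule theI')

lemma ideal_max_ideal: "ideal (max_ideal R) R"
  using maximalideal_max_ideal by (simp add: maximalideal_def)

lemma one_notin_max_ideal: "\<one> \<notin> max_ideal R"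
  using maximalideal.I_notcarr[OF maximalideal_max_ideal] ideal.one_imp_carrier[OF ideal_max_ideal]
  by blast

lemma max_ideal_subset: "max_ideal R \<subseteq> carrier R"
  using ideal.Icarr[OF ideal_max_ideal] by blast

text \<open>A nonunit generates a proper ideal. A largest proper ideal above it is maximal, hence
  the only maximal ideal.\<close>

lemma Units_if_notin_max_ideal:
  assumes a: "a \<in> carrier R" "a \<notin> max_ideal R"
  shows "a \<in> Units R"
proof -
  let ?A = "{I. ideal I R \<and> I \<noteq> carrier R}"
  interpret P: ideal "PIdl a" R by (rule cgenideal_ideal[OF a(1)])
  have "PIdl a = carrier R"
  proof (rule ccontr)
    assume "PIdl a \<noteq> carrier R"
    then have "PIdl a \<in> ?A"
      using P.ideal_axioms by simp
    then have "\<exists>m\<in>?A. PIdl a \<subseteq> m \<and> (\<forall>q\<in>?A. m \<subseteq> q \<longrightarrow> q = m)"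
      by (rule ex_maximal_ideal_in_family) simp
    then obtain m where m: "m \<in> ?A" "PIdl a \<subseteq> m" "\<forall>q\<in>?A. m \<subseteq> q \<longrightarrow> q = m"
      by (elim bexE conjE)
    have "maximalideal m R"
    proof (rule maximalidealI)
      show "ideal m R" "carrier R \<noteq> m"
        using m(1) by auto
      show "I = m \<or> I = carrier R" if "ideal I R" "m \<subseteq> I" for I
        using m(3) that by blast
    qed
    then have "m = max_ideal R"
      unfolding max_ideal_def by (rule the1_equality[OF local, symmetric])
    then show False
      using a m(2) cgenideal_self[OF a(1)] by blast
  qed
  then have "\<one> \<in> PIdl a"
    by simp
  then obtain b where b: "b \<in> carrier R" "\<one> = b \<otimes> a"
    unfolding cgenideal_def by blast
  then have "b \<otimes> a = \<one>" "a \<otimes> b = \<one>"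
    using a(1) by (simp_all add: m_comm)
  then show ?thesis
    using a(1) b(1) unfolding Units_def by blast
qed

lemma adjoin_seq_subset_max_ideal:
  assumes "set xs \<subseteq> max_ideal R"
  shows "adjoin_seq (regular_module R) {\<zero>} xs \<subseteq> max_ideal R"
proof -
  interpret m: ideal "max_ideal R" R by (rule ideal_max_ideal)
  interpret RM: module R "regular_module R" by (rule module_regular)
  show ?thesis
    using assms
  proof (induction xs rule: rev_induct)
    case (snoc x xs)
    have "k \<oplus> x \<otimes> w \<in> max_ideal R"
      if "k \<in> adjoin_seq (regular_module R) {\<zero>} xs" "w \<in> carrier R" for k w
      using snoc that m.I_r_closed[of x w] by auto
    then show ?case
      by (auto elim!: RM.adjoinE)
  qed (simp add: m.zero_closed)
qed

text \<open>The ideal generated by elements of the maximal ideal is proper, so here weakly regular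
  sequences are regular and count towards the depth.\<close>

lemma length_le_if_weakly_regular:
  assumes "ring_depth R = enat t" "set xs \<subseteq> max_ideal R"
    and "weakly_regular (regular_module R) {\<zero>} xs"
  shows "length xs \<le> t"
proof -
  interpret RM: module R "regular_module R" by (rule module_regular)
  have "adjoin_seq (regular_module R) {\<zero>} xs \<noteq> carrier (regular_module R)"
    using adjoin_seq_subset_max_ideal[OF assms(2)] one_notin_max_ideal by auto
  then have "regular_seq R (regular_module R) xs"
    using assms(2,3) max_ideal_subset by (auto simp: RM.regular_seq_iff_weakly_regular)
  then have "enat (length xs) \<le> depth R (regular_module R)"
    using assms(2) by (auto simp: depth_def intro: Sup_upper)
  then show ?thesis
    using assms(1) by (simp add: ring_depth_def)
qed

text \<open>If R/(xs) had zero socle, prime avoidance would find one more nonzerodivisor z in the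
  maximal ideal, and xs followed by z would be longer than the depth permits.\<close>

lemma ex_socle_element:
  assumes depth: "ring_depth R = enat t" and xs: "set xs \<subseteq> max_ideal R" "length xs = t"
    and reg: "weakly_regular (regular_module R) {\<zero>} xs"
  obtains s where "s \<in> carrier R" "s \<notin> adjoin_seq (regular_module R) {\<zero>} xs"
    "\<And>a. a \<in> max_ideal R \<Longrightarrow> a \<otimes> s \<in> adjoin_seq (regular_module R) {\<zero>} xs"
proof -
  interpret RM: module R "regular_module R" by (rule module_regular)
  let ?I = "adjoin_seq (regular_module R) {\<zero>} xs"
  have sub: "submodule ?I R (regular_module R)"
    using RM.submodule_adjoin_seq[OF RM.submodule_zero, of xs] xs(1) max_ideal_subset by auto
  have "\<not> socle_free (max_ideal R) (regular_module R) ?I"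
  proof
    assume soc: "socle_free (max_ideal R) (regular_module R) ?I"
    obtain P where P: "finite P" "\<And>p. p \<in> P \<Longrightarrow> primeideal p R \<and> \<not> max_ideal R \<subseteq> p"
      "\<And>z. z \<in> carrier R \<Longrightarrow> \<forall>p\<in>P. z \<notin> p \<Longrightarrow> nzd (regular_module R) ?I z"
      using finite_primes_covering_zero_divisors[OF noetherian_module_regular sub soc max_ideal_subset]
      by blast
    obtain z where z: "z \<in> max_ideal R" "\<forall>p\<in>P. z \<notin> p"
      using prime_avoidance[OF ideal_max_ideal P(1,2)] by blast
    have "nzd (regular_module R) ?I z"
      using P(3)[of z] z max_ideal_subset by blast
    then have "weakly_regular (regular_module R) {\<zero>} (xs @ [z])"
      using reg by (simp add: weakly_regular_append)
    then have "length (xs @ [z]) \<le> t"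
      using z xs(1) by (intro length_le_if_weakly_regular[OF depth]) auto
    then show False
      using xs(2) by simp
  qed
  then show thesis
    using that by (auto simp: socle_free_def)
qed

end

section \<open>Free resolutions and Ext\<close>

lemma module_homI: "module R M \<Longrightarrow> module R N \<Longrightarrow> linear_map R M N f \<Longrightarrow> module_hom R M N f"
  by (simp add: module_hom_def module_hom_axioms_def)

lemma (in module_hom) linear_map_minus_smult:
  assumes "linear_map R M N g" "z \<in> carrier R"
  shows "linear_map R M N (\<lambda>u. f u \<ominus>\<^bsub>N\<^esub> z \<odot>\<^bsub>N\<^esub> g u)"
proof -
  note g = linear_mapD[OF assms(1)]
  have "f (x \<oplus>\<^bsub>M\<^esub> y) \<ominus>\<^bsub>N\<^esub> z \<odot>\<^bsub>N\<^esub> g (x \<oplus>\<^bsub>M\<^esub> y) =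
      (f x \<ominus>\<^bsub>N\<^esub> z \<odot>\<^bsub>N\<^esub> g x) \<oplus>\<^bsub>N\<^esub> (f y \<ominus>\<^bsub>N\<^esub> z \<odot>\<^bsub>N\<^esub> g y)" if "x \<in> carrier M" "y \<in> carrier M" for x y
    using that assms(2)
    by (simp add: f_simps g N.smult_r_distr a_minus_def N.M.minus_add N.M.a_ac)
  moreover have "f (a \<odot>\<^bsub>M\<^esub> x) \<ominus>\<^bsub>N\<^esub> z \<odot>\<^bsub>N\<^esub> g (a \<odot>\<^bsub>M\<^esub> x) = a \<odot>\<^bsub>N\<^esub> (f x \<ominus>\<^bsub>N\<^esub> z \<odot>\<^bsub>N\<^esub> g x)"
    if "a \<in> carrier R" "x \<in> carrier M" for a x
  proof -
    have "z \<odot>\<^bsub>N\<^esub> (a \<odot>\<^bsub>N\<^esub> g x) = a \<odot>\<^bsub>N\<^esub> (z \<odot>\<^bsub>N\<^esub> g x)"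
      using that assms(2) g by (simp add: N.smult_assoc1[symmetric] M.R.m_comm)
    then show ?thesis
      using that assms(2) by (simp add: f_simps g N.smult_minus_right)
  qed
  ultimately show ?thesis
    using assms(2) by (auto simp: linear_map_def f_simps g)
qed

text \<open>Choose preimages arbitrarily; the kernel condition makes the value of g independent of
  the choice.\<close>

lemma (in module_hom) ex_factorization:
  assumes surj: "f ` carrier M = carrier N" and P: "module R P" and g: "linear_map R M P g"
    and ker: "\<And>u. u \<in> carrier M \<Longrightarrow> f u = \<zero>\<^bsub>N\<^esub> \<Longrightarrow> g u = \<zero>\<^bsub>P\<^esub>"
  shows "\<exists>h\<in>mod_hom R N P. \<forall>u\<in>carrier M. h (f u) = g u"
proof -
  interpret g: module_hom R M P g
    by (rule module_homI[OF M.module_axioms P g])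
  define h where "h = (\<lambda>m. g (inv_into (carrier M) f m))"
  have h: "h (f u) = g u" if u: "u \<in> carrier M" for u
  proof -
    let ?v = "inv_into (carrier M) f (f u)"
    have v: "?v \<in> carrier M" "f ?v = f u"
      using u by (auto intro: inv_into_into f_inv_into_f)
    then have "g (?v \<ominus>\<^bsub>M\<^esub> u) = \<zero>\<^bsub>P\<^esub>"
      using u by (intro ker f_minus_eq_zero) auto
    then show ?thesis
      using u v(1) by (simp add: h_def g.f_minus g.N.minus_eq_iff_eq_plus g.f_simps(1))
  qed
  have "linear_map R N P h"
    unfolding linear_map_def surj[symmetric]
    by (auto simp: h g.f_simps(1) g.f_simps(2,3)[symmetric] f_simps(2,3)[symmetric])
  then show ?thesis
    using restrict_in_mod_hom[OF N.module_axioms] h f_simps(1)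
    by (intro bexI[of _ "restrict h (carrier N)"]) auto
qed

context cring
begin

lemma ex_free_cover:
  assumes M: "module R M" and K: "submodule K R M" and S: "finite S" "S \<subseteq> K" "span_mod R M S = K"
  shows "\<exists>n. \<exists>g\<in>mod_hom R (free_mod R n) M. g ` carrier (free_mod R n) = K"
proof -
  interpret M: module R M by fact
  obtain w and n :: nat where w: "S = w ` {i. i < n}"
    using S(1) finite_imp_nat_seg_image_inj_on by metis
  have wK: "w i \<in> K" if "i < n" for i
    using that w S(2) by blast
  then obtain g where g: "g \<in> mod_hom R (free_mod R n) M" "\<And>i. i < n \<Longrightarrow> g (basis_vec R n i) = w i"
    using ex_linear_map_free_mod[OF M, of n w] M.submodule_closed(1)[OF K wK] by metis
  interpret g: module_hom R "free_mod R n" M g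
    by (intro module_homI module_free_mod M linear_map_if_mod_hom g(1))
  have "g u \<in> K" if "u \<in> carrier (free_mod R n)" for u
    using linear_map_free_mod_in[OF M g.lin K _ that] g(2) wK by simp
  moreover have "S \<subseteq> g ` carrier (free_mod R n)"
  proof
    fix x assume "x \<in> S"
    then obtain i where "i < n" "x = w i"
      using w by blast
    then show "x \<in> g ` carrier (free_mod R n)"
      using g(2)[of i] basis_vec_closed[of n i] by (intro image_eqI[of _ _ "basis_vec R n i"]) simp_all
  qed
  then have "K \<subseteq> g ` carrier (free_mod R n)"
    using span_minimal[OF _ g.submodule_image[OF g.M.carrier_is_submodule]] S(3) by blast
  ultimately show ?thesis
    using g(1) by blast
qed

text \<open>Divide by z modulo K on the basis vectors and extend linearly. The difference h - z c
  then sends the basis, hence everything, into K.\<close>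

lemma ex_free_lift_mod_adjoin:
  assumes N: "module R N" and K: "submodule K R N" and z: "z \<in> carrier R"
    and h: "linear_map R (free_mod R n) N h"
    and mem: "\<And>u. u \<in> carrier (free_mod R n) \<Longrightarrow> h u \<in> adjoin N K z"
  shows "\<exists>c\<in>mod_hom R (free_mod R n) N. \<forall>u\<in>carrier (free_mod R n). h u \<ominus>\<^bsub>N\<^esub> z \<odot>\<^bsub>N\<^esub> c u \<in> K"
proof -
  interpret h: module_hom R "free_mod R n" N h
    by (intro module_homI module_free_mod N h)
  have "\<forall>i. \<exists>w\<in>carrier N. h (basis_vec R n i) \<ominus>\<^bsub>N\<^esub> z \<odot>\<^bsub>N\<^esub> w \<in> K"
    using h.N.mem_adjoin_iff[OF K z] mem basis_vec_closed h.f_simps(1) by blast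
  then obtain w where w: "\<And>i. w i \<in> carrier N" "\<And>i. h (basis_vec R n i) \<ominus>\<^bsub>N\<^esub> z \<odot>\<^bsub>N\<^esub> w i \<in> K"
    by metis
  obtain c where c: "c \<in> mod_hom R (free_mod R n) N" "\<And>i. i < n \<Longrightarrow> c (basis_vec R n i) = w i"
    using ex_linear_map_free_mod[OF N, of n w] w(1) by blast
  have "h u \<ominus>\<^bsub>N\<^esub> z \<odot>\<^bsub>N\<^esub> c u \<in> K" if "u \<in> carrier (free_mod R n)" for u
    using linear_map_free_mod_in[OF N h.linear_map_minus_smult[OF linear_map_if_mod_hom[OF c(1)] z] K _ that]
      w(2) c(2) by simp
  then show ?thesis
    using c(1) by blast
qed

end

lemma (in module_hom) submodule_kernel: "submodule (a_kernel M N f) R M"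
proof -
  have "a_kernel M N f = {x \<in> carrier M. f x = \<zero>\<^bsub>N\<^esub>}"
    by (simp add: a_kernel_def')
  then show ?thesis
    using submodule_Int_kernel[OF M.carrier_is_submodule] by simp
qed

context noetherian_cring
begin

lemma ex_free_cover_kernel:
  assumes "module R M" "f \<in> mod_hom R (free_mod R n) M"
  shows "\<exists>m. \<exists>g\<in>mod_hom R (free_mod R m) (free_mod R n).
    g ` carrier (free_mod R m) = a_kernel (free_mod R n) M f"
proof -
  interpret f: module_hom R "free_mod R n" M f
    by (intro module_homI module_free_mod assms linear_map_if_mod_hom)
  obtain S where "finite S" "S \<subseteq> a_kernel (free_mod R n) M f"
    "span_mod R (free_mod R n) S = a_kernel (free_mod R n) M f"
    using conjunct2[OF noetherian_module_free_mod[of n, unfolded noetherian_module_def],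
        THEN spec, THEN mp, OF f.submodule_kernel] by (elim exE conjE)
  then show ?thesis
    by (rule ex_free_cover[OF module_free_mod f.submodule_kernel])
qed

lemma ex_free_resolution:
  assumes "fin_gen R M"
  shows "\<exists>b d e. free_resolution R M b d e"
proof -
  interpret M: module R M using assms by (simp add: fin_gen_def)
  obtain S where "finite S" "S \<subseteq> carrier M" "span_mod R M S = carrier M"
    using assms unfolding fin_gen_def by (elim exE conjE)
  then have "\<exists>n. \<exists>e\<in>mod_hom R (free_mod R n) M. e ` carrier (free_mod R n) = carrier M"
    by (rule ex_free_cover[OF M.module_axioms M.carrier_is_submodule])
  then obtain n e where e: "e \<in> mod_hom R (free_mod R n) M" "e ` carrier (free_mod R n) = carrier M"
    by (elim exE bexE)
  \<comment> \<open>Dependent choice runs over triples (a, b, d) that stand for a map d from R^b to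
    R^a. \<open>?P\<close> pins the first map to the kernel of the augmentation, and
    \<open>?Q\<close> states that consecutive maps match in rank and are exact.\<close>
  let ?P = "\<lambda>i (a, b, d). d \<in> mod_hom R (free_mod R b) (free_mod R a) \<and>
    (i = (0::nat) \<longrightarrow> a = n \<and> d ` carrier (free_mod R b) = a_kernel (free_mod R n) M e)"
  let ?Q = "\<lambda>(i::nat) (a, b, d) (a', b', d'). a' = b \<and>
    d' ` carrier (free_mod R b') = a_kernel (free_mod R b) (free_mod R a) d"
  have "\<exists>s. \<forall>i. ?P i (s i) \<and> ?Q i (s i) (s (Suc i))"
  proof (rule dependent_nat_choice)
    obtain b d where "d \<in> mod_hom R (free_mod R b) (free_mod R n)"
      "d ` carrier (free_mod R b) = a_kernel (free_mod R n) M e"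
      using ex_free_cover_kernel[OF M.module_axioms e(1)] by (elim exE bexE)
    then have "?P 0 (n, b, d)"
      by (simp only: prod.case simp_thms)
    then show "\<exists>x. ?P 0 x"
      by (rule exI)
    show "\<exists>y. ?P (Suc i) y \<and> ?Q i x y" if "?P i x" for x i
    proof -
      obtain a b d where x: "x = (a, b, d)"
        by (cases x)
      then have d: "d \<in> mod_hom R (free_mod R b) (free_mod R a)"
        using that by (simp only: prod.case)
      obtain b' d' where "d' \<in> mod_hom R (free_mod R b') (free_mod R b)"
        "d' ` carrier (free_mod R b') = a_kernel (free_mod R b) (free_mod R a) d"
        using ex_free_cover_kernel[OF module_free_mod d] by (elim exE bexE)
      then have "?P (Suc i) (b, b', d') \<and> ?Q i x (b, b', d')"
        unfolding x by (simp only: prod.case) blast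
      then show ?thesis
        by (rule exI)
    qed
  qed
  then obtain s where s': "\<forall>i. ?P i (s i) \<and> ?Q i (s i) (s (Suc i))"
    by (rule exE)
  have s: "?P i (s i)" "?Q i (s i) (s (Suc i))" for i
    by (rule conjunct1[OF spec[OF s']], rule conjunct2[OF spec[OF s']])
  define b where "b i = fst (s i)" for i
  define d where "d i = snd (snd (s i))" for i
  have "fst (snd (s i)) = b (Suc i)" for i
    using s(2)[of i] by (simp add: b_def case_prod_beta)
  then have si: "s i = (b i, b (Suc i), d i)" for i
    by (simp add: b_def d_def prod_eq_iff)
  note s = s[unfolded si prod.case]
  have "b 0 = n" "d 0 ` carrier (free_mod R (b 1)) = a_kernel (free_mod R (b 0)) M e"
    using s(1)[of 0] by simp_all
  moreover have "d i \<in> mod_hom R (free_mod R (b (Suc i))) (free_mod R (b i))" for i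
    using s(1)[of i] by blast
  moreover have "d (Suc i) ` carrier (free_mod R (b (Suc (Suc i)))) =
      a_kernel (free_mod R (b (Suc i))) (free_mod R (b i)) (d i)" for i
    using s(2)[of i] by blast
  ultimately have "free_resolution R M b d e"
    using e by (simp add: free_resolution_def del: free_mod_simps)
  then show ?thesis
    by blast
qed

text \<open>The choice in \<open>Ext\<close> fixes only \<open>b\<close> and \<open>d\<close>; an
  augmentation \<open>e\<close> is recovered from its defining property. The choice depends neither
  on the degree nor on \<open>N\<close>, so one resolution serves all degrees.\<close>

lemma Ext_eq_hom_cohomology:
  assumes "fin_gen R M"
  obtains b d e where "free_resolution R M b d e" "\<And>i. Ext R i M N = hom_cohomology R b d N i"
proof -
  define p where "p = (SOME (b, d). \<exists>e. free_resolution R M b d e)"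
  obtain b d where bd: "p = (b, d)"
    by (cases p)
  have "\<exists>p. case p of (b, d) \<Rightarrow> \<exists>e. free_resolution R M b d e"
    using ex_free_resolution[OF assms] by auto
  then have "case p of (b, d) \<Rightarrow> \<exists>e. free_resolution R M b d e"
    unfolding p_def by (rule someI_ex)
  then obtain e where "free_resolution R M b d e"
    using bd by auto
  moreover have "Ext R i M N = hom_cohomology R b d N i" for i
    using bd by (simp add: Ext_def p_def[symmetric])
  ultimately show thesis
    by (rule that)
qed

end

text \<open>In a zero quotient the coset of f is the set of coboundaries itself. The zero map is a
  coboundary, so f = 0 + f belongs to that coset.\<close>

lemma (in module) hom_cocycles_subset_if_cohomology_zero:
  assumes "zero_module (hom_cohomology R b d M (Suc i))"
    and d: "d i \<in> mod_hom R (free_mod R (b (Suc i))) (free_mod R (b i))"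
  shows "hom_cocycles R b d M (Suc i) \<subseteq> hom_coboundaries R b d M (Suc i)"
proof
  let ?H = "Hom_mod R (free_mod R (b (Suc i))) M \<lparr>carrier := hom_cocycles R b d M (Suc i)\<rparr>"
  let ?B = "hom_coboundaries R b d M (Suc i)"
  fix f assume f: "f \<in> hom_cocycles R b d M (Suc i)"
  have "?B +>\<^bsub>?H\<^esub> f = ?B"
    using assms f unfolding hom_cohomology_def zero_module_def quot_mod_def A_RCOSETS_def'
    by auto
  moreover have "(\<lambda>u\<in>carrier (free_mod R (b (Suc i))). \<zero>\<^bsub>M\<^esub>) \<in> ?B"
  proof -
    have "linear_map R (free_mod R (b i)) M (\<lambda>u. \<zero>\<^bsub>M\<^esub>)"
      by (auto simp: linear_map_def)
    then have "(\<lambda>u\<in>carrier (free_mod R (b i)). \<zero>\<^bsub>M\<^esub>) \<in> mod_hom R (free_mod R (b i)) M"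
      by (rule restrict_in_mod_hom[OF R.module_free_mod])
    moreover have "d i u \<in> carrier (free_mod R (b i))" if "u \<in> carrier (free_mod R (b (Suc i)))" for u
      using linear_mapD(1)[OF linear_map_if_mod_hom[OF d] that] .
    ultimately show ?thesis
      unfolding hom_coboundaries.simps
      by (intro image_eqI[of _ _ "\<lambda>u\<in>carrier (free_mod R (b i)). \<zero>\<^bsub>M\<^esub>"] restrict_ext) simp_all
  qed
  ultimately have "(\<lambda>u\<in>carrier (free_mod R (b (Suc i))). \<zero>\<^bsub>M\<^esub>) \<oplus>\<^bsub>?H\<^esub> f \<in> ?B"
    unfolding a_r_coset_def' by blast
  moreover have "(\<lambda>u\<in>carrier (free_mod R (b (Suc i))). \<zero>\<^bsub>M\<^esub>) \<oplus>\<^bsub>?H\<^esub> f = f"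
    using f by (intro ext) (auto simp: Hom_mod_def hom_cocycles_def mod_hom_iff_linear_map linear_map_def Pi_iff extensional_def)
  ultimately show "f \<in> ?B"
    by simp
qed

section \<open>Exactness modulo a regular sequence\<close>

text \<open>The vanishing of Ext enters as an inclusion of cocycles in coboundaries, so that the
  diagram chases below involve cochains only.\<close>

locale exact_hom_complex = M: module R M + N: module R N
  for R (structure) and M :: "('a, 'b, 'c) module_scheme" and N :: "('a, 'd, 'e) module_scheme" +
  fixes b d e t
  assumes res: "free_resolution R M b d e"
    and exact: "\<And>i. 1 \<le> i \<Longrightarrow> i < t \<Longrightarrow> hom_cocycles R b d N i \<subseteq> hom_coboundaries R b d N i"
begin

abbreviation F where "F i \<equiv> free_mod R (b i)"

lemma module_F: "module R (F i)"
  by (rule M.R.module_free_mod)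

lemma d_hom: "d i \<in> mod_hom R (F (Suc i)) (F i)"
  using res by (simp add: free_resolution_def del: free_mod_simps)

lemma e_hom: "e \<in> mod_hom R (F 0) M"
  using res by (simp add: free_resolution_def del: free_mod_simps)

sublocale d: module_hom R "F (Suc i)" "F i" "d i" for i
  by (intro module_homI module_F linear_map_if_mod_hom d_hom)

sublocale e: module_hom R "F 0" M e
  by (intro module_homI module_F M.module_axioms linear_map_if_mod_hom e_hom)

lemma d_d: "u \<in> carrier (F (Suc (Suc i))) \<Longrightarrow> d i (d (Suc i) u) = \<zero>\<^bsub>F i\<^esub>"
proof -
  assume "u \<in> carrier (F (Suc (Suc i)))"
  then have "d (Suc i) u \<in> a_kernel (F (Suc i)) (F i) (d i)"
    using res unfolding free_resolution_def by blast
  then show ?thesis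
    by (simp add: a_kernel_def' del: free_mod_simps)
qed

lemma e_surj: "e ` carrier (F 0) = carrier M"
  using res unfolding free_resolution_def by blast

lemma kernel_e: "d 0 ` carrier (F 1) = a_kernel (F 0) M e"
  using res unfolding free_resolution_def by blast

text \<open>
  Exactness of \<open>Hom\<^sub>R(R\<^bsup>b \<bullet>\<^esup>, N)\<close> in degrees \<open>1, \<dots>, t - 1\<close> survives reduction modulo a regular
  sequence on \<open>N\<close>, one degree less for each element.
\<close>

lemma lift_cocycle:
  assumes "set zs \<subseteq> carrier R" "weakly_regular N {\<zero>\<^bsub>N\<^esub>} zs" "j + length zs < t"
    and "f \<in> mod_hom R (F j) N"
    and "\<And>u. u \<in> carrier (F (Suc j)) \<Longrightarrow> f (d j u) \<in> adjoin_seq N {\<zero>\<^bsub>N\<^esub>} zs"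
  shows "\<exists>g\<in>hom_cocycles R b d N j. \<forall>u\<in>carrier (F j). f u \<ominus>\<^bsub>N\<^esub> g u \<in> adjoin_seq N {\<zero>\<^bsub>N\<^esub>} zs"
  using assms
proof (induction zs arbitrary: j f rule: rev_induct)
  case Nil
  have "f \<in> hom_cocycles R b d N j"
    using Nil by (simp add: hom_cocycles_def del: free_mod_simps)
  moreover have "f u \<ominus>\<^bsub>N\<^esub> f u = \<zero>\<^bsub>N\<^esub>" if "u \<in> carrier (F j)" for u
    using linear_mapD(1)[OF linear_map_if_mod_hom[OF Nil(4)] that] by (simp add: a_minus_def N.M.r_neg)
  ultimately show ?case
    by (intro bexI[of _ f]) (simp_all del: free_mod_simps)
next
  case (snoc z zs)
  let ?K = "adjoin_seq N {\<zero>\<^bsub>N\<^esub>} zs"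
  have zs: "set zs \<subseteq> carrier R" "weakly_regular N {\<zero>\<^bsub>N\<^esub>} zs" and z: "z \<in> carrier R" "nzd N ?K z"
    using snoc.prems(1,2) by (auto simp: weakly_regular_append)
  have K: "submodule ?K R N"
    by (rule N.submodule_adjoin_seq[OF N.submodule_zero zs(1)])
  note KD = N.submodule_closed[OF K]
  interpret f: module_hom R "F j" N f
    by (intro module_homI module_F N.module_axioms linear_map_if_mod_hom snoc.prems(4))
  have "linear_map R (F (Suc j)) N (\<lambda>u. f (d j u))"
    by (rule linear_map_comp[OF d.lin f.lin])
  moreover have "f (d j u) \<in> adjoin N ?K z" if "u \<in> carrier (F (Suc j))" for u
    using snoc.prems(5)[OF that] by simp
  \<comment> \<open>This is the connecting homomorphism by hand: f d = z c modulo \<open>?K\<close>.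
    Composing with the next differential kills f d, and cancelling z shows that c is a cocycle
    modulo \<open>?K\<close>, one degree higher.\<close>
  ultimately have "\<exists>c\<in>mod_hom R (F (Suc j)) N.
      \<forall>u\<in>carrier (F (Suc j)). f (d j u) \<ominus>\<^bsub>N\<^esub> z \<odot>\<^bsub>N\<^esub> c u \<in> ?K"
    by (rule M.R.ex_free_lift_mod_adjoin[OF N.module_axioms K z(1)])
  then obtain c where c: "c \<in> mod_hom R (F (Suc j)) N"
    "\<forall>u\<in>carrier (F (Suc j)). f (d j u) \<ominus>\<^bsub>N\<^esub> z \<odot>\<^bsub>N\<^esub> c u \<in> ?K"
    by (elim bexE)
  note c = c(1) bspec[OF c(2)]
  interpret c: module_hom R "F (Suc j)" N c
    by (intro module_homI module_F N.module_axioms linear_map_if_mod_hom c(1))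
  have "c (d (Suc j) v) \<in> ?K" if v: "v \<in> carrier (F (Suc (Suc j)))" for v
  proof -
    note dv = d.f_simps(1)[OF v]
    have "\<ominus>\<^bsub>N\<^esub> (z \<odot>\<^bsub>N\<^esub> c (d (Suc j) v)) \<in> ?K"
      using c(2)[OF dv] d_d[OF v] f.f_zero c.f_simps(1)[OF dv] z(1)
      by (simp add: a_minus_def del: free_mod_simps)
    from KD(6)[OF this] have "z \<odot>\<^bsub>N\<^esub> c (d (Suc j) v) \<in> ?K"
      using c.f_simps(1)[OF dv] z(1) by simp
    then show ?thesis
      using z(2) c.f_simps(1)[OF dv] by (simp add: nzd_def)
  qed
  moreover have "Suc j + length zs < t"
    using snoc.prems(3) by simp
  \<comment> \<open>One sequence element fewer pays for one degree more, so the bound on their sum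
    is kept. It also places degree \<open>Suc j\<close> within the range of exactness used
    next.\<close>
  ultimately have "\<exists>g\<in>hom_cocycles R b d N (Suc j). \<forall>u\<in>carrier (F (Suc j)). c u \<ominus>\<^bsub>N\<^esub> g u \<in> ?K"
    by (intro snoc.IH[OF zs _ c(1)])
  then obtain g where g: "g \<in> hom_cocycles R b d N (Suc j)"
    "\<forall>u\<in>carrier (F (Suc j)). c u \<ominus>\<^bsub>N\<^esub> g u \<in> ?K"
    by (elim bexE)
  note g = g(1) bspec[OF g(2)]
  have "g \<in> hom_coboundaries R b d N (Suc j)"
    using exact[of "Suc j"] g(1) snoc.prems(3) by auto
  then obtain g' where g': "g' \<in> mod_hom R (F j) N" "g = (\<lambda>u\<in>carrier (F (Suc j)). g' (d j u))"
    by auto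
  interpret g': module_hom R "F j" N g'
    by (intro module_homI module_F N.module_axioms linear_map_if_mod_hom g'(1))
  \<comment> \<open>Since g = g' d, the identity f d - z g' d = (f d - z c) + z (c - g) makes f' a
    cocycle modulo \<open>?K\<close>. A second use of the induction hypothesis, now in degree j,
    lifts it to a true cocycle h, and f - h = (f' - h) + z g'.\<close>
  define f' where "f' = (\<lambda>u\<in>carrier (F j). f u \<ominus>\<^bsub>N\<^esub> z \<odot>\<^bsub>N\<^esub> g' u)"
  have f': "f' \<in> mod_hom R (F j) N"
    unfolding f'_def by (intro restrict_in_mod_hom module_F f.linear_map_minus_smult g'.lin z(1))
  have "f' (d j u) \<in> ?K" if u: "u \<in> carrier (F (Suc j))" for u
  proof -
    note du = d.f_simps(1)[OF u]
    note cl = f.f_simps(1)[OF du] g'.f_simps(1)[OF du] c.f_simps(1)[OF u]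
    have "(f (d j u) \<ominus>\<^bsub>N\<^esub> z \<odot>\<^bsub>N\<^esub> c u) \<oplus>\<^bsub>N\<^esub> z \<odot>\<^bsub>N\<^esub> (c u \<ominus>\<^bsub>N\<^esub> g' (d j u)) \<in> ?K"
      using c(2)[OF u] g(2)[OF u] u g'(2) KD(3,5) z(1) by (simp del: free_mod_simps)
    also have "(f (d j u) \<ominus>\<^bsub>N\<^esub> z \<odot>\<^bsub>N\<^esub> c u) \<oplus>\<^bsub>N\<^esub> z \<odot>\<^bsub>N\<^esub> (c u \<ominus>\<^bsub>N\<^esub> g' (d j u)) = f' (d j u)"
      using cl z(1) du by (simp add: f'_def a_minus_def N.smult_r_distr N.smult_r_minus N.M.a_assoc
          N.M.r_neg1 del: free_mod_simps)
    finally show ?thesis .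
  qed
  moreover have "j + length zs < t"
    using snoc.prems(3) by simp
  ultimately have "\<exists>h\<in>hom_cocycles R b d N j. \<forall>u\<in>carrier (F j). f' u \<ominus>\<^bsub>N\<^esub> h u \<in> ?K"
    by (intro snoc.IH[OF zs _ f'])
  then obtain h where h: "h \<in> hom_cocycles R b d N j" "\<forall>u\<in>carrier (F j). f' u \<ominus>\<^bsub>N\<^esub> h u \<in> ?K"
    by (elim bexE)
  note h = h(1) bspec[OF h(2)]
  have "f u \<ominus>\<^bsub>N\<^esub> h u \<in> adjoin N ?K z" if u: "u \<in> carrier (F j)" for u
  proof -
    have hu: "h u \<in> carrier N"
      using h(1) linear_mapD(1)[OF linear_map_if_mod_hom _, of h R "F j" N u] u
      by (simp add: hom_cocycles_def del: free_mod_simps)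
    note cl = f.f_simps(1)[OF u] g'.f_simps(1)[OF u] hu
    have "f' u \<ominus>\<^bsub>N\<^esub> h u = (f u \<ominus>\<^bsub>N\<^esub> h u) \<ominus>\<^bsub>N\<^esub> z \<odot>\<^bsub>N\<^esub> g' u"
      using cl z(1) u by (simp add: f'_def a_minus_def N.M.a_ac del: free_mod_simps)
    then show ?thesis
      using h(2)[OF u] N.mem_adjoin_iff[OF K z(1)] cl by auto
  qed
  then show ?case
    using h(1) by auto
qed

text \<open>This is the injectivity of Hom(M, N)/z Hom(M, N) -> Hom(M, N/zN). Dividing h by the last
  element gives a cochain that is a cocycle modulo the remaining ones. Its lift to a true cocycle of
  degree 0 is a homomorphism from M. Only the remaining elements enter \<open>lift_cocycle\<close>,
  whence length at most t here and a strict bound there.\<close>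

lemma hom_in_adjoin_seq:
  assumes "set zs \<subseteq> carrier R" "weakly_regular N {\<zero>\<^bsub>N\<^esub>} zs" "length zs \<le> t"
    and "h \<in> mod_hom R M N"
    and "\<And>m. m \<in> carrier M \<Longrightarrow> h m \<in> adjoin_seq N {\<zero>\<^bsub>N\<^esub>} zs"
  shows "h \<in> adjoin_seq (Hom_mod R M N) {\<zero>\<^bsub>Hom_mod R M N\<^esub>} zs"
  using assms
proof (induction zs arbitrary: h rule: rev_induct)
  case Nil
  have "h = (\<lambda>x\<in>carrier M. \<zero>\<^bsub>N\<^esub>)"
    using Nil(4,5) by (intro ext) (auto simp: mod_hom_def PiE_iff extensional_def)
  then show ?case
    by (simp add: Hom_mod_def)
next
  case (snoc z zs)
  let ?K = "adjoin_seq N {\<zero>\<^bsub>N\<^esub>} zs"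
  have zs: "set zs \<subseteq> carrier R" "weakly_regular N {\<zero>\<^bsub>N\<^esub>} zs" and z: "z \<in> carrier R" "nzd N ?K z"
    using snoc.prems(1,2) by (auto simp: weakly_regular_append)
  have K: "submodule ?K R N"
    by (rule N.submodule_adjoin_seq[OF N.submodule_zero zs(1)])
  note KD = N.submodule_closed[OF K]
  interpret h: module_hom R M N h
    by (intro module_homI M.module_axioms N.module_axioms linear_map_if_mod_hom snoc.prems(4))
  have "linear_map R (F 0) N (\<lambda>u. h (e u))"
    by (rule linear_map_comp[OF e.lin h.lin])
  moreover have "h (e u) \<in> adjoin N ?K z" if "u \<in> carrier (F 0)" for u
    using snoc.prems(5)[OF e.f_simps(1)[OF that]] by simp
  ultimately have "\<exists>c\<in>mod_hom R (F 0) N.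
      \<forall>u\<in>carrier (F 0). h (e u) \<ominus>\<^bsub>N\<^esub> z \<odot>\<^bsub>N\<^esub> c u \<in> ?K"
    by (rule M.R.ex_free_lift_mod_adjoin[OF N.module_axioms K z(1)])
  then obtain c where c: "c \<in> mod_hom R (F 0) N"
    "\<forall>u\<in>carrier (F 0). h (e u) \<ominus>\<^bsub>N\<^esub> z \<odot>\<^bsub>N\<^esub> c u \<in> ?K"
    by (elim bexE)
  note c = c(1) bspec[OF c(2)]
  interpret c: module_hom R "F 0" N c
    by (intro module_homI module_F N.module_axioms linear_map_if_mod_hom c(1))
  have "c (d 0 v) \<in> ?K" if v: "v \<in> carrier (F (Suc 0))" for v
  proof -
    note dv = d.f_simps(1)[OF v]
    have "d 0 v \<in> a_kernel (F 0) M e"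
      using kernel_e v by auto
    then have "e (d 0 v) = \<zero>\<^bsub>M\<^esub>"
      by (simp add: a_kernel_def' del: free_mod_simps)
    then have "\<ominus>\<^bsub>N\<^esub> (z \<odot>\<^bsub>N\<^esub> c (d 0 v)) \<in> ?K"
      using c(2)[OF dv] h.f_zero c.f_simps(1)[OF dv] z(1)
      by (simp add: a_minus_def del: free_mod_simps)
    from KD(6)[OF this] have "z \<odot>\<^bsub>N\<^esub> c (d 0 v) \<in> ?K"
      using c.f_simps(1)[OF dv] z(1) by simp
    then show ?thesis
      using z(2) c.f_simps(1)[OF dv] by (simp add: nzd_def)
  qed
  moreover have "0 + length zs < t"
    using snoc.prems(3) by simp
  ultimately have "\<exists>g\<in>hom_cocycles R b d N 0. \<forall>u\<in>carrier (F 0). c u \<ominus>\<^bsub>N\<^esub> g u \<in> ?K"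
    by (intro lift_cocycle[OF zs _ c(1)])
  then obtain g where g: "g \<in> hom_cocycles R b d N 0"
    "\<forall>u\<in>carrier (F 0). c u \<ominus>\<^bsub>N\<^esub> g u \<in> ?K"
    by (elim bexE)
  note g = g(1) bspec[OF g(2)]
  have g_hom: "g \<in> mod_hom R (F 0) N" and g_d: "\<And>v. v \<in> carrier (F (Suc 0)) \<Longrightarrow> g (d 0 v) = \<zero>\<^bsub>N\<^esub>"
    using g(1) by (simp_all add: hom_cocycles_def del: free_mod_simps)
  have "g u = \<zero>\<^bsub>N\<^esub>" if "u \<in> carrier (F 0)" "e u = \<zero>\<^bsub>M\<^esub>" for u
  proof -
    have "u \<in> d 0 ` carrier (F 1)"
      using that unfolding kernel_e by (simp add: a_kernel_def' del: free_mod_simps)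
    then show ?thesis
      using g_d by auto
  qed
  \<comment> \<open>The kernel of e is the image of d 0, where the cocycle g vanishes, so g factors
    through M.\<close>
  then have "\<exists>g'\<in>mod_hom R M N. \<forall>u\<in>carrier (F 0). g' (e u) = g u"
    by (rule e.ex_factorization[OF e_surj N.module_axioms linear_map_if_mod_hom[OF g_hom]])
  then obtain g' where g': "g' \<in> mod_hom R M N" "\<forall>u\<in>carrier (F 0). g' (e u) = g u"
    by (elim bexE)
  note g' = g'(1) bspec[OF g'(2)]
  interpret g': module_hom R M N g'
    by (intro module_homI M.module_axioms N.module_axioms linear_map_if_mod_hom g'(1))
  define h' where "h' = (\<lambda>m\<in>carrier M. h m \<ominus>\<^bsub>N\<^esub> z \<odot>\<^bsub>N\<^esub> g' m)"
  have h': "h' \<in> mod_hom R M N"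
    unfolding h'_def
    by (intro restrict_in_mod_hom M.module_axioms h.linear_map_minus_smult g'.lin z(1))
  have "h' m \<in> ?K" if "m \<in> carrier M" for m
  proof -
    obtain u where u: "u \<in> carrier (F 0)" "m = e u"
      using \<open>m \<in> carrier M\<close> e_surj by blast
    note cl = h.f_simps(1)[OF that] g'.f_simps(1)[OF that] c.f_simps(1)[OF u(1)]
    have "(h (e u) \<ominus>\<^bsub>N\<^esub> z \<odot>\<^bsub>N\<^esub> c u) \<oplus>\<^bsub>N\<^esub> z \<odot>\<^bsub>N\<^esub> (c u \<ominus>\<^bsub>N\<^esub> g' m) \<in> ?K"
      using c(2)[OF u(1)] g(2)[OF u(1)] g'(2)[OF u(1)] u(2) KD(3,5) z(1) by simp
    also have "(h (e u) \<ominus>\<^bsub>N\<^esub> z \<odot>\<^bsub>N\<^esub> c u) \<oplus>\<^bsub>N\<^esub> z \<odot>\<^bsub>N\<^esub> (c u \<ominus>\<^bsub>N\<^esub> g' m) = h' m"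
      using cl z(1) that by (simp add: u(2)[symmetric] h'_def a_minus_def N.smult_r_distr N.smult_r_minus
          N.M.a_assoc N.M.r_neg1)
    finally show ?thesis .
  qed
  then have IH: "h' \<in> adjoin_seq (Hom_mod R M N) {\<zero>\<^bsub>Hom_mod R M N\<^esub>} zs"
    using snoc.IH[OF zs _ h'] snoc.prems(3) by simp
  have "h = h' \<oplus>\<^bsub>Hom_mod R M N\<^esub> z \<odot>\<^bsub>Hom_mod R M N\<^esub> g'"
  proof
    fix m
    show "h m = (h' \<oplus>\<^bsub>Hom_mod R M N\<^esub> z \<odot>\<^bsub>Hom_mod R M N\<^esub> g') m"
    proof (cases "m \<in> carrier M")
      case True
      note cl = h.f_simps(1)[OF True] g'.f_simps(1)[OF True]
      have "h' m \<oplus>\<^bsub>N\<^esub> z \<odot>\<^bsub>N\<^esub> g' m = h m"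
        using True cl z(1) N.minus_eq_iff_eq_plus[of "h m" "z \<odot>\<^bsub>N\<^esub> g' m" "h' m"]
        by (simp add: h'_def)
      then show ?thesis
        using True by (simp add: Hom_mod_def)
    next
      case False
      then show ?thesis
        using snoc.prems(4) by (auto simp: Hom_mod_def mod_hom_def PiE_iff extensional_def)
    qed
  qed
  moreover have "g' \<in> carrier (Hom_mod R M N)"
    using g'(1) by (simp add: Hom_mod_def)
  ultimately show ?case
    using IH by (auto simp: adjoin_def[of _ _ z])
qed

end

section \<open>Regular sequences on submodules and on free modules\<close>

lemma (in module) adjoin_seq_decompose:
  assumes L: "submodule L R M" and "set zs \<subseteq> carrier R" "v \<in> adjoin_seq M L zs"
  shows "\<exists>l\<in>L. \<exists>k\<in>adjoin_seq M {\<zero>\<^bsub>M\<^esub>} zs. v = l \<oplus>\<^bsub>M\<^esub> k"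
  using assms(2,3)
proof (induction zs arbitrary: v rule: rev_induct)
  case Nil
  then show ?case
    using submodule_closed(1)[OF L] by force
next
  case (snoc z zs)
  then obtain u w where v: "u \<in> adjoin_seq M L zs" "w \<in> carrier M" "v = u \<oplus>\<^bsub>M\<^esub> z \<odot>\<^bsub>M\<^esub> w"
    by (auto elim: adjoinE)
  then obtain l k where lk: "l \<in> L" "k \<in> adjoin_seq M {\<zero>\<^bsub>M\<^esub>} zs" "u = l \<oplus>\<^bsub>M\<^esub> k"
    using snoc.IH[of u] snoc.prems(1) by auto
  have "l \<in> carrier M" "k \<in> carrier M"
    using lk(1,2) submodule_closed(1)[OF L] submodule_closed(1)[OF submodule_adjoin_seq[OF submodule_zero]]
      snoc.prems(1) by auto
  then have "v = l \<oplus>\<^bsub>M\<^esub> (k \<oplus>\<^bsub>M\<^esub> z \<odot>\<^bsub>M\<^esub> w)"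
    using v(2,3) lk(3) snoc.prems(1) by (simp add: M.a_assoc)
  moreover have "k \<oplus>\<^bsub>M\<^esub> z \<odot>\<^bsub>M\<^esub> w \<in> adjoin_seq M {\<zero>\<^bsub>M\<^esub>} (zs @ [z])"
    using adjoinI[OF lk(2) v(2)] by simp
  ultimately show ?case
    using lk(1) by blast
qed

lemma adjoin_mono: "K \<subseteq> L \<Longrightarrow> adjoin M K z \<subseteq> adjoin M L z"
  unfolding adjoin_def by blast

lemma adjoin_seq_mono: "K \<subseteq> L \<Longrightarrow> adjoin_seq M K zs \<subseteq> adjoin_seq M L zs"
  by (induction zs arbitrary: K L) (auto simp: adjoin_mono)

text \<open>Regularity on the cokernel keeps M/(zs)M -> N/(zs)N injective. Hence the next element is
  a nonzerodivisor on M/(zs)M, as it is on N/(zs)N. The two claims are proved together because the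
  second drives the first.\<close>

lemma (in module_hom) weakly_regular_source:
  assumes inj: "inj_on f (carrier M)" and "set zs \<subseteq> carrier R"
    and "weakly_regular N {\<zero>\<^bsub>N\<^esub>} zs" "weakly_regular N (f ` carrier M) zs"
  shows "weakly_regular M {\<zero>\<^bsub>M\<^esub>} zs \<and>
    (\<forall>x\<in>carrier M. f x \<in> adjoin_seq N {\<zero>\<^bsub>N\<^esub>} zs \<longrightarrow> x \<in> adjoin_seq M {\<zero>\<^bsub>M\<^esub>} zs)"
  using assms(2-)
proof (induction zs rule: rev_induct)
  case Nil
  show ?case
    using inj by (simp add: inj_on_iff_kernel)
next
  case (snoc z zs)
  let ?K = "adjoin_seq N {\<zero>\<^bsub>N\<^esub>} zs"
  let ?L = "f ` carrier M"
  have zs: "set zs \<subseteq> carrier R" and z: "z \<in> carrier R" "nzd N ?K z" "nzd N (adjoin_seq N ?L zs) z"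
    using snoc.prems by (auto simp: weakly_regular_append)
  have IH: "weakly_regular M {\<zero>\<^bsub>M\<^esub>} zs"
    "\<And>x. x \<in> carrier M \<Longrightarrow> f x \<in> ?K \<Longrightarrow> x \<in> adjoin_seq M {\<zero>\<^bsub>M\<^esub>} zs"
    using snoc.IH snoc.prems by (auto simp: weakly_regular_append)
  have K: "submodule ?K R N"
    by (rule N.submodule_adjoin_seq[OF N.submodule_zero zs])
  have L: "submodule ?L R N"
    by (rule submodule_image[OF M.carrier_is_submodule])
  note KL = N.submodule_adjoin_seq[OF L zs]
  have fK: "f x \<in> ?K" if "x \<in> adjoin_seq M {\<zero>\<^bsub>M\<^esub>} zs" for x
    using image_adjoin_seq[of "{\<zero>\<^bsub>M\<^esub>}" "{\<zero>\<^bsub>N\<^esub>}" zs x] that zs f_zero by simp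
  have "x \<in> adjoin_seq M {\<zero>\<^bsub>M\<^esub>} zs" if x: "x \<in> carrier M" "z \<odot>\<^bsub>M\<^esub> x \<in> adjoin_seq M {\<zero>\<^bsub>M\<^esub>} zs" for x
  proof -
    have "z \<odot>\<^bsub>N\<^esub> f x \<in> ?K"
      using fK[OF x(2)] x(1) z(1) by (simp add: f_simps)
    then show ?thesis
      using z(2) x(1) by (intro IH(2)) (auto simp: nzd_def f_simps)
  qed
  then have "nzd M (adjoin_seq M {\<zero>\<^bsub>M\<^esub>} zs) z"
    by (simp add: nzd_def)
  moreover have "x \<in> adjoin M (adjoin_seq M {\<zero>\<^bsub>M\<^esub>} zs) z"
    if x: "x \<in> carrier M" and "f x \<in> adjoin N ?K z" for x
  proof -
    obtain k v where kv: "k \<in> ?K" "v \<in> carrier N" "f x = k \<oplus>\<^bsub>N\<^esub> z \<odot>\<^bsub>N\<^esub> v"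
      using \<open>f x \<in> adjoin N ?K z\<close> by (rule N.adjoinE)
    have "?L \<subseteq> adjoin_seq N ?L zs'" if "set zs' \<subseteq> carrier R" for zs'
      using that
    proof (induction zs' rule: rev_induct)
      case (snoc y ys)
      then show ?case
        using N.subset_adjoin[OF N.submodule_adjoin_seq[OF L], of ys y] by simp
    qed simp
    then have "f x \<in> adjoin_seq N ?L zs"
      using x zs by blast
    moreover have "k \<in> adjoin_seq N ?L zs"
      using kv(1) adjoin_seq_mono[of "{\<zero>\<^bsub>N\<^esub>}" ?L N zs] N.submodule_closed(2)[OF L] by auto
    \<comment> \<open>As f x is zero in the cokernel, z v vanishes there modulo zs, and z can be
      cancelled. So v = f y + k' with k' in \<open>?K\<close>, and x - z y is sent into
      \<open>?K\<close>, where the induction hypothesis applies.\<close>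
    ultimately have "z \<odot>\<^bsub>N\<^esub> v \<in> adjoin_seq N ?L zs"
      using N.submodule_mem_plus_iff[OF KL] kv(2,3) z(1) by simp
    then have "v \<in> adjoin_seq N ?L zs"
      using z(3) kv(2) by (simp add: nzd_def)
    then obtain y k' where y: "y \<in> carrier M" "k' \<in> ?K" "v = f y \<oplus>\<^bsub>N\<^esub> k'"
      using N.adjoin_seq_decompose[OF L zs] by blast
    have cl: "k \<in> carrier N" "k' \<in> carrier N"
      using kv(1) y(2) N.submodule_closed(1)[OF K] by auto
    have "f (x \<ominus>\<^bsub>M\<^esub> z \<odot>\<^bsub>M\<^esub> y) = k \<oplus>\<^bsub>N\<^esub> z \<odot>\<^bsub>N\<^esub> k'"
    proof -
      have "f (x \<ominus>\<^bsub>M\<^esub> z \<odot>\<^bsub>M\<^esub> y) = f x \<ominus>\<^bsub>N\<^esub> z \<odot>\<^bsub>N\<^esub> f y"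
        using x y(1) z(1) by (simp add: f_minus f_simps)
      also have "\<dots> = k \<oplus>\<^bsub>N\<^esub> z \<odot>\<^bsub>N\<^esub> k'"
        using cl f_simps(1)[OF x] f_simps(1)[OF y(1)] z(1)
        by (subst N.minus_eq_iff_eq_plus) (simp_all add: kv(3) y(3) N.smult_r_distr N.M.a_ac)
      finally show ?thesis .
    qed
    then have "f (x \<ominus>\<^bsub>M\<^esub> z \<odot>\<^bsub>M\<^esub> y) \<in> ?K"
      using N.submodule_closed(3,5)[OF K] kv(1) y(2) z(1) by simp
    then have "x \<ominus>\<^bsub>M\<^esub> z \<odot>\<^bsub>M\<^esub> y \<in> adjoin_seq M {\<zero>\<^bsub>M\<^esub>} zs"
      using x y(1) z(1) by (intro IH(2)) auto
    then show ?thesis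
      using M.mem_adjoin_iff[OF M.submodule_adjoin_seq[OF M.submodule_zero zs] z(1) x] y(1) by blast
  qed
  ultimately show ?case
    using IH(1) by (simp add: weakly_regular_append)
qed

context cring
begin

text \<open>The witnesses can be chosen in each coordinate separately and assembled into
  vectors.\<close>

lemma adjoin_seq_free_mod:
  assumes "set zs \<subseteq> carrier R"
  shows "adjoin_seq (free_mod R n) {\<zero>\<^bsub>free_mod R n\<^esub>} zs =
    {u \<in> carrier (free_mod R n). \<forall>i<n. u i \<in> adjoin_seq (regular_module R) {\<zero>} zs}"
  using assms
proof (induction zs rule: rev_induct)
  case Nil
  have "u = \<zero>\<^bsub>free_mod R n\<^esub> \<longleftrightarrow> u \<in> carrier (free_mod R n) \<and> (\<forall>i<n. u i = \<zero>)" for u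
    by (auto simp: fun_eq_iff PiE_iff extensional_def)
  then show ?case
    by (auto simp del: free_mod_simps)
next
  case (snoc z zs)
  interpret F: module R "free_mod R n" by (rule module_free_mod)
  interpret RM: module R "regular_module R" by (rule module_regular)
  let ?I = "adjoin_seq (regular_module R) {\<zero>} zs"
  have zs: "set zs \<subseteq> carrier R" and z: "z \<in> carrier R"
    using snoc.prems by auto
  note IH = snoc.IH[OF zs]
  have "u \<in> carrier (free_mod R n) \<and> (\<forall>i<n. u i \<in> adjoin (regular_module R) ?I z)"
    if u: "u \<in> adjoin_seq (free_mod R n) {\<zero>\<^bsub>free_mod R n\<^esub>} (zs @ [z])" for u
  proof -
    obtain k w where kw: "k \<in> carrier (free_mod R n)" "\<forall>i<n. k i \<in> ?I" "w \<in> carrier (free_mod R n)"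
      "u = k \<oplus>\<^bsub>free_mod R n\<^esub> z \<odot>\<^bsub>free_mod R n\<^esub> w"
      using u unfolding foldl_append IH by (auto elim!: F.adjoinE simp del: free_mod_simps)
    have "u i \<in> adjoin (regular_module R) ?I z" if i: "i < n" for i
    proof -
      have "u i = k i \<oplus>\<^bsub>regular_module R\<^esub> z \<odot>\<^bsub>regular_module R\<^esub> w i" "w i \<in> carrier (regular_module R)"
        using kw(3,4) i by auto
      then show ?thesis
        using RM.adjoinI[of "k i" ?I "w i" z] kw(2) i by simp
    qed
    moreover have "u \<in> carrier (free_mod R n)"
      using kw(1,3) z unfolding kw(4) by (intro F.M.a_closed F.smult_closed)
    ultimately show ?thesis
      by blast
  qed
  moreover have "u \<in> adjoin_seq (free_mod R n) {\<zero>\<^bsub>free_mod R n\<^esub>} (zs @ [z])"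
    if u: "u \<in> carrier (free_mod R n)" "\<forall>i<n. u i \<in> adjoin (regular_module R) ?I z" for u
  proof -
    have "\<forall>i. \<exists>k w. i < n \<longrightarrow> k \<in> ?I \<and> w \<in> carrier R \<and> u i = k \<oplus> z \<otimes> w"
    proof
      fix i
      show "\<exists>k w. i < n \<longrightarrow> k \<in> ?I \<and> w \<in> carrier R \<and> u i = k \<oplus> z \<otimes> w"
        using u(2) by (cases "i < n") (auto simp: adjoin_def)
    qed
    then obtain k w where kw: "\<And>i. i < n \<Longrightarrow> k i \<in> ?I \<and> w i \<in> carrier R \<and> u i = k i \<oplus> z \<otimes> w i"
      by metis
    have kR: "k i \<in> carrier R" if "i < n" for i
      using kw[OF that] RM.submodule_closed(1)[OF RM.submodule_adjoin_seq[OF RM.submodule_zero zs]]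
      by auto
    have "restrict k {..<n} \<in> adjoin_seq (free_mod R n) {\<zero>\<^bsub>free_mod R n\<^esub>} zs"
      unfolding IH using kw kR by auto
    moreover have "restrict w {..<n} \<in> carrier (free_mod R n)"
      using kw by auto
    moreover have "u = restrict k {..<n} \<oplus>\<^bsub>free_mod R n\<^esub> z \<odot>\<^bsub>free_mod R n\<^esub> restrict w {..<n}"
      using u(1) kw by (intro ext) (auto simp: PiE_iff extensional_def)
    ultimately show ?thesis
      using F.adjoinI by (simp del: free_mod_simps)
  qed
  ultimately show ?case
    by (auto simp del: free_mod_simps)
qed

lemma weakly_regular_free_mod:
  assumes "set zs \<subseteq> carrier R" "weakly_regular (regular_module R) {\<zero>} zs"
  shows "weakly_regular (free_mod R n) {\<zero>\<^bsub>free_mod R n\<^esub>} zs"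
  using assms
proof (induction zs rule: rev_induct)
  case (snoc z zs)
  have zs: "set zs \<subseteq> carrier R"
    using snoc.prems(1) by simp
  have z: "nzd (regular_module R) (adjoin_seq (regular_module R) {\<zero>} zs) z"
    using snoc.prems(2) by (simp add: weakly_regular_append)
  have "nzd (free_mod R n) (adjoin_seq (free_mod R n) {\<zero>\<^bsub>free_mod R n\<^esub>} zs) z"
    unfolding adjoin_seq_free_mod[OF zs] using z by (auto simp: nzd_def PiE_iff)
  then show ?case
    using snoc by (simp add: weakly_regular_append del: free_mod_simps)
qed simp

end

section \<open>Free modules over a local ring\<close>

lemma (in module_hom) f_finsum:
  assumes "finite A" "g \<in> A \<rightarrow> carrier M"
  shows "f (finsum M g A) = (\<Oplus>\<^bsub>N\<^esub>i\<in>A. f (g i))"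
  using assms
proof (induction A rule: finite_induct)
  case (insert a A)
  then have "g \<in> A \<rightarrow> carrier M" "g a \<in> carrier M" "(\<lambda>i. f (g i)) \<in> A \<rightarrow> carrier N"
    by (auto simp: Pi_iff f_simps(1))
  then show ?case
    using insert by (simp add: f_simps M.M.finsum_closed)
qed (simp add: f_zero)

context cring
begin

lemma free_mod_eq_finsum_basis:
  assumes v: "v \<in> carrier (free_mod R n)"
  shows "v = (\<Oplus>\<^bsub>free_mod R n\<^esub>j\<in>{..<n}. v j \<odot>\<^bsub>free_mod R n\<^esub> basis_vec R n j)"
proof -
  interpret F: module R "free_mod R n" by (rule module_free_mod)
  interpret RM: module R "regular_module R" by (rule module_regular)
  let ?g = "\<lambda>j. v j \<odot>\<^bsub>free_mod R n\<^esub> basis_vec R n j"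
  have g: "?g \<in> {..<n} \<rightarrow> carrier (free_mod R n)"
    using v basis_vec_closed by (intro Pi_I F.smult_closed) auto
  have sum: "(\<Oplus>\<^bsub>free_mod R n\<^esub>j\<in>{..<n}. ?g j) \<in> carrier (free_mod R n)"
    using g by (rule F.M.finsum_closed)
  have "(\<Oplus>\<^bsub>free_mod R n\<^esub>j\<in>{..<n}. ?g j) i = v i" if i: "i < n" for i
  proof -
    interpret c: module_hom R "free_mod R n" "regular_module R" "\<lambda>u. u i"
      by (intro module_homI linear_map_coord i F.module_axioms RM.module_axioms)
    have "(\<Oplus>\<^bsub>free_mod R n\<^esub>j\<in>{..<n}. ?g j) i = (\<Oplus>\<^bsub>regular_module R\<^esub>j\<in>{..<n}. ?g j i)"
      using g by (intro c.f_finsum) auto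
    also have "\<dots> = (\<Oplus>\<^bsub>regular_module R\<^esub>j\<in>{..<n}. if i = j then v j else \<zero>\<^bsub>regular_module R\<^esub>)"
      using v i by (intro RM.M.finsum_cong') (auto simp: basis_vec_def PiE_iff)
    also have "\<dots> = v i"
      using v i by (intro RM.M.finsum_singleton) (auto simp: PiE_iff)
    finally show ?thesis .
  qed
  then show ?thesis
    using v sum unfolding free_mod_simps(1) by (intro PiE_ext[of v "{..<n}"]) simp_all
qed

lemma is_free_if_zero_module:
  assumes "module R P" "zero_module P"
  shows "is_free R P"
proof -
  interpret P: module R P by fact
  have "linear_map R P (free_mod R 0) (\<lambda>x. \<lambda>i\<in>{..<0::nat}. \<zero>)"
    by (auto simp: linear_map_def)
  from restrict_in_mod_hom[OF P.module_axioms this]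
  have "(\<lambda>x\<in>carrier P. \<lambda>i\<in>{..<0::nat}. \<zero>) \<in> mod_hom R P (free_mod R 0)" .
  moreover have "bij_betw (\<lambda>x\<in>carrier P. \<lambda>i\<in>{..<0::nat}. \<zero>) (carrier P) (carrier (free_mod R 0))"
    using assms(2) by (auto simp: zero_module_def bij_betw_def)
  ultimately show ?thesis
    unfolding is_free_def using P.module_axioms by blast
qed

text \<open>P is the direct sum of the kernel of \<phi> and R y, with projection p - \<phi>(p) y
  onto the kernel. An isomorphism of the kernel with R^n, extended by \<phi> as last coordinate, is
  one of P with R^(n+1).\<close>

lemma is_free_if_kernel_is_free:
  assumes P: "module R P" and \<phi>: "linear_map R P (regular_module R) \<phi>"
    and y: "y \<in> carrier P" "\<phi> y = \<one>"
    and free: "is_free R (P\<lparr>carrier := {p \<in> carrier P. \<phi> p = \<zero>}\<rparr>)"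
  shows "is_free R P"
proof -
  interpret RM: module R "regular_module R" by (rule module_regular)
  interpret \<phi>: module_hom R P "regular_module R" \<phi>
    by (intro module_homI P RM.module_axioms \<phi>)
  let ?K = "{p \<in> carrier P. \<phi> p = \<zero>}"
  let ?P = "P\<lparr>carrier := ?K\<rparr>"
  obtain n f where f: "f \<in> mod_hom R ?P (free_mod R n)" "bij_betw f (carrier ?P) (carrier (free_mod R n))"
    using free unfolding is_free_def by blast
  note fD = linear_mapD[OF linear_map_if_mod_hom[OF f(1)], simplified]
  define \<pi> where "\<pi> p = p \<ominus>\<^bsub>P\<^esub> \<phi> p \<odot>\<^bsub>P\<^esub> y" for p
  have \<phi>R: "\<phi> p \<in> carrier R" if "p \<in> carrier P" for p
    using \<phi>.f_simps(1)[OF that] by simp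
  have \<pi>K: "\<pi> p \<in> ?K" if "p \<in> carrier P" for p
  proof -
    have "\<phi> p = \<phi> (\<phi> p \<odot>\<^bsub>P\<^esub> y)"
      using that y \<phi>R[OF that] by (simp add: \<phi>.f_simps)
    then show ?thesis
      using that y \<phi>R[OF that] \<phi>.f_minus_eq_zero[of p "\<phi> p \<odot>\<^bsub>P\<^esub> y"] by (simp add: \<pi>_def)
  qed
  have \<pi>_id: "\<pi> p = p" if "p \<in> ?K" for p
    using that y by (simp add: \<pi>_def a_minus_def)
  have decomp: "p = \<pi> p \<oplus>\<^bsub>P\<^esub> \<phi> p \<odot>\<^bsub>P\<^esub> y" if "p \<in> carrier P" for p
    using that y(1) \<phi>R[OF that] \<phi>.M.minus_eq_iff_eq_plus[of p "\<phi> p \<odot>\<^bsub>P\<^esub> y" "\<pi> p"] by (simp add: \<pi>_def)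
  have \<pi>_add: "\<pi> (p \<oplus>\<^bsub>P\<^esub> q) = \<pi> p \<oplus>\<^bsub>P\<^esub> \<pi> q" if "p \<in> carrier P" "q \<in> carrier P" for p q
    using that y(1) \<phi>R by (simp add: \<pi>_def \<phi>.f_simps \<phi>.M.smult_l_distr a_minus_def \<phi>.M.M.minus_add \<phi>.M.M.a_ac)
  have \<pi>_smult: "\<pi> (a \<odot>\<^bsub>P\<^esub> p) = a \<odot>\<^bsub>P\<^esub> \<pi> p" if "a \<in> carrier R" "p \<in> carrier P" for a p
    using that y(1) \<phi>R by (simp add: \<pi>_def \<phi>.f_simps \<phi>.M.smult_assoc1 \<phi>.M.smult_minus_right)
  define g where "g = (\<lambda>p. \<lambda>i\<in>{..<Suc n}. if i = n then \<phi> p else f (\<pi> p) i)"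
  have f\<pi>: "f (\<pi> p) \<in> {..<n} \<rightarrow>\<^sub>E carrier R" if "p \<in> carrier P" for p
    using fD(1)[of "\<pi> p"] \<pi>K[OF that] by simp
  have "linear_map R P (free_mod R (Suc n)) g"
    unfolding linear_map_def
  proof (intro conjI ballI)
    show "g \<in> carrier P \<rightarrow> carrier (free_mod R (Suc n))"
      using f\<pi> \<phi>R by (fastforce simp: g_def PiE_iff)
  next
    fix p q assume pq: "p \<in> carrier P" "q \<in> carrier P"
    have "f (\<pi> (p \<oplus>\<^bsub>P\<^esub> q)) = (\<lambda>i\<in>{..<n}. f (\<pi> p) i \<oplus> f (\<pi> q) i)"
      using fD(2)[of "\<pi> p" "\<pi> q"] \<pi>K[OF pq(1)] \<pi>K[OF pq(2)] \<pi>_add[OF pq] by simp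
    then show "g (p \<oplus>\<^bsub>P\<^esub> q) = g p \<oplus>\<^bsub>free_mod R (Suc n)\<^esub> g q"
      using pq by (auto simp: g_def \<phi>.f_simps intro!: restrict_ext)
  next
    fix a p assume ap: "a \<in> carrier R" "p \<in> carrier P"
    have "f (\<pi> (a \<odot>\<^bsub>P\<^esub> p)) = (\<lambda>i\<in>{..<n}. a \<otimes> f (\<pi> p) i)"
      using fD(3)[of a "\<pi> p"] \<pi>K[OF ap(2)] \<pi>_smult[OF ap] ap(1) by simp
    then show "g (a \<odot>\<^bsub>P\<^esub> p) = a \<odot>\<^bsub>free_mod R (Suc n)\<^esub> g p"
      using ap by (auto simp: g_def \<phi>.f_simps intro!: restrict_ext)
  qed
  moreover have "bij_betw g (carrier P) (carrier (free_mod R (Suc n)))"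
    unfolding bij_betw_def
  proof
    show "inj_on g (carrier P)"
    proof (rule inj_onI)
      fix p q assume pq: "p \<in> carrier P" "q \<in> carrier P" "g p = g q"
      have g_eq: "g p i = g q i" for i
        using pq(3) by simp
      have "\<phi> p = \<phi> q"
        using g_eq[of n] by (simp add: g_def)
      moreover have "f (\<pi> p) = f (\<pi> q)"
      proof
        fix i
        show "f (\<pi> p) i = f (\<pi> q) i"
          using g_eq[of i] f\<pi>[OF pq(1)] f\<pi>[OF pq(2)]
          by (cases "i < n") (auto simp: g_def PiE_iff extensional_def)
      qed
      then have "\<pi> p = \<pi> q"
        using f(2) \<pi>K pq(1,2) by (auto simp: bij_betw_def dest: inj_onD)
      ultimately show "p = q"
        using decomp[OF pq(1)] decomp[OF pq(2)] by simp
    qed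
    have "v \<in> g ` carrier P" if v: "v \<in> carrier (free_mod R (Suc n))" for v
    proof -
      have vR: "v i \<in> carrier R" if "i < Suc n" for i
        using v that by (simp add: PiE_iff)
      then have vn: "v n \<in> carrier R"
        by simp
      have "restrict v {..<n} \<in> carrier (free_mod R n)"
        using vR by (simp add: restrict_PiE_iff)
      moreover have "f ` ?K = carrier (free_mod R n)"
        using f(2) by (simp add: bij_betw_def del: free_mod_simps)
      ultimately have "restrict v {..<n} \<in> f ` ?K"
        by (simp only:)
      then obtain q where q: "f q = restrict v {..<n}" "q \<in> ?K"
        by (rule imageE) simp
      note q = q(2,1)
      define p where "p = q \<oplus>\<^bsub>P\<^esub> v n \<odot>\<^bsub>P\<^esub> y"
      have p: "p \<in> carrier P" "\<phi> p = v n"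
        using q(1) vn y by (simp_all add: p_def \<phi>.f_simps)
      have "\<pi> p = q"
        using q(1) vn y(1) p by (simp add: \<pi>_def \<phi>.M.minus_eq_iff_eq_plus) (simp add: p_def)
      then have "g p = v"
        using p(2) q(2) v by (intro ext) (auto simp: g_def PiE_iff extensional_def)
      then show ?thesis
        using p(1) by blast
    qed
    then show "g ` carrier P = carrier (free_mod R (Suc n))"
      using linear_mapD(1)[OF \<open>linear_map R P (free_mod R (Suc n)) g\<close>] by blast
  qed
  then have "bij_betw (restrict g (carrier P)) (carrier P) (carrier (free_mod R (Suc n)))"
    by (simp add: bij_betw_def inj_on_def)
  ultimately show ?thesis
    unfolding is_free_def using P restrict_in_mod_hom[OF P] by blast
qed

end

text \<open>
  A dual basis \<open>x\<^sub>0, \<dots>, x\<^sub>n\<close>, \<open>\<phi>\<^sub>0, \<dots>, \<phi>\<^sub>n\<close> can be shortened because \<open>R\<close> is local: if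
  \<open>\<phi>\<^sub>n(x\<^sub>n)\<close> is a unit, then \<open>x\<^sub>n\<close> splits off; otherwise \<open>1 - \<phi>\<^sub>n(x\<^sub>n)\<close> is a unit, and \<open>x\<^sub>n\<close> is a
  combination of the other \<open>x\<^sub>i\<close>.
\<close>

lemma (in noetherian_local_ring) is_free_if_dual_basis:
  fixes n :: nat
  assumes "module R P" "\<And>i. i < n \<Longrightarrow> x i \<in> carrier P"
    and "\<And>i. i < n \<Longrightarrow> linear_map R P (regular_module R) (\<phi> i)"
    and "\<And>p. p \<in> carrier P \<Longrightarrow> p = (\<Oplus>\<^bsub>P\<^esub>i\<in>{..<n}. \<phi> i p \<odot>\<^bsub>P\<^esub> x i)"
  shows "is_free R P"
  using assms
proof (induction n arbitrary: P x \<phi>)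
  case 0
  then interpret P: module R P by simp
  have "p = \<zero>\<^bsub>P\<^esub>" if "p \<in> carrier P" for p
    using 0(4)[OF that] by simp
  then have "zero_module P"
    using P.M.zero_closed unfolding zero_module_def by blast
  then show ?case
    by (rule is_free_if_zero_module[OF P.module_axioms])
next
  case (Suc n)
  interpret P: module R P by fact
  have \<phi>R: "\<phi> i p \<in> carrier R" if "i < Suc n" "p \<in> carrier P" for i p
    using linear_mapD(1)[OF Suc.prems(3)[OF that(1)] that(2)] by simp
  note xP = Suc.prems(2)
  have summand: "(\<lambda>i. \<phi> i p \<odot>\<^bsub>P\<^esub> x i) \<in> {..<n} \<rightarrow> carrier P" if "p \<in> carrier P" for p
    using that \<phi>R xP by simp
  have sum_cl: "(\<Oplus>\<^bsub>P\<^esub>i\<in>{..<n}. \<phi> i p \<odot>\<^bsub>P\<^esub> x i) \<in> carrier P" if "p \<in> carrier P" for p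
    by (rule P.M.finsum_closed[OF summand[OF that]])
  have expand: "p = \<phi> n p \<odot>\<^bsub>P\<^esub> x n \<oplus>\<^bsub>P\<^esub> (\<Oplus>\<^bsub>P\<^esub>i\<in>{..<n}. \<phi> i p \<odot>\<^bsub>P\<^esub> x i)" if p: "p \<in> carrier P" for p
  proof -
    have "(\<Oplus>\<^bsub>P\<^esub>i\<in>{..<Suc n}. \<phi> i p \<odot>\<^bsub>P\<^esub> x i) = \<phi> n p \<odot>\<^bsub>P\<^esub> x n \<oplus>\<^bsub>P\<^esub> (\<Oplus>\<^bsub>P\<^esub>i\<in>{..<n}. \<phi> i p \<odot>\<^bsub>P\<^esub> x i)"
      unfolding lessThan_Suc
      by (rule P.M.finsum_insert[OF _ _ summand[OF p]]) (use p \<phi>R xP in auto)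
    then show ?thesis
      using Suc.prems(4)[OF p] by (rule trans[rotated])
  qed
  interpret RM: module R "regular_module R" by (rule module_regular)
  interpret \<phi>: module_hom R P "regular_module R" "\<phi> n"
    by (intro module_homI P.module_axioms RM.module_axioms Suc.prems(3)) simp
  define a where "a = \<phi> n (x n)"
  have aR: "a \<in> carrier R"
    using \<phi>R xP by (simp add: a_def)
  show ?case
  proof (cases "a \<in> max_ideal R")
    case False
    then have "a \<in> Units R"
      using Units_if_notin_max_ideal aR by blast
    define y where "y = inv a \<odot>\<^bsub>P\<^esub> x n"
    have y: "y \<in> carrier P" "\<phi> n y = \<one>"
      using \<open>a \<in> Units R\<close> xP by (simp_all add: y_def \<phi>.f_simps a_def[symmetric])
    let ?K = "{p \<in> carrier P. \<phi> n p = \<zero>}"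
    let ?P = "P\<lparr>carrier := ?K\<rparr>"
    have K: "submodule ?K R P"
      using \<phi>.submodule_Int_kernel[OF P.carrier_is_submodule] by simp
    have P': "module R ?P"
      by (rule submodule.submodule_is_module[OF K P.module_axioms])
    interpret inc: module_hom R ?P P "\<lambda>p. p"
      by (intro module_homI P' P.module_axioms) (auto simp: linear_map_def)
    define \<pi> where "\<pi> p = p \<ominus>\<^bsub>P\<^esub> \<phi> n p \<odot>\<^bsub>P\<^esub> y" for p
    have \<pi>_lin: "linear_map R P P \<pi>"
      using y(1) \<phi>R[of n]
      by (auto simp: linear_map_def \<pi>_def \<phi>.f_simps P.smult_l_distr a_minus_def P.M.minus_add
          P.M.a_ac P.smult_assoc1 P.smult_r_distr P.smult_r_minus)
    interpret \<pi>: module_hom R P P \<pi>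
      by (intro module_homI P.module_axioms \<pi>_lin)
    have \<pi>K: "\<pi> p \<in> ?K" if p: "p \<in> carrier P" for p
    proof -
      have "\<phi> n p = \<phi> n (\<phi> n p \<odot>\<^bsub>P\<^esub> y)"
        using p y \<phi>R[of n p] by (simp add: \<phi>.f_simps)
      then show ?thesis
        using p y \<phi>R[of n p] \<phi>.f_minus_eq_zero[of p "\<phi> n p \<odot>\<^bsub>P\<^esub> y"] by (simp add: \<pi>_def)
    qed
    have \<pi>_id: "\<pi> p = p" if "p \<in> ?K" for p
      using that y(1) by (simp add: \<pi>_def a_minus_def)
    \<comment> \<open>On the kernel of the last functional its term in the expansion is zero.
      Applying \<pi>, which fixes the kernel, moves the other vectors into it and leaves a dual
      basis of length n.\<close>
    have "is_free R ?P"
    proof (rule Suc.IH[OF P', of "\<lambda>i. \<pi> (x i)" \<phi>])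
      show "\<pi> (x i) \<in> carrier ?P" if "i < n" for i
        using \<pi>K[OF xP[of i]] that by simp
      show "linear_map R ?P (regular_module R) (\<phi> i)" if "i < n" for i
        using linear_map_comp[OF inc.lin Suc.prems(3)[of i]] that by simp
      fix p assume "p \<in> carrier ?P"
      then have p: "p \<in> carrier P" "\<phi> n p = \<zero>" "p \<in> ?K"
        by auto
      have "p = (\<Oplus>\<^bsub>P\<^esub>i\<in>{..<n}. \<phi> i p \<odot>\<^bsub>P\<^esub> x i)"
        using expand[OF p(1)] p(2) xP[of n] sum_cl[OF p(1)] by simp
      then have "\<pi> p = (\<Oplus>\<^bsub>P\<^esub>i\<in>{..<n}. \<pi> (\<phi> i p \<odot>\<^bsub>P\<^esub> x i))"
        using \<pi>.f_finsum[OF _ summand[OF p(1)]] by simp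
      also have "\<dots> = (\<Oplus>\<^bsub>P\<^esub>i\<in>{..<n}. \<phi> i p \<odot>\<^bsub>P\<^esub> \<pi> (x i))"
        using p(1) \<phi>R xP \<pi>.f_simps by (intro P.M.finsum_cong') auto
      also have "\<dots> = (\<Oplus>\<^bsub>?P\<^esub>i\<in>{..<n}. \<phi> i p \<odot>\<^bsub>P\<^esub> \<pi> (x i))"
        using inc.f_finsum[of "{..<n}" "\<lambda>i. \<phi> i p \<odot>\<^bsub>P\<^esub> \<pi> (x i)"] \<pi>K xP \<phi>R p(1)
          P.submodule_closed(5)[OF K] by (simp add: Pi_iff)
      finally show "p = (\<Oplus>\<^bsub>?P\<^esub>i\<in>{..<n}. \<phi> i p \<odot>\<^bsub>?P\<^esub> \<pi> (x i))"
        using \<pi>_id[OF p(3)] by simp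
    qed
    then show ?thesis
      by (intro is_free_if_kernel_is_free[OF P.module_axioms \<phi>.lin y])
  next
    case True
    have "\<one> \<ominus> a \<notin> max_ideal R"
    proof
      assume "\<one> \<ominus> a \<in> max_ideal R"
      then have "a \<oplus> (\<one> \<ominus> a) \<in> max_ideal R"
        using True ideal_max_ideal by (meson additive_subgroup.a_closed ideal.axioms(1))
      moreover have "a \<oplus> (\<one> \<ominus> a) = \<one>"
        using aR by (simp add: a_minus_def a_lcomm[of a \<one>] r_neg)
      ultimately show False
        using one_notin_max_ideal by simp
    qed
    then have unit: "\<one> \<ominus> a \<in> Units R"
      using Units_if_notin_max_ideal aR by simp
    define c where "c = inv (\<one> \<ominus> a)"
    have c: "c \<in> carrier R" "c \<otimes> (\<one> \<ominus> a) = \<one>"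
      using unit by (simp_all add: c_def)
    let ?s = "\<Oplus>\<^bsub>P\<^esub>i\<in>{..<n}. \<phi> i (x n) \<odot>\<^bsub>P\<^esub> x i"
    have xn: "x n \<in> carrier P"
      using xP by simp
    have "(\<one> \<ominus> a) \<odot>\<^bsub>P\<^esub> x n = x n \<ominus>\<^bsub>P\<^esub> a \<odot>\<^bsub>P\<^esub> x n"
      using aR xn by (simp add: a_minus_def P.smult_l_distr P.smult_l_minus)
    also have "\<dots> = ?s"
      using expand[OF xn] aR xn sum_cl[OF xn]
      by (subst P.minus_eq_iff_eq_plus) (simp_all add: a_def P.M.a_comm)
    finally have "c \<odot>\<^bsub>P\<^esub> ?s = (c \<otimes> (\<one> \<ominus> a)) \<odot>\<^bsub>P\<^esub> x n"
      using c(1) aR xn by (simp add: P.smult_assoc1)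
    then have xn_eq: "x n = c \<odot>\<^bsub>P\<^esub> ?s"
      using c(2) xn by simp
    \<comment> \<open>Substituting x_n = c times the sum of the \<phi>_i(x_n) x_i into the expansion
      of p and collecting the coefficients of x_i gives the new functionals.\<close>
    show ?thesis
    proof (rule Suc.IH[OF P.module_axioms, of x
          "\<lambda>i p. \<phi> i p \<oplus> \<phi> n p \<otimes> (c \<otimes> \<phi> i (x n))"])
      show "x i \<in> carrier P" if "i < n" for i
        using xP that by simp
      show "linear_map R P (regular_module R) (\<lambda>p. \<phi> i p \<oplus> \<phi> n p \<otimes> (c \<otimes> \<phi> i (x n)))" if "i < n" for i
      proof -
        have "c \<otimes> \<phi> i (x n) \<in> carrier R"
          using c(1) \<phi>R xn that by simp
        then show ?thesis
          using linear_mapD[OF Suc.prems(3)[of i]] linear_mapD[OF Suc.prems(3)[of n]] that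
          by (auto simp: linear_map_def l_distr r_distr m_assoc a_ac)
      qed
      fix p assume p: "p \<in> carrier P"
      have sum: "(\<lambda>i. (\<phi> n p \<otimes> c) \<odot>\<^bsub>P\<^esub> (\<phi> i (x n) \<odot>\<^bsub>P\<^esub> x i)) \<in> {..<n} \<rightarrow> carrier P"
        using p \<phi>R xP c(1) xn by auto
      have "\<phi> n p \<odot>\<^bsub>P\<^esub> x n = (\<phi> n p \<otimes> c) \<odot>\<^bsub>P\<^esub> ?s"
        using p \<phi>R c(1) sum_cl[OF xn] by (subst xn_eq) (simp add: P.smult_assoc1)
      also have "\<dots> = (\<Oplus>\<^bsub>P\<^esub>i\<in>{..<n}. (\<phi> n p \<otimes> c) \<odot>\<^bsub>P\<^esub> (\<phi> i (x n) \<odot>\<^bsub>P\<^esub> x i))"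
        using p \<phi>R c(1) summand[OF xn] by (intro P.finsum_smult_ldistr) auto
      finally have "p = (\<Oplus>\<^bsub>P\<^esub>i\<in>{..<n}. (\<phi> n p \<otimes> c) \<odot>\<^bsub>P\<^esub> (\<phi> i (x n) \<odot>\<^bsub>P\<^esub> x i)) \<oplus>\<^bsub>P\<^esub>
          (\<Oplus>\<^bsub>P\<^esub>i\<in>{..<n}. \<phi> i p \<odot>\<^bsub>P\<^esub> x i)"
        using expand[OF p] by simp
      also have "\<dots> = (\<Oplus>\<^bsub>P\<^esub>i\<in>{..<n}. (\<phi> n p \<otimes> c) \<odot>\<^bsub>P\<^esub> (\<phi> i (x n) \<odot>\<^bsub>P\<^esub> x i) \<oplus>\<^bsub>P\<^esub> \<phi> i p \<odot>\<^bsub>P\<^esub> x i)"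
        by (rule P.M.finsum_addf[OF sum summand[OF p], symmetric])
      also have "\<dots> = (\<Oplus>\<^bsub>P\<^esub>i\<in>{..<n}. (\<phi> i p \<oplus> \<phi> n p \<otimes> (c \<otimes> \<phi> i (x n))) \<odot>\<^bsub>P\<^esub> x i)"
      proof (intro P.M.finsum_cong')
        show "(\<lambda>i. (\<phi> i p \<oplus> \<phi> n p \<otimes> (c \<otimes> \<phi> i (x n))) \<odot>\<^bsub>P\<^esub> x i) \<in> {..<n} \<rightarrow> carrier P"
          using p \<phi>R xP c(1) xn by auto
        show "(\<phi> n p \<otimes> c) \<odot>\<^bsub>P\<^esub> (\<phi> i (x n) \<odot>\<^bsub>P\<^esub> x i) \<oplus>\<^bsub>P\<^esub> \<phi> i p \<odot>\<^bsub>P\<^esub> x i =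
            (\<phi> i p \<oplus> \<phi> n p \<otimes> (c \<otimes> \<phi> i (x n))) \<odot>\<^bsub>P\<^esub> x i" if "i \<in> {..<n}" for i
          using that p \<phi>R[of i p] \<phi>R[of n p] \<phi>R[of i "x n"] xP[of i] c(1) xn
          by (simp add: P.smult_l_distr P.smult_assoc1 P.M.a_comm m_assoc)
      qed simp
      finally show "p = (\<Oplus>\<^bsub>P\<^esub>i\<in>{..<n}. (\<phi> i p \<oplus> \<phi> n p \<otimes> (c \<otimes> \<phi> i (x n))) \<odot>\<^bsub>P\<^esub> x i)" .
    qed
  qed
qed

text \<open>Transported along f, the retraction p becomes a map q from R^n to N. The images under q
  of the standard basis and the coordinates of f composed with i form a dual basis of N.\<close>

lemma (in noetherian_local_ring) is_free_if_retract:
  assumes N: "module R N" and free: "is_free R H"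
    and i: "linear_map R N H i" and p: "linear_map R H N p"
    and pi: "\<And>x. x \<in> carrier N \<Longrightarrow> p (i x) = x"
  shows "is_free R N"
proof -
  obtain n f where H: "module R H" and f: "f \<in> mod_hom R H (free_mod R n)"
    "bij_betw f (carrier H) (carrier (free_mod R n))"
    using free unfolding is_free_def by blast
  interpret N: module R N by fact
  interpret f: module_hom R H "free_mod R n" f
    by (intro module_homI H module_free_mod linear_map_if_mod_hom f(1))
  interpret p: module_hom R H N p
    by (intro module_homI H N p)
  have surj: "f ` carrier H = carrier (free_mod R n)" and inj: "inj_on f (carrier H)"
    using f(2) by (auto simp: bij_betw_def simp del: free_mod_simps)
  have "p u = \<zero>\<^bsub>N\<^esub>" if "u \<in> carrier H" "f u = \<zero>\<^bsub>free_mod R n\<^esub>" for u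
    using that inj p.f_zero unfolding f.inj_on_iff_kernel by metis
  then have "\<exists>q\<in>mod_hom R (free_mod R n) N. \<forall>u\<in>carrier H. q (f u) = p u"
    by (rule f.ex_factorization[OF surj N p])
  then obtain q where q: "q \<in> mod_hom R (free_mod R n) N" "\<forall>u\<in>carrier H. q (f u) = p u"
    by (elim bexE)
  interpret q: module_hom R "free_mod R n" N q
    by (intro module_homI N module_free_mod linear_map_if_mod_hom q(1))
  have fi: "f (i x) \<in> carrier (free_mod R n)" if "x \<in> carrier N" for x
    using that linear_mapD(1)[OF i] f.f_simps(1) by blast
  show ?thesis
  proof (rule is_free_if_dual_basis[OF N, where n = n and x = "\<lambda>j. q (basis_vec R n j)"
        and \<phi> = "\<lambda>j x. f (i x) j"])
    show "q (basis_vec R n j) \<in> carrier N" for j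
      using q.f_simps(1) basis_vec_closed by blast
    show "linear_map R N (regular_module R) (\<lambda>x. f (i x) j)" if "j < n" for j
      by (rule linear_map_comp[OF linear_map_comp[OF i f.lin] linear_map_coord[OF that]])
    fix x assume x: "x \<in> carrier N"
    let ?v = "f (i x)"
    have vR: "?v j \<in> carrier R" if "j < n" for j
      using fi[OF x] that by (simp add: PiE_iff)
    have "x = q ?v"
      using q(2) pi[OF x] linear_mapD(1)[OF i x] by simp
    also have "\<dots> = q (\<Oplus>\<^bsub>free_mod R n\<^esub>j\<in>{..<n}. ?v j \<odot>\<^bsub>free_mod R n\<^esub> basis_vec R n j)"
      using free_mod_eq_finsum_basis[OF fi[OF x]] by simp
    also have "\<dots> = (\<Oplus>\<^bsub>N\<^esub>j\<in>{..<n}. q (?v j \<odot>\<^bsub>free_mod R n\<^esub> basis_vec R n j))"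
      using vR basis_vec_closed by (intro q.f_finsum Pi_I f.N.smult_closed) auto
    also have "\<dots> = (\<Oplus>\<^bsub>N\<^esub>j\<in>{..<n}. ?v j \<odot>\<^bsub>N\<^esub> q (basis_vec R n j))"
      using vR basis_vec_closed q.f_simps by (intro N.M.finsum_cong') (auto simp del: free_mod_simps)
    finally show "x = (\<Oplus>\<^bsub>N\<^esub>j\<in>{..<n}. ?v j \<odot>\<^bsub>N\<^esub> q (basis_vec R n j))" .
  qed
qed

section \<open>Freeness of N: a functional on M with value 1, and the splitting it induces\<close>

theorem corollary3p7:
  fixes R :: "('a, 'r) ring_scheme"
    and M :: "('a, 'b, 'c) module_scheme"
    and N :: "('a, 'd, 'e) module_scheme"
    and t :: nat
  assumes "noetherian_local_ring R"
    and "ring_depth R = enat t"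
    and "fin_gen R M" and "fin_gen R N"
    and "M \<in> Deep R" and "N \<in> Omega_Deep R"
    and "is_free R (Hom_mod R M N)"
    and "\<not> zero_module N \<Longrightarrow> \<not> zero_module (Hom_mod R M N)"
    and "\<forall>i\<in>{1..t - 1}. zero_module (Ext R i M N)"
  shows "is_free R N"
proof (cases "zero_module N")
  case True
  interpret noetherian_local_ring R by fact
  show ?thesis
    using assms(4) True by (intro is_free_if_zero_module) (auto simp: fin_gen_def)
next
  case False
  interpret noetherian_local_ring R by fact
  interpret M: module R M using assms(3) by (simp add: fin_gen_def)
  interpret N: module R N using assms(4) by (simp add: fin_gen_def)
  interpret RM: module R "regular_module R" by (rule module_regular)
  let ?H = "Hom_mod R M N"
  interpret H: module R ?H using assms(7) by (simp add: is_free_def)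
  have H_carrier: "carrier ?H = mod_hom R M N"
    by (simp add: Hom_mod_def)

  obtain k and Y :: "('a, (nat \<Rightarrow> 'a) set) module" and \<iota> g where Y: "Y \<in> Deep R"
    and \<iota>: "\<iota> \<in> mod_hom R N (free_mod R k)" "inj_on \<iota> (carrier N)"
    and g: "g \<in> mod_hom R (free_mod R k) Y" "g ` carrier (free_mod R k) = carrier Y"
    and ex: "\<iota> ` carrier N = a_kernel (free_mod R k) Y g"
    using assms(6) unfolding Omega_Deep_def mem_Collect_eq by (elim exE conjE bexE)
  let ?F = "free_mod R k"
  interpret Y: module R Y using Y by (simp add: Deep_def fin_gen_def)
  interpret F: module R ?F by (rule module_free_mod)
  interpret \<iota>: module_hom R N ?F \<iota>
    by (intro module_homI N.module_axioms F.module_axioms linear_map_if_mod_hom \<iota>(1))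
  interpret g: module_hom R ?F Y g
    by (intro module_homI Y.module_axioms F.module_axioms linear_map_if_mod_hom g(1))
  have zero_max: "\<zero>\<^bsub>R\<^esub> \<in> max_ideal R"
    using additive_subgroup.zero_closed[OF ideal.axioms(1)[OF ideal_max_ideal]] .

  have "enat t \<le> depth R (regular_module R)" "enat t \<le> depth R Y"
    using assms(2) Y by (simp_all add: ring_depth_def Deep_def)
  then obtain xs ys where
    xs: "length xs = t" "set xs \<subseteq> max_ideal R" "weakly_regular (regular_module R) {\<zero>\<^bsub>R\<^esub>} xs" and
    ys: "length ys = t" "set ys \<subseteq> max_ideal R" "weakly_regular Y {\<zero>\<^bsub>Y\<^esub>} ys"
    using RM.ex_weakly_regular_if_le_depth[OF _ zero_max] Y.ex_weakly_regular_if_le_depth[OF _ zero_max]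
    by (metis regular_module_simps(2))
  \<comment> \<open>From here on \<open>Y\<close> is represented by R^k modulo the image of
    \<open>N\<close>, so the common sequence is sought for that quotient.\<close>
  have kernel: "{v \<in> carrier ?F. g v \<in> {\<zero>\<^bsub>Y\<^esub>}} = \<iota> ` carrier N"
    unfolding ex by (simp add: a_kernel_def' del: free_mod_simps)
  have "weakly_regular ?F (\<iota> ` carrier N) ys"
    using g.weakly_regular_vimage_iff[OF g(2) Y.submodule_zero, of ys] ys(2,3) max_ideal_subset
    unfolding kernel by blast
  then obtain zs where zs: "length zs = t" "set zs \<subseteq> max_ideal R"
    "weakly_regular (regular_module R) {\<zero>\<^bsub>R\<^esub>} zs" "weakly_regular ?F (\<iota> ` carrier N) zs"
    using ex_common_weakly_regular[OF noetherian_module_regular _ noetherian_module_free_mod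
        \<iota>.submodule_image[OF N.carrier_is_submodule] ideal_max_ideal xs(3,2,1)] ys(1,2)
      RM.submodule_zero by (metis regular_module_simps(2))
  have zsR: "set zs \<subseteq> carrier R"
    using zs(2) max_ideal_subset by blast
  let ?I = "adjoin_seq (regular_module R) {\<zero>\<^bsub>R\<^esub>} zs"
  let ?K = "adjoin_seq N {\<zero>\<^bsub>N\<^esub>} zs"
  obtain s where s: "s \<in> carrier R" "s \<notin> ?I" "\<And>a. a \<in> max_ideal R \<Longrightarrow> a \<otimes>\<^bsub>R\<^esub> s \<in> ?I"
    using ex_socle_element[OF assms(2) zs(2,1,3)] by blast
  have N_reg: "weakly_regular N {\<zero>\<^bsub>N\<^esub>} zs"
    and N_mem: "\<And>y. y \<in> carrier N \<Longrightarrow> \<iota> y \<in> adjoin_seq ?F {\<zero>\<^bsub>?F\<^esub>} zs \<Longrightarrow> y \<in> ?K"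
    using \<iota>.weakly_regular_source[OF \<iota>(2) zsR weakly_regular_free_mod[OF zsR zs(3)] zs(4)] by blast+

  obtain b d e where res: "free_resolution R M b d e" and
    Ext: "\<And>i. Ext R i M N = hom_cohomology R b d N i"
    using Ext_eq_hom_cohomology[OF assms(3)] by blast
  have d_hom: "d i \<in> mod_hom R (free_mod R (b (Suc i))) (free_mod R (b i))" for i
    using res unfolding free_resolution_def by blast
  interpret C: exact_hom_complex R M N b d e t
  proof
    show "free_resolution R M b d e" by fact
    fix i :: nat assume i: "1 \<le> i" "i < t"
    then obtain j where j: "i = Suc j"
      by (cases i) auto
    have "zero_module (hom_cohomology R b d N (Suc j))"
      using assms(9) i unfolding j Ext[symmetric] by auto
    then show "hom_cocycles R b d N i \<subseteq> hom_coboundaries R b d N i"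
      unfolding j using d_hom[of j] by (rule N.hom_cocycles_subset_if_cohomology_zero)
  qed

  obtain n f where f: "f \<in> mod_hom R ?H (free_mod R n)"
    "bij_betw f (carrier ?H) (carrier (free_mod R n))"
    using assms(7) unfolding is_free_def by blast
  interpret f: module_hom R ?H "free_mod R n" f
    by (intro module_homI H.module_axioms module_free_mod linear_map_if_mod_hom f(1))
  \<comment> \<open>Positive rank comes from the hypothesis that Hom(M, N) is nonzero for nonzero N;
    it provides the coordinate 0 tested below.\<close>
  have n: "0 < n"
  proof (rule ccontr)
    assume "\<not> 0 < n"
    then have "carrier (free_mod R n) = {\<zero>\<^bsub>free_mod R n\<^esub>}"
      by (simp add: restrict_def)
    then have "\<forall>h\<in>carrier ?H. f h = \<zero>\<^bsub>free_mod R n\<^esub>"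
      using f.f_simps(1) by blast
    moreover have "inj_on f (carrier ?H)"
      using f(2) by (simp only: bij_betw_def)
    ultimately have "zero_module ?H"
      using H.M.zero_closed unfolding f.inj_on_iff_kernel zero_module_def by blast
    then show False
      using assms(8) False by blast
  qed

  have "\<exists>h\<in>mod_hom R M N. \<exists>m\<in>carrier M. \<exists>i<k. \<iota> (h m) i \<notin> max_ideal R"
  proof (rule ccontr)
    assume *: "\<not> (\<exists>h\<in>mod_hom R M N. \<exists>m\<in>carrier M. \<exists>i<k. \<iota> (h m) i \<notin> max_ideal R)"
    \<comment> \<open>h is the first element of a basis of Hom(M, N). Its coordinate 0 is 1, so s h
      in z Hom(M, N) would force s to lie in (z).\<close>
    obtain h where h: "h \<in> carrier ?H" "f h = basis_vec R n 0"
      using f(2) basis_vec_closed[of n 0] unfolding bij_betw_def by (metis imageE)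
    have h_hom: "h \<in> mod_hom R M N"
      using h(1) H_carrier by simp
    have sh: "s \<odot>\<^bsub>?H\<^esub> h \<in> carrier ?H"
      using h(1) s(1) by (rule H.smult_closed[rotated])
    have "(s \<odot>\<^bsub>?H\<^esub> h) m \<in> ?K" if m: "m \<in> carrier M" for m
    proof -
      have hm: "h m \<in> carrier N"
        using linear_mapD(1)[OF linear_map_if_mod_hom[OF h_hom] m] .
      have v: "\<iota> (h m) \<in> carrier ?F"
        using \<iota>.f_simps(1)[OF hm] .
      have "s \<otimes>\<^bsub>R\<^esub> \<iota> (h m) i \<in> ?I" if "i < k" for i
      proof -
        have "\<iota> (h m) i \<in> max_ideal R"
          using * h_hom m that by blast
        then show ?thesis
          using s(3)[of "\<iota> (h m) i"] s(1) max_ideal_subset by (metis m_comm subsetD)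
      qed
      \<comment> \<open>All coordinates of the image of h m in R^k lie in the maximal ideal, so s
        moves them into (z). The injectivity of N/zN -> (R/z)^k then brings s (h m) into zN.\<close>
      then have "s \<odot>\<^bsub>?F\<^esub> \<iota> (h m) \<in> adjoin_seq ?F {\<zero>\<^bsub>?F\<^esub>} zs"
        unfolding adjoin_seq_free_mod[OF zsR] using F.smult_closed[OF s(1) v] by simp
      then have "s \<odot>\<^bsub>N\<^esub> h m \<in> ?K"
        using N_mem[of "s \<odot>\<^bsub>N\<^esub> h m"] hm s(1) by (simp add: \<iota>.f_simps del: free_mod_simps)
      then show ?thesis
        using m by (simp add: Hom_mod_def)
    qed
    then have "s \<odot>\<^bsub>?H\<^esub> h \<in> adjoin_seq ?H {\<zero>\<^bsub>?H\<^esub>} zs"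
      using sh zs(1) by (intro C.hom_in_adjoin_seq zsR N_reg) (simp_all add: H_carrier)
    moreover
    have c_lin: "linear_map R ?H (regular_module R) (\<lambda>h. f h 0)"
      by (rule linear_map_comp[OF f.lin linear_map_coord[OF n]])
    interpret c: module_hom R ?H "regular_module R" "\<lambda>h. f h 0"
      by (intro module_homI H.module_axioms RM.module_axioms c_lin)
    have "f \<zero>\<^bsub>?H\<^esub> 0 = \<zero>\<^bsub>R\<^esub>"
      using c.f_zero by simp
    ultimately have "f (s \<odot>\<^bsub>?H\<^esub> h) 0 \<in> ?I"
      using c.image_adjoin_seq[of "{\<zero>\<^bsub>?H\<^esub>}" "{\<zero>\<^bsub>R\<^esub>}" zs] zsR H.M.zero_closed by blast
    moreover have "f (s \<odot>\<^bsub>?H\<^esub> h) 0 = s"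
      using c.f_simps(3)[OF s(1) h(1)] h(2) n s(1) by (simp add: basis_vec_def)
    ultimately show False
      using s(2) by simp
  qed
  then obtain h m i where h: "h \<in> mod_hom R M N" and m: "m \<in> carrier M" and i: "i < k"
    and unit: "\<iota> (h m) i \<notin> max_ideal R"
    by blast
  define \<psi> where "\<psi> x = \<iota> (h x) i" for x
  have "linear_map R M (regular_module R) \<psi>"
    unfolding \<psi>_def
    by (rule linear_map_comp[OF linear_map_comp[OF linear_map_if_mod_hom[OF h] \<iota>.lin] linear_map_coord[OF i]])
  then interpret \<psi>: module_hom R M "regular_module R" \<psi>
    by (intro module_homI M.module_axioms RM.module_axioms)
  have \<psi>R: "\<psi> x \<in> carrier R" if "x \<in> carrier M" for x
    using \<psi>.f_simps(1)[OF that] by simp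
  have "\<psi> m \<in> Units R"
    using Units_if_notin_max_ideal[OF \<psi>R[OF m]] unit by (simp add: \<psi>_def)
  \<comment> \<open>Rescaling by the inverse of the unit \<psi> m normalizes the value of \<psi> to
    1.\<close>
  define m' where "m' = inv\<^bsub>R\<^esub> (\<psi> m) \<odot>\<^bsub>M\<^esub> m"
  have m': "m' \<in> carrier M" "\<psi> m' = \<one>\<^bsub>R\<^esub>"
    using \<open>\<psi> m \<in> Units R\<close> m by (simp_all add: m'_def \<psi>.f_simps)

  show ?thesis
  \<comment> \<open>The section sends y to the homomorphism x -> \<psi>(x) y, and the retraction is
    evaluation at m'; they compose to multiplication by \<psi> m' = 1.\<close>
  proof (rule is_free_if_retract[OF N.module_axioms assms(7)])
    have "(\<lambda>x\<in>carrier M. \<psi> x \<odot>\<^bsub>N\<^esub> y) \<in> mod_hom R M N" if "y \<in> carrier N" for y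
    proof (rule restrict_in_mod_hom[OF M.module_axioms])
      show "linear_map R M N (\<lambda>x. \<psi> x \<odot>\<^bsub>N\<^esub> y)"
        using that \<psi>R by (auto simp: linear_map_def \<psi>.f_simps N.smult_l_distr N.smult_assoc1)
    qed
    then show "linear_map R N ?H (\<lambda>y. \<lambda>x\<in>carrier M. \<psi> x \<odot>\<^bsub>N\<^esub> y)"
      using \<psi>R by (auto simp: linear_map_def Hom_mod_def N.smult_r_distr N.smult_assoc1[symmetric] m_comm
          intro!: restrict_ext)
    show "linear_map R ?H N (\<lambda>h. h m')"
      using m'(1) by (auto simp: linear_map_def Hom_mod_def mod_hom_def)
    show "(\<lambda>x\<in>carrier M. \<psi> x \<odot>\<^bsub>N\<^esub> y) m' = y" if "y \<in> carrier N" for y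
      using that m' by simp
  qed
qed

end
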